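(* (i) The $\tau$ function associated with $K=\Gamma_{\Psi^*}\sigma\Gamma_\Psi$ is $\tau(2s)=\det(I-K_s)$, which gives an analytic function on $\Omega$. (ii) Let $q(s)=-2\frac{d^2}{ds^2}\log\tau(2s)$. Then $q(s)$ is meromorphic on $\Omega$, and analytic where $\int_0^\infty x\|\Psi(x+s)\|^2\,dx<1$. (iii) If $0\le K\le I$, then $\tau(s)$ is non-negative for $0<s<\infty$, increasing, and converges to one as $s\to\infty$.
   Context: Let $v(x)=\sum_{j=0}^{2N}a_jx^j$ be a real polynomial with $a_{2N}>0$, and let $\rho$ be its equilibrium measure: the Borel probability measure on $\mathbf{R}$ minimizing $\int v\,d\rho-\iint\log|x-y|\,\rho(dx)\rho(dy)$. Its compact support is $S=\bigcup_{j=1}^{g+1}[\delta_{2j-1},\delta_{2j}]$. Let $u(z)=\int_S\frac{v'(z)-v'(x)}{z-x}\rho(dx)$; let $\delta_1,\dots,\delta_{4N-2}$ be the zeros of $v'(z)^2-4u(z)$ (the first $2g+2$ being the endpoints of $S$ in increasing order), and $w(x)=2Na_{2N}\bigl(-\prod_{j=1}^{4N-2}(x-\delta_j)\bigr)^{1/2}$, so $w^2=4u-v'^2$ and $\rho(dx)=\frac1{2\pi}\mathbf{I}_S(x)w(x)\,dx$. Let $p_j$ be the monic orthogonal polynomials for $\rho$, $h_j=\int_S p_j^2\,d\rho$, $$Y_n(z)=\begin{bmatrix}p_n(z)&\int_S\frac{p_n(t)\rho(dt)}{z-t}\\ \frac{p_{n-1}(z)}{h_{n-1}}&\frac1{h_{n-1}}\int_S\frac{p_{n-1}(t)\rho(dt)}{z-t}\end{bmatrix},$$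 $$A_n(z)=Y_n'Y_n^{-1}+Y_n\begin{bmatrix}0&0\\0&-w'/w\end{bmatrix}Y_n^{-1}=\sum_{j=1}^{4N-2}\frac{\alpha_j(n)}{z-\delta_j},$$ $\beta_j(n)=\alpha_j(n)-\frac12\operatorname{trace}(\alpha_j(n))I_2$, $B_n(z)=\sum_j\frac{\beta_j(n)}{z-\delta_j}$, $J=\begin{bmatrix}0&-1\\1&0\end{bmatrix}$; normalize $\delta_1=0$, $1<\delta_2$. Suppose $\beta_1(n)$ has eigenvalues $\pm\kappa_1(n)$, $\kappa_1=\kappa_1(n)>0$, $2\kappa_1\notin\mathbf{Z}$, and let $Z$ be a $2\times1$ real solution of $Z'=B_nZ$ with $Z(x)\to0$ as $x\to\delta_1$. The matrices $-\delta_kJ\beta_k(n)$ ($k\ge2$) are real symmetric; let $\gamma(n)$ be a block diagonal matrix such that $\gamma(n)^\dagger\sigma_0\gamma(n)=\operatorname{diagonal}[-\delta_kJ\beta_k(n)]_{k=2}^{4N-2}$, where $\sigma_0$ is the block diagonal matrix of signature matrices (diagonal $2\times 2$ blocks with entries in $\{1,-1,0\}$) congruent to the blocks $-\delta_kJ\beta_k(n)$. Define $\psi(x)=\gamma(n)\,\operatorname{column}\bigl[\frac{\sqrt x\,Z(x)}{x-\delta_k}\bigr]_{k=2}^{4N-2}$, and change variable from $x\in(0,1)$ to $t\in(0,\infty)$ by $x=\delta_1+e^{-t}$; in the new variable $$\psi(t)=\sum_{\ell=0}^\infty\chi_\ell e^{-(\kappa_1+\ell+1/2)t},\qquad \chi_\ell\in\mathbf{C}^{8N-6},\quad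 \sum_{\ell}\|\chi_\ell\|<\infty .$$ Let $\Omega=\{z:\Re z>0\}$, and let $\Psi(x)=\begin{bmatrix}0&\psi(x)\\ \psi(\bar x)^\dagger&0\end{bmatrix}$, extended to an analytic function $\Psi:\Omega\to M_{8N-5}(\mathbf{C})$ with $\Psi(x)=\Psi(x)^\dagger$ for $x>0$. For $s\in\Omega$ let $\Psi_{(s)}(x)=\Psi(x+2s)$ and $\Psi^*_{(s)}(x)=\Psi(x+2\bar s)^\dagger$; let $\sigma$ be a constant matrix and $K_s=\Gamma_{\Psi^*_{(s)}}\sigma\Gamma_{\Psi_{(s)}}$, a family of operators on (vector-valued) $L^2(0,\infty)$, where $\Gamma_\Phi f(x)=\int_0^\infty\Phi(x+y)f(y)\,dy$ is the Hankel operator with symbol $\Phi$. $K$ is the same with $s=0$. The $\tau$ function of a trace-class operator $K$ on $L^2(0,\infty)$ is $\tau(t)=\det(I-P_{[t,\infty)}K)$, where $P_{[t,\infty)}f=\mathbf{I}_{[t,\infty)}f$. The norms are operator norms.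
   Formalization: In (ii), analyticity of q is shown where ‖σ‖∫x‖Ψ(x+2s)‖²dx<1 for s in Ω, and under the printed condition ∫x‖Ψ(x+s)‖²dx<1 only for real s>0 with ‖σ‖≤1; as printed it fails for large σ and for non-real s. *)

theory Defs
  imports
    "HOL-Complex_Analysis.Complex_Analysis"
    "HOL-Probability.Probability_Measure"
begin

section \<open>Equilibrium measure and orthogonal polynomials\<close>

definition cpoly :: "real poly \<Rightarrow> complex \<Rightarrow> complex" where
  "cpoly p = poly (map_poly complex_of_real p)"

definition measure_support :: "real measure \<Rightarrow> real set" where
  "measure_support \<mu> = {x. \<forall>U. open U \<and> x \<in> U \<longrightarrow> emeasure \<mu> U > 0}"

text \<open>
  The Borel probability measures of finite energy.  Every other probability measure has
  energy \<open>+\<infinity>\<close>.  In particular an atom makes the logarithmic energy infinite; this has to be said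
  explicitly, because \<open>ln 0 = 0\<close> would hide the contribution of the diagonal.
\<close>

definition finite_energy :: "real poly \<Rightarrow> real measure \<Rightarrow> bool" where
  "finite_energy v \<mu> \<longleftrightarrow>
     prob_space \<mu> \<and> sets \<mu> = sets borel \<and> (\<forall>x. measure \<mu> {x} = 0) \<and>
     integrable \<mu> (poly v) \<and> integrable (\<mu> \<Otimes>\<^sub>M \<mu>) (\<lambda>(x, y). ln \<bar>x - y\<bar>)"

definition energy :: "real poly \<Rightarrow> real measure \<Rightarrow> real" where
  "energy v \<mu> = (LINT x|\<mu>. poly v x) - (LINT z|(\<mu> \<Otimes>\<^sub>M \<mu>). (case z of (x, y) \<Rightarrow> ln \<bar>x - y\<bar>))"

definition is_equilibrium_measure :: "real poly \<Rightarrow> real measure \<Rightarrow> bool" where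
  "is_equilibrium_measure v \<rho> \<longleftrightarrow>
     finite_energy v \<rho> \<and> (\<forall>\<mu>. finite_energy v \<mu> \<longrightarrow> energy v \<rho> \<le> energy v \<mu>)"

definition bands :: "nat \<Rightarrow> (nat \<Rightarrow> complex) \<Rightarrow> real set" where
  "bands g \<delta> = (\<Union>j\<in>{1..g+1}. {Re (\<delta> (2*j - 1)) .. Re (\<delta> (2*j))})"

definition u_fun :: "real poly \<Rightarrow> real measure \<Rightarrow> real set \<Rightarrow> complex \<Rightarrow> complex" where
  "u_fun v \<rho> S z =
     (LINT x:S|\<rho>. (cpoly (pderiv v) z - cpoly (pderiv v) (of_real x)) / (z - of_real x))"

definition w_radicand :: "nat \<Rightarrow> (nat \<Rightarrow> complex) \<Rightarrow> complex \<Rightarrow> complex" where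
  "w_radicand N \<delta> z = - (\<Prod>j=1..4*N-2. z - \<delta> j)"

text \<open>The principal branch is nonnegative on \<open>S\<close>, as required there; \<open>w'/w\<close> does not depend on the branch.\<close>

definition w_fun :: "nat \<Rightarrow> real poly \<Rightarrow> (nat \<Rightarrow> complex) \<Rightarrow> complex \<Rightarrow> complex" where
  "w_fun N v \<delta> z = of_real (2 * real N * coeff v (2*N)) * csqrt (w_radicand N \<delta> z)"

definition monic_orthogonal :: "real measure \<Rightarrow> (nat \<Rightarrow> real poly) \<Rightarrow> bool" where
  "monic_orthogonal \<rho> p \<longleftrightarrow>
     (\<forall>j. degree (p j) = j \<and> lead_coeff (p j) = 1) \<and>
     (\<forall>i j. i \<noteq> j \<longrightarrow> (LINT x|\<rho>. poly (p i) x * poly (p j) x) = 0)"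

definition h_const :: "real measure \<Rightarrow> real set \<Rightarrow> (nat \<Rightarrow> real poly) \<Rightarrow> nat \<Rightarrow> real" where
  "h_const \<rho> S p j = (LINT x:S|\<rho>. (poly (p j) x)\<^sup>2)"

definition cauchy_transform :: "real measure \<Rightarrow> real set \<Rightarrow> real poly \<Rightarrow> complex \<Rightarrow> complex" where
  "cauchy_transform \<rho> S p z = (LINT t:S|\<rho>. of_real (poly p t) / (z - of_real t))"


section \<open>The Magnus--Schlesinger system\<close>

definition Y_mat ::
  "real measure \<Rightarrow> real set \<Rightarrow> (nat \<Rightarrow> real poly) \<Rightarrow> nat \<Rightarrow> complex \<Rightarrow> complex^2^2" where
  "Y_mat \<rho> S p n z = vector
     [vector [cpoly (p n) z, cauchy_transform \<rho> S (p n) z],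
      vector [cpoly (p (n-1)) z / of_real (h_const \<rho> S p (n-1)),
              1 / of_real (h_const \<rho> S p (n-1)) * cauchy_transform \<rho> S (p (n-1)) z]]"

definition mat_deriv :: "(complex \<Rightarrow> complex^'n^'m) \<Rightarrow> complex \<Rightarrow> complex^'n^'m" where
  "mat_deriv F z = (\<chi> i j. deriv (\<lambda>\<zeta>. F \<zeta> $ i $ j) z)"

definition A_mat ::
  "nat \<Rightarrow> real poly \<Rightarrow> real measure \<Rightarrow> real set \<Rightarrow> (nat \<Rightarrow> complex) \<Rightarrow> (nat \<Rightarrow> real poly) \<Rightarrow>
   nat \<Rightarrow> complex \<Rightarrow> complex^2^2" where
  "A_mat N v \<rho> S \<delta> p n z =
     (let Y = Y_mat \<rho> S p n; w = w_fun N v \<delta> in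
        mat_deriv Y z ** matrix_inv (Y z) +
        Y z ** vector [vector [0, 0], vector [0, - (deriv w z / w z)]] ** matrix_inv (Y z))"

definition partial_fractions :: "nat \<Rightarrow> (nat \<Rightarrow> complex) \<Rightarrow> (nat \<Rightarrow> complex^2^2) \<Rightarrow> complex \<Rightarrow> complex^2^2"
  where
  "partial_fractions N \<delta> a z = (\<Sum>j=1..4*N-2. map_matrix (\<lambda>c. c / (z - \<delta> j)) (a j))"

definition beta :: "(nat \<Rightarrow> complex^2^2) \<Rightarrow> nat \<Rightarrow> complex^2^2" where
  "beta \<alpha> j = \<alpha> j - mat (trace (\<alpha> j) / 2)"

definition B_mat :: "nat \<Rightarrow> (nat \<Rightarrow> complex) \<Rightarrow> (nat \<Rightarrow> complex^2^2) \<Rightarrow> complex \<Rightarrow> complex^2^2" where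
  "B_mat N \<delta> \<alpha> = partial_fractions N \<delta> (beta \<alpha>)"

definition J_mat :: "complex^2^2" where
  "J_mat = vector [vector [0, -1], vector [1, 0]]"

definition eigenvalue_of :: "complex^'n^'n \<Rightarrow> complex \<Rightarrow> bool" where
  "eigenvalue_of A c \<longleftrightarrow> (\<exists>x. x \<noteq> 0 \<and> A *v x = c *s x)"

definition cadjoint :: "complex^'n^'m \<Rightarrow> complex^'m^'n" where
  "cadjoint A = (\<chi> i j. cnj (A $ j $ i))"

definition block_diag :: "('k \<Rightarrow> complex^2^2) \<Rightarrow> complex^('k::finite \<times> 2)^('k \<times> 2)" where
  "block_diag D = (\<chi> i j. if fst i = fst j then D (fst i) $ snd i $ snd j else 0)"

definition signature_matrix :: "complex^'n^'n \<Rightarrow> bool" where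
  "signature_matrix A \<longleftrightarrow> (\<forall>i j. if i = j then A $ i $ j \<in> {1, -1, 0} else A $ i $ j = 0)"

definition congruent_matrices :: "complex^'n^'n \<Rightarrow> complex^'n^'n \<Rightarrow> bool" where
  "congruent_matrices A B \<longleftrightarrow> (\<exists>P. invertible P \<and> cadjoint P ** A ** P = B)"

definition real_symmetric :: "complex^'n^'n \<Rightarrow> bool" where
  "real_symmetric A \<longleftrightarrow> transpose A = A \<and> (\<forall>i j. A $ i $ j \<in> \<real>)"

definition residue_block :: "(nat \<Rightarrow> complex) \<Rightarrow> (nat \<Rightarrow> complex^2^2) \<Rightarrow> nat \<Rightarrow> complex^2^2" where
  "residue_block \<delta> \<alpha> k = map_matrix (\<lambda>c. - \<delta> k * c) (J_mat ** beta \<alpha> k)"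

definition cvec :: "real^'n \<Rightarrow> complex^'n" where
  "cvec x = (\<chi> i. of_real (x $ i))"

text \<open>
  The \<open>4N - 3\<close> blocks \<open>k = 2, \<dots>, 4N - 2\<close> are indexed by a finite type \<open>'k\<close>; \<open>pos\<close> gives the
  number \<open>k\<close> of a block.  So \<open>'k \<times> 2\<close> indexes \<open>\<complex>\<^bsup>8N-6\<^esup>\<close> and \<open>'k \<times> 2 + unit\<close> indexes \<open>\<complex>\<^bsup>8N-5\<^esup>\<close>.
\<close>

definition psi_column ::
  "('k::finite \<Rightarrow> nat) \<Rightarrow> (nat \<Rightarrow> complex) \<Rightarrow> ('k \<Rightarrow> complex^2^2) \<Rightarrow> (real \<Rightarrow> real^2) \<Rightarrow> real \<Rightarrow>
   complex^('k \<times> 2)" where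
  "psi_column pos \<delta> \<gamma> Z x =
     block_diag \<gamma> *v (\<chi> i. of_real (sqrt x * Z x $ snd i) / (of_real x - \<delta> (pos (fst i))))"

definition Psi :: "(complex \<Rightarrow> complex^('k::finite \<times> 2)) \<Rightarrow> complex \<Rightarrow>
    complex^('k \<times> 2 + unit)^('k \<times> 2 + unit)" where
  "Psi \<psi> z = (\<chi> i j.
     case (i, j) of
       (Inl a, Inr _) \<Rightarrow> \<psi> z $ a
     | (Inr _, Inl b) \<Rightarrow> cnj (\<psi> (cnj z) $ b)
     | _ \<Rightarrow> 0)"


section \<open>Trace class operators and determinants on \<open>L\<^sup>2((0,\<infinity>); \<complex>\<^sup>m)\<close>\<close>

text \<open>
  Elements of \<open>L\<^sup>2\<close> are represented by functions; only their restriction to \<open>(0,\<infinity>)\<close> up to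
  null sets matters.  Operators are maps between such functions.
\<close>

definition L2 :: "(real \<Rightarrow> complex^'m) set" where
  "L2 = {f. set_borel_measurable lborel {0<..} f \<and>
            set_integrable lborel {0<..} (\<lambda>x. (norm (f x))\<^sup>2)}"

definition l2_inner :: "(real \<Rightarrow> complex^'m) \<Rightarrow> (real \<Rightarrow> complex^'m) \<Rightarrow> complex" where
  "l2_inner f g = (LINT x:{0<..}|lborel. (\<Sum>i\<in>UNIV. cnj (f x $ i) * g x $ i))"

definition l2_norm :: "(real \<Rightarrow> complex^'m) \<Rightarrow> real" where
  "l2_norm f = sqrt (LINT x:{0<..}|lborel. (norm (f x))\<^sup>2)"

type_synonym 'm operator = "(real \<Rightarrow> complex^'m) \<Rightarrow> (real \<Rightarrow> complex^'m)"

text \<open>\<open>T = \<Sum>\<^sub>i \<langle>v\<^sub>i, \<cdot>\<rangle> u\<^sub>i\<close> with \<open>\<Sum>\<^sub>i \<parallel>u\<^sub>i\<parallel> \<parallel>v\<^sub>i\<parallel> < \<infinity>\<close>: the series converges in trace norm.\<close>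

definition nuclear_representation ::
  "'m::finite operator \<Rightarrow> (nat \<Rightarrow> real \<Rightarrow> complex^'m) \<Rightarrow> (nat \<Rightarrow> real \<Rightarrow> complex^'m) \<Rightarrow> bool" where
  "nuclear_representation T u v \<longleftrightarrow>
     (\<forall>i. u i \<in> L2 \<and> v i \<in> L2) \<and>
     summable (\<lambda>i. l2_norm (u i) * l2_norm (v i)) \<and>
     (\<forall>f\<in>L2. T f \<in> L2 \<and>
        (\<lambda>n. l2_norm (\<lambda>x. T f x - (\<Sum>i<n. l2_inner (v i) f *s u i x))) \<longlonglongrightarrow> 0)"

text \<open>On a Hilbert space the nuclear operators are exactly the trace class operators.\<close>

definition trace_class :: "'m::finite operator \<Rightarrow> bool" where
  "trace_class T \<longleftrightarrow> (\<exists>u v. nuclear_representation T u v)"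

definition leibniz_det :: "nat \<Rightarrow> (nat \<Rightarrow> nat \<Rightarrow> complex) \<Rightarrow> complex" where
  "leibniz_det n A = (\<Sum>\<pi> | \<pi> permutes {..<n}. of_int (sign \<pi>) * (\<Prod>i<n. A i (\<pi> i)))"

text \<open>
  \<open>det (I - T)\<close>.  For \<open>F = \<Sum>\<^sub>i\<^sub><\<^sub>n \<langle>v\<^sub>i, \<cdot>\<rangle> u\<^sub>i\<close> of finite rank,
  \<open>det (I - F) = det [\<delta>\<^sub>i\<^sub>j - \<langle>v\<^sub>i, u\<^sub>j\<rangle>]\<close>; the determinant is extended
  to trace class operators by continuity in the trace norm (Gohberg--Goldberg--Krein).  The limit does not
  depend on the nuclear representation, so \<open>THE\<close> is meaningful for every trace class \<open>T\<close>.
\<close>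

definition fredholm_det :: "'m::finite operator \<Rightarrow> complex" where
  "fredholm_det T = (THE d. \<forall>u v. nuclear_representation T u v \<longrightarrow>
     (\<lambda>n. leibniz_det n (\<lambda>i j. (if i = j then 1 else 0) - l2_inner (v i) (u j))) \<longlonglongrightarrow> d)"

definition zero_le_op_le_id :: "'m::finite operator \<Rightarrow> bool" where
  "zero_le_op_le_id T \<longleftrightarrow>
     (\<forall>f\<in>L2. l2_inner f (T f) \<in> \<real> \<and> 0 \<le> Re (l2_inner f (T f)) \<and>
             Re (l2_inner f (T f)) \<le> Re (l2_inner f f))"

definition mat_norm :: "complex^'n^'m \<Rightarrow> real" where
  "mat_norm A = onorm (\<lambda>x. A *v x)"


section \<open>Hankel operators and the \<open>\<tau>\<close> function\<close>

definition right_half_plane :: "complex set" where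
  "right_half_plane = {z. Re z > 0}"

definition hankel :: "(real \<Rightarrow> complex^'m^'m) \<Rightarrow> 'm::finite operator" where
  "hankel \<Phi> f = (\<lambda>x. LINT y:{0<..}|lborel. \<Phi> (x + y) *v f y)"

definition shift_sym :: "(complex \<Rightarrow> complex^'m^'m) \<Rightarrow> complex \<Rightarrow> real \<Rightarrow> complex^'m^'m" where
  "shift_sym \<Psi> s x = \<Psi> (of_real x + 2 * s)"

definition shift_sym_star :: "(complex \<Rightarrow> complex^'m^'m) \<Rightarrow> complex \<Rightarrow> real \<Rightarrow> complex^'m^'m" where
  "shift_sym_star \<Psi> s x = cadjoint (\<Psi> (of_real x + 2 * cnj s))"

definition K_op :: "(complex \<Rightarrow> complex^'m^'m) \<Rightarrow> complex^'m^'m \<Rightarrow> complex \<Rightarrow> 'm::finite operator" where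
  "K_op \<Psi> \<sigma> s f = hankel (shift_sym_star \<Psi> s) (\<lambda>x. \<sigma> *v hankel (shift_sym \<Psi> s) f x)"

definition truncate :: "real \<Rightarrow> 'm::finite operator \<Rightarrow> 'm operator" where
  "truncate t T f = (\<lambda>x. indicator {t..} x *\<^sub>R T f x)"

definition tau :: "'m::finite operator \<Rightarrow> real \<Rightarrow> complex" where
  "tau T t = fredholm_det (truncate t T)"

text \<open>
  \<open>-2 (log F)''\<close>, written with the logarithmic derivative \<open>F'/F\<close> since no single branch of
  the logarithm serves for all arguments.
\<close>

definition minus_two_log_deriv2 :: "(complex \<Rightarrow> complex) \<Rightarrow> complex \<Rightarrow> complex" where
  "minus_two_log_deriv2 F s = - 2 * deriv (\<lambda>z. deriv F z / F z) s"

definition weighted_symbol_norm :: "(complex \<Rightarrow> complex^'m^'m) \<Rightarrow> complex \<Rightarrow> ennreal" where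
  "weighted_symbol_norm \<Psi> s =
     (\<integral>\<^sup>+x\<in>{0<..}. ennreal (x * (mat_norm (\<Psi> (of_real x + s)))\<^sup>2) \<partial>lborel)"

end

theory Submission
  imports Defs "Jordan_Normal_Form.Determinant"
begin

text \<open>
  The symbol is a sum of decaying exponentials: \<open>\<Psi>(z) = \<Sum>\<^sub>l exp(-\<mu>\<^sub>l z) C\<^sub>l\<close> with
  \<open>\<mu>\<^sub>l = \<kappa> + l + 1/2\<close> and \<open>\<Sum>\<^sub>l \<parallel>C\<^sub>l\<parallel> < \<infinity>\<close>.  On the positive half-line this is the expansion of
  \<open>\<psi>\<close>, and it persists on the half-plane \<open>\<Omega>\<close> by analytic continuation.  Integrating the product of two such series
  shows that \<open>K\<^sub>s\<close> is an absolutely convergent sum of rank one operators with kernels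
  \<open>exp(-\<mu>\<^sub>l x) E\<^sub>l\<^sub>m exp(-2 s (\<mu>\<^sub>l + \<mu>\<^sub>m)) exp(-\<mu>\<^sub>m y) / (\<mu>\<^sub>l + \<mu>\<^sub>m)\<close>, where
  \<open>E\<^sub>l\<^sub>m = C\<^sub>l \<sigma> C\<^sub>m\<close>.  Hence \<open>K\<^sub>s\<close> is trace class, and its determinant is the limit of finite determinants whose
  entries are exponentials in \<open>s\<close>.

  The determinant itself is built from finite matrices.  If the entries of \<open>A\<close> are bounded by \<open>p\<^sub>i q\<^sub>j\<close>, then
  Hadamard's inequality bounds the change of \<open>det (I - A)\<close> under enlarging the matrix by one row and column by
  \<open>p\<^sub>n q\<^sub>n\<close> times a constant that depends on \<open>\<Sum>\<^sub>i p\<^sub>i q\<^sub>i\<close> only (\<open>leibniz_det_step\<close>).  For a nuclear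
  representation \<open>\<Sum>\<^sub>i \<langle>v\<^sub>i, \<cdot>\<rangle> u\<^sub>i\<close> this gives convergence of \<open>det [\<delta>\<^sub>i\<^sub>j - \<langle>v\<^sub>i, u\<^sub>j\<rangle>]\<close>, with
  the same rate after every orthogonal projection of the \<open>u\<^sub>i\<close> and \<open>v\<^sub>i\<close>.  After projection to a finite
  orthonormal family \<open>e\<close>, Sylvester's identity turns the limit into \<open>det [\<delta>\<^sub>i\<^sub>j - \<langle>e\<^sub>i, T e\<^sub>j\<rangle>]\<close>, which
  depends on the operator alone.  So the Fredholm determinant is approximated by the determinants of compressions
  (\<open>nuclear_det_approximation\<close>), in particular it does not depend on the representation.

  (i) The entries of the Gram matrix for the truncation of \<open>K\<close> to \<open>[2s, \<infinity>)\<close> and for \<open>K\<^sub>s\<close> differ by conjugation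
  with the diagonal matrix of \<open>exp(-2 s \<mu>\<^sub>l)\<close> (\<open>tau_K\<close>).  The finite determinants converge uniformly on
  \<open>\<Omega>\<close>, so their limit is holomorphic.

  (ii) \<open>q\<close> is built from a holomorphic function by differentiation and division, and is analytic where the determinant
  does not vanish.  A Hankel operator is dominated by a scalar integral operator with Hilbert--Schmidt norm squared
  \<open>\<integral> x \<parallel>\<Psi>(x + 2s)\<parallel>\<^sup>2 dx\<close>, so under the hypothesis \<open>K\<^sub>s\<close> is a strict contraction.  Then the inverses of the
  compressions of \<open>I - K\<^sub>s\<close> are nuclear perturbations of the identity with uniformly bounded determinants, and
  the determinant stays away from zero (\<open>fredholm_det_contraction_nonzero\<close>).

  (iii) If \<open>0 \<le> K \<le> I\<close>, then every compression of \<open>I - K\<close> is a positive semidefinite matrix with diagonal entries at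
  most one.  Its determinant is non-negative and does not grow when the matrix is enlarged, whereas increasing
  \<open>t\<close> shrinks the space \<open>L\<^sup>2(t, \<infinity>)\<close> on which the compressions live (\<open>tau_positive_contraction\<close>).
  The limit one comes from the exponential decay of the kernel.
\<close>

alias truncate = Defs.truncate
no_notation vec_index (infixl "$" 100)
no_notation fps_nth (infixl "$" 75)

section \<open>Determinants of finite matrices\<close>

definition kron :: "nat \<Rightarrow> nat \<Rightarrow> complex" where
  "kron i j = (if i = j then 1 else 0)"

lemma permutes_lessThan_less: "\<pi> permutes {..<n} \<Longrightarrow> i < n \<Longrightarrow> \<pi> i < n" for n :: nat
  using permutes_in_image[of \<pi> "{..<n}" i] by simp

lemma leibniz_det_eq_det: "leibniz_det n A = Determinant.det (Matrix.mat n n (\<lambda>(i, j). A i j))"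
proof -
  have "Determinant.det (Matrix.mat n n (\<lambda>(i, j). A i j))
      = (\<Sum>p | p permutes {0..<n}. of_int (sign p) * (\<Prod>i = 0..<n. Matrix.mat n n (\<lambda>(i, j). A i j) $$ (i, p i)))"
    by (rule det_def') auto
  also have "\<dots> = leibniz_det n A"
    unfolding leibniz_det_def atLeast0LessThan
    by (intro sum.cong refl arg_cong2[where f = "(*)"] prod.cong)
       (auto simp: permutes_lessThan_less)
  finally show ?thesis by simp
qed

lemma leibniz_det_cong:
  assumes "\<And>i j. i < n \<Longrightarrow> j < n \<Longrightarrow> A i j = B i j"
  shows "leibniz_det n A = leibniz_det n B"
  unfolding leibniz_det_eq_det by (intro arg_cong[where f = Determinant.det] eq_matI) (auto simp: assms)

lemma leibniz_det_0 [simp]: "leibniz_det 0 A = 1"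
  by (simp add: leibniz_det_eq_det)

lemma leibniz_det_kron [simp]: "leibniz_det n kron = 1"
proof -
  have "Matrix.mat n n (\<lambda>(i, j). kron i j) = 1\<^sub>m n"
    by (intro eq_matI) (auto simp: kron_def)
  then show ?thesis by (simp add: leibniz_det_eq_det)
qed


lemma tendsto_leibniz_det:
  assumes "\<And>i j. i < n \<Longrightarrow> j < n \<Longrightarrow> ((\<lambda>x. A x i j) \<longlongrightarrow> B i j) F"
  shows "((\<lambda>x. leibniz_det n (A x)) \<longlongrightarrow> leibniz_det n B) F"
  unfolding leibniz_det_def
  by (intro tendsto_intros) (auto simp: permutes_lessThan_less intro!: assms)

lemma holomorphic_leibniz_det:
  assumes "\<And>i j. i < n \<Longrightarrow> j < n \<Longrightarrow> (\<lambda>z. A z i j) holomorphic_on S"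
  shows "(\<lambda>z. leibniz_det n (A z)) holomorphic_on S"
  unfolding leibniz_det_def
  by (intro holomorphic_intros) (auto simp: permutes_lessThan_less intro!: assms)

lemma leibniz_det_cnj_transpose: "leibniz_det n (\<lambda>i j. cnj (A j i)) = cnj (leibniz_det n A)"
proof -
  have "leibniz_det n (\<lambda>i j. cnj (A j i)) = leibniz_det n (\<lambda>i j. cnj (A i j))"
  proof -
    have "Matrix.mat n n (\<lambda>(i, j). cnj (A j i)) = transpose_mat (Matrix.mat n n (\<lambda>(i, j). cnj (A i j)))"
      by (intro eq_matI) auto
    then show ?thesis
      unfolding leibniz_det_eq_det by (metis det_transpose mat_carrier)
  qed
  then show ?thesis
    by (simp add: leibniz_det_def)
qed

lemma leibniz_det_mult:
  "leibniz_det n (\<lambda>i j. \<Sum>k<n. A i k * B k j) = leibniz_det n A * leibniz_det n B"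
proof -
  let ?M = "\<lambda>A::nat\<Rightarrow>nat\<Rightarrow>complex. Matrix.mat n n (\<lambda>(i, j). A i j)"
  have "?M (\<lambda>i j. \<Sum>k<n. A i k * B k j) = ?M A * ?M B"
    by (intro eq_matI) (auto simp: scalar_prod_def atLeast0LessThan)
  then show ?thesis
    unfolding leibniz_det_eq_det by (simp add: det_mult[where n = n])
qed

text \<open>Sylvester's identity, from the two block triangular factorisations of the same matrix.\<close>
lemma leibniz_det_sylvester:
  "leibniz_det N (\<lambda>i j. kron i j - (\<Sum>k<m. V i k * U k j)) =
   leibniz_det m (\<lambda>i j. kron i j - (\<Sum>k<N. U i k * V k j))"
proof -
  let ?V = "Matrix.mat N m (\<lambda>(i, j). V i j)" and ?U = "Matrix.mat m N (\<lambda>(i, j). U i j)"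
  let ?B = "four_block_mat (1\<^sub>m N) ?V ?U (1\<^sub>m m)"
  let ?L = "four_block_mat (1\<^sub>m N) (- ?V) (0\<^sub>m m N) (1\<^sub>m m)"
  have B: "?B \<in> carrier_mat (N + m) (N + m)" and L: "?L \<in> carrier_mat (N + m) (N + m)"
    by auto
  have L1: "Determinant.det ?L = 1"
    by (subst det_four_block_mat_lower_left_zero[of _ N _ m]) auto
  have "?L * ?B = four_block_mat (1\<^sub>m N * 1\<^sub>m N + (- ?V) * ?U) (1\<^sub>m N * ?V + (- ?V) * 1\<^sub>m m)
      (0\<^sub>m m N * 1\<^sub>m N + 1\<^sub>m m * ?U) (0\<^sub>m m N * ?V + 1\<^sub>m m * 1\<^sub>m m)"
    by (rule mult_four_block_mat) auto
  also have "\<dots> = four_block_mat (Matrix.mat N N (\<lambda>(i, j). kron i j - (\<Sum>k<m. V i k * U k j))) (0\<^sub>m N m) ?U (1\<^sub>m m)"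
    by (intro cong_four_block_mat eq_matI)
       (auto simp: scalar_prod_def atLeast0LessThan kron_def sum_negf)
  finally have "Determinant.det (?L * ?B) = leibniz_det N (\<lambda>i j. kron i j - (\<Sum>k<m. V i k * U k j))"
    by (simp add: det_four_block_mat_upper_right_zero[of _ N _ m] leibniz_det_eq_det)
  then have 1: "Determinant.det ?B = leibniz_det N (\<lambda>i j. kron i j - (\<Sum>k<m. V i k * U k j))"
    using det_mult[OF L B] L1 by simp
  have "?B * ?L = four_block_mat (1\<^sub>m N * 1\<^sub>m N + ?V * 0\<^sub>m m N) (1\<^sub>m N * (- ?V) + ?V * 1\<^sub>m m)
      (?U * 1\<^sub>m N + 1\<^sub>m m * 0\<^sub>m m N) (?U * (- ?V) + 1\<^sub>m m * 1\<^sub>m m)"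
    by (rule mult_four_block_mat) auto
  also have "\<dots> = four_block_mat (1\<^sub>m N) (0\<^sub>m N m) ?U (Matrix.mat m m (\<lambda>(i, j). kron i j - (\<Sum>k<N. U i k * V k j)))"
    by (intro cong_four_block_mat eq_matI)
       (auto simp: scalar_prod_def atLeast0LessThan kron_def sum_negf)
  finally have "Determinant.det (?B * ?L) = leibniz_det m (\<lambda>i j. kron i j - (\<Sum>k<N. U i k * V k j))"
    by (simp add: det_four_block_mat_upper_right_zero[of _ N _ m] leibniz_det_eq_det)
  then have 2: "Determinant.det ?B = leibniz_det m (\<lambda>i j. kron i j - (\<Sum>k<N. U i k * V k j))"
    using det_mult[OF B L] L1 by simp
  show ?thesis using 1 2 by simp
qed

text \<open>Subtracting from the last column the combination of the others with coefficients \<open>c\<close>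
  clears it above the diagonal.\<close>
lemma leibniz_det_schur:
  assumes c: "\<And>i. i < n \<Longrightarrow> (\<Sum>j<n. A i j * c j) = A i n"
  shows "leibniz_det (Suc n) A = leibniz_det n A * (A n n - (\<Sum>j<n. A n j * c j))"
proof -
  let ?M = "Matrix.mat n n (\<lambda>(i, j). A i j)"
  let ?B = "four_block_mat ?M (Matrix.mat n 1 (\<lambda>(i, j). A i n)) (Matrix.mat 1 n (\<lambda>(i, j). A n j)) (Matrix.mat 1 1 (\<lambda>_. A n n))"
  let ?L = "four_block_mat (1\<^sub>m n) (Matrix.mat n 1 (\<lambda>(i, j). - c i)) (0\<^sub>m 1 n) (1\<^sub>m 1)"
  let ?s = "A n n - (\<Sum>j<n. A n j * c j)"
  have B: "?B \<in> carrier_mat (n + 1) (n + 1)" and L: "?L \<in> carrier_mat (n + 1) (n + 1)" by auto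
  have L1: "Determinant.det ?L = 1"
    by (subst det_four_block_mat_lower_left_zero[of _ n _ 1]) auto
  have eq: "Matrix.mat (Suc n) (Suc n) (\<lambda>(i, j). A i j) = ?B"
    by (intro eq_matI) (auto simp: less_Suc_eq)
  have "?B * ?L = four_block_mat (?M * 1\<^sub>m n + Matrix.mat n 1 (\<lambda>(i, j). A i n) * 0\<^sub>m 1 n)
     (?M * Matrix.mat n 1 (\<lambda>(i, j). - c i) + Matrix.mat n 1 (\<lambda>(i, j). A i n) * 1\<^sub>m 1)
     (Matrix.mat 1 n (\<lambda>(i, j). A n j) * 1\<^sub>m n + Matrix.mat 1 1 (\<lambda>_. A n n) * 0\<^sub>m 1 n)
     (Matrix.mat 1 n (\<lambda>(i, j). A n j) * Matrix.mat n 1 (\<lambda>(i, j). - c i) + Matrix.mat 1 1 (\<lambda>_. A n n) * 1\<^sub>m 1)"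
    by (rule mult_four_block_mat) auto
  also have "\<dots> = four_block_mat ?M (0\<^sub>m n 1) (Matrix.mat 1 n (\<lambda>(i, j). A n j)) (Matrix.mat 1 1 (\<lambda>_. ?s))"
    by (intro cong_four_block_mat eq_matI)
       (auto simp: scalar_prod_def atLeast0LessThan sum_negf c)
  finally have "Determinant.det (?B * ?L) = Determinant.det ?M * Determinant.det (Matrix.mat 1 1 (\<lambda>_. ?s))"
    by (simp add: det_four_block_mat_upper_right_zero[of _ n _ 1])
  also have "Determinant.det (Matrix.mat 1 1 (\<lambda>_. ?s)) = ?s"
    by (subst det_single) auto
  finally show ?thesis
    unfolding leibniz_det_eq_det eq using det_mult[OF B L] L1 by simp
qed

lemma leibniz_det_eq_0_kernel:
  assumes "leibniz_det n A = 0"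
  obtains c where "\<exists>i<n. c i \<noteq> 0" "\<And>i. i < n \<Longrightarrow> (\<Sum>j<n. A i j * c j) = 0"
proof -
  let ?M = "Matrix.mat n n (\<lambda>(i, j). A i j)"
  have "?M \<in> carrier_mat n n" by auto
  from det_0_iff_vec_prod_zero[OF this] assms
  obtain v where v: "v \<in> carrier_vec n" "v \<noteq> 0\<^sub>v n" "?M *\<^sub>v v = 0\<^sub>v n"
    by (auto simp: leibniz_det_eq_det)
  show ?thesis
  proof (rule that[of "\<lambda>i. vec_index v i"])
    show "\<exists>i<n. vec_index v i \<noteq> 0"
      using v(1,2) by (metis carrier_vecD eq_vecI index_zero_vec)
    fix i assume i: "i < n"
    have "vec_index (?M *\<^sub>v v) i = 0" using v(3) i by simp
    then show "(\<Sum>j<n. A i j * vec_index v j) = 0"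
      using i v(1) by (auto simp: scalar_prod_def atLeast0LessThan)
  qed
qed

lemma leibniz_det_inverse:
  assumes "leibniz_det n A \<noteq> 0"
  obtains R where "\<And>i j. i < n \<Longrightarrow> j < n \<Longrightarrow> (\<Sum>k<n. A i k * R k j) = kron i j"
    "\<And>i j. i < n \<Longrightarrow> j < n \<Longrightarrow> (\<Sum>k<n. R i k * A k j) = kron i j"
proof -
  let ?M = "Matrix.mat n n (\<lambda>(i, j). A i j)"
  have M: "?M \<in> carrier_mat n n" by auto
  have "?M \<in> Units (ring_mat TYPE(complex) n ())"
    using assms by (intro det_non_zero_imp_unit) (auto simp: leibniz_det_eq_det)
  then obtain B where B: "B \<in> carrier_mat n n" "B * ?M = 1\<^sub>m n" "?M * B = 1\<^sub>m n"
    unfolding Units_def by (auto simp: ring_mat_def)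
  show ?thesis
  proof (rule that[of "\<lambda>i j. B $$ (i, j)"])
    fix i j assume ij: "i < n" "j < n"
    have "(?M * B) $$ (i, j) = kron i j" "(B * ?M) $$ (i, j) = kron i j"
      using ij B by (simp_all add: kron_def)
    then show "(\<Sum>k<n. A i k * B $$ (k, j)) = kron i j" "(\<Sum>k<n. B $$ (i, k) * A k j) = kron i j"
      using ij B(1) by (auto simp: scalar_prod_def atLeast0LessThan)
  qed
qed

section \<open>Positive semidefinite matrices and Hadamard's inequality\<close>

definition quad_form :: "nat \<Rightarrow> (nat \<Rightarrow> nat \<Rightarrow> complex) \<Rightarrow> (nat \<Rightarrow> complex) \<Rightarrow> complex" where
  "quad_form n A c = (\<Sum>i<n. \<Sum>j<n. cnj (c i) * A i j * c j)"

definition psd :: "nat \<Rightarrow> (nat \<Rightarrow> nat \<Rightarrow> complex) \<Rightarrow> bool" where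
  "psd n A \<longleftrightarrow> (\<forall>c. Im (quad_form n A c) = 0 \<and> 0 \<le> Re (quad_form n A c))"

definition pd :: "nat \<Rightarrow> (nat \<Rightarrow> nat \<Rightarrow> complex) \<Rightarrow> bool" where
  "pd n A \<longleftrightarrow> psd n A \<and> (\<forall>c. (\<exists>i<n. c i \<noteq> 0) \<longrightarrow> 0 < Re (quad_form n A c))"

lemma quad_form_Suc:
  "quad_form (Suc n) A c = quad_form n A c + (\<Sum>i<n. cnj (c i) * A i n) * c n
     + cnj (c n) * (\<Sum>j<n. A n j * c j) + cnj (c n) * A n n * c n"
  by (simp add: quad_form_def sum.distrib sum_distrib_left sum_distrib_right algebra_simps)

lemma quad_form_restrict: "quad_form n A c = quad_form (Suc n) A (c(n := 0))"
  unfolding quad_form_Suc by (simp add: quad_form_def)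

lemma psd_SucD: "psd (Suc n) A \<Longrightarrow> psd n A"
  unfolding psd_def by (metis quad_form_restrict)

lemma pd_quad_form_pos: "pd n A \<Longrightarrow> i < n \<Longrightarrow> c i \<noteq> 0 \<Longrightarrow> 0 < Re (quad_form n A c)"
  by (auto simp: pd_def)

lemma pd_SucD: assumes "pd (Suc n) A" shows "pd n A"
  unfolding pd_def
proof (intro conjI allI impI)
  show "psd n A" using assms psd_SucD by (auto simp: pd_def)
  fix c :: "nat \<Rightarrow> complex" assume "\<exists>i<n. c i \<noteq> 0"
  then have "\<exists>i<Suc n. (c(n := 0)) i \<noteq> 0" by (metis fun_upd_other less_SucI nat_neq_iff)
  then show "0 < Re (quad_form n A c)"
    using assms quad_form_restrict[of n A c] unfolding pd_def by metis
qed

lemma psd_hermitian: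
  assumes "psd n A" "i < n" "j < n"
  shows "A j i = cnj (A i j)"
proof -
  have inner: "(\<Sum>b<n. A a b * (x * kron i b + y * kron j b)) = A a i * x + A a j * y" for a x y
    using assms(2,3) by (simp add: kron_def distrib_left sum.distrib if_distrib[of "\<lambda>t. _ * t"] cong: if_cong)
  have Q: "quad_form n A (\<lambda>k. x * kron i k + y * kron j k)
      = cnj x * (A i i * x + A i j * y) + cnj y * (A j i * x + A j j * y)" for x y
  proof -
    have "quad_form n A (\<lambda>k. x * kron i k + y * kron j k)
      = (\<Sum>a<n. cnj (x * kron i a + y * kron j a) * (A a i * x + A a j * y))"
      unfolding quad_form_def inner[symmetric] by (simp add: sum_distrib_left mult.assoc)
    also have "\<dots> = cnj x * (A i i * x + A i j * y) + cnj y * (A j i * x + A j j * y)"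
      using assms(2,3)
      by (simp add: kron_def distrib_right sum.distrib if_distrib[of cnj] if_distrib[of "\<lambda>t. _ * t"]
            if_distrib[of "\<lambda>t. t * _"] cong: if_cong)
    finally show ?thesis .
  qed
  have R: "Im (cnj x * (A i i * x + A i j * y) + cnj y * (A j i * x + A j j * y)) = 0" for x y
    using assms(1) unfolding psd_def Q[symmetric] by blast
  show ?thesis
    using R[of 1 0] R[of 0 1] R[of 1 1] R[of 1 \<i>] by (simp add: complex_eq_iff)
qed

lemma psd_diag: assumes "psd n A" "i < n" shows "Im (A i i) = 0" "0 \<le> Re (A i i)"
proof -
  have "quad_form n A (kron i) = A i i"
    unfolding quad_form_def kron_def using assms(2)
    by (simp add: if_distrib[of cnj] if_distrib[of "\<lambda>t. _ * t"] if_distrib[of "\<lambda>t. t * _"] cong: if_cong)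
  then show "Im (A i i) = 0" "0 \<le> Re (A i i)" using assms(1) unfolding psd_def by metis+
qed

text \<open>By induction on the size: the Schur complement of the last diagonal entry is the value of the
  quadratic form at a vector with last coordinate one, hence positive, and it is obtained from that
  entry by subtracting a value of the quadratic form of the smaller matrix.\<close>
lemma pd_det_pos:
  assumes "pd n A"
  shows "Im (leibniz_det n A) = 0 \<and> 0 < Re (leibniz_det n A)"
    and "n = Suc m \<Longrightarrow> Re (leibniz_det n A) \<le> Re (leibniz_det m A) * Re (A m m)"
proof -
  have "Im (leibniz_det n A) = 0 \<and> 0 < Re (leibniz_det n A) \<and>
        (\<forall>m. n = Suc m \<longrightarrow> Re (leibniz_det n A) \<le> Re (leibniz_det m A) * Re (A m m))"
    using assms
  proof (induction n)
    case 0 then show ?case by simp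
  next
    case (Suc n)
    note pd = \<open>pd (Suc n) A\<close>
    have IH: "Im (leibniz_det n A) = 0" "0 < Re (leibniz_det n A)"
      using Suc.IH[OF pd_SucD[OF pd]] by auto
    then have "leibniz_det n A \<noteq> 0" by auto
    then obtain R where R: "\<And>i j. i < n \<Longrightarrow> j < n \<Longrightarrow> (\<Sum>k<n. A i k * R k j) = kron i j"
      and "\<And>i j. i < n \<Longrightarrow> j < n \<Longrightarrow> (\<Sum>k<n. R i k * A k j) = kron i j"
      by (rule leibniz_det_inverse) auto
    define c where "c k = (\<Sum>j<n. R k j * A j n)" for k
    have c: "(\<Sum>j<n. A i j * c j) = A i n" if "i < n" for i
    proof -
      have "(\<Sum>k<n. A i k * c k) = (\<Sum>k<n. \<Sum>j<n. A i k * R k j * A j n)"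
        by (simp add: c_def sum_distrib_left mult.assoc)
      also have "\<dots> = (\<Sum>j<n. (\<Sum>k<n. A i k * R k j) * A j n)"
        by (subst sum.swap) (simp add: sum_distrib_right)
      also have "\<dots> = (\<Sum>j<n. kron i j * A j n)"
        using that R by (intro sum.cong) auto
      also have "\<dots> = A i n" using that by (simp add: kron_def if_distrib[of "\<lambda>t. t * _"] cong: if_cong)
      finally show ?thesis .
    qed
    define t where "t = (\<Sum>j<n. A n j * c j)"
    have det: "leibniz_det (Suc n) A = leibniz_det n A * (A n n - t)"
      unfolding t_def by (rule leibniz_det_schur[OF c])
    have psd: "psd (Suc n) A" using pd by (simp add: pd_def)
    have qc: "quad_form n A c = (\<Sum>i<n. cnj (c i) * A i n)"
      unfolding quad_form_def
      by (intro sum.cong refl) (simp add: sum_distrib_left[symmetric] mult.assoc c)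
    have "t = cnj (quad_form n A c)"
      unfolding t_def qc cnj_sum
      by (intro sum.cong refl) (simp add: psd_hermitian[OF psd, of _ n])
    moreover have "Im (quad_form n A c) = 0" "0 \<le> Re (quad_form n A c)"
      using psd_SucD[OF psd] by (auto simp: psd_def)
    ultimately have t: "Im t = 0" "0 \<le> Re t" by auto
    \<comment> \<open>The Schur complement is the value of the quadratic form at \<open>(-c, 1)\<close>.\<close>
    let ?d = "\<lambda>k. if k = n then 1 else - c k"
    have "quad_form n A ?d = quad_form n A c"
      unfolding quad_form_def by (intro sum.cong) auto
    moreover have "(\<Sum>i<n. cnj (?d i) * A i n) = - (\<Sum>i<n. cnj (c i) * A i n)"
      unfolding sum_negf[symmetric] by (intro sum.cong) auto
    moreover have "(\<Sum>j<n. A n j * ?d j) = - t"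
      unfolding t_def sum_negf[symmetric] by (intro sum.cong) auto
    ultimately have "quad_form (Suc n) A ?d = A n n - t"
      unfolding quad_form_Suc by (simp add: qc)
    moreover have "0 < Re (quad_form (Suc n) A ?d)"
      by (rule pd_quad_form_pos[OF pd, of n]) simp_all
    ultimately have s: "0 < Re (A n n - t)" by simp
    have "Im (A n n) = 0" using psd_diag[OF psd] by simp
    then have si: "Im (A n n - t) = 0" using t by simp
    have "Re (leibniz_det (Suc n) A) = Re (leibniz_det n A) * Re (A n n - t)"
      "Im (leibniz_det (Suc n) A) = 0"
      using si IH unfolding det by auto
    moreover have "Re (leibniz_det n A) * Re (A n n - t) \<le> Re (leibniz_det n A) * Re (A n n)"
      using IH t by (intro mult_left_mono) auto
    ultimately show ?case using IH(2) s by auto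
  qed
  then show "Im (leibniz_det n A) = 0 \<and> 0 < Re (leibniz_det n A)"
    and "n = Suc m \<Longrightarrow> Re (leibniz_det n A) \<le> Re (leibniz_det m A) * Re (A m m)" by auto
qed

lemma psd_perturb_pd:
  assumes "psd n A" "\<epsilon> > 0"
  shows "pd n (\<lambda>i j. A i j + of_real \<epsilon> * kron i j)"
proof -
  have "quad_form n (\<lambda>i j. A i j + of_real \<epsilon> * kron i j) c
      = quad_form n A c + (\<Sum>i<n. \<Sum>j<n. cnj (c i) * (of_real \<epsilon> * kron i j) * c j)" for c
    by (simp add: quad_form_def algebra_simps sum.distrib)
  moreover have "(\<Sum>i<n. \<Sum>j<n. cnj (c i) * (of_real \<epsilon> * kron i j) * c j) = of_real (\<epsilon> * (\<Sum>i<n. (cmod (c i))\<^sup>2))" for c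
  proof -
    have "(\<Sum>i<n. \<Sum>j<n. cnj (c i) * (of_real \<epsilon> * kron i j) * c j) = (\<Sum>i<n. of_real \<epsilon> * (c i * cnj (c i)))"
      by (intro sum.cong refl) (auto simp: kron_def if_distrib[of "\<lambda>t. _ * t"] if_distrib[of "\<lambda>t. t * _"] cong: if_cong)
    then show ?thesis by (simp only: complex_norm_square[symmetric]) (simp add: sum_distrib_left)
  qed
  ultimately have Q: "quad_form n (\<lambda>i j. A i j + of_real \<epsilon> * kron i j) c
      = quad_form n A c + of_real (\<epsilon> * (\<Sum>i<n. (cmod (c i))\<^sup>2))" for c by simp
  have "0 < (\<Sum>i<n. (cmod (c i))\<^sup>2)" if "\<exists>i<n. c i \<noteq> 0" for c
    using that by (auto intro!: sum_pos2)
  then show ?thesis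
    unfolding pd_def psd_def Q using assms by (auto simp: psd_def add_nonneg_pos sum_nonneg)
qed

text \<open>The semidefinite case follows by adding \<open>\<epsilon> I\<close> and letting \<open>\<epsilon> \<longrightarrow> 0\<close>.\<close>
lemma
  assumes "psd n A"
  shows psd_det_real: "Im (leibniz_det n A) = 0"
    and psd_det_nonneg: "0 \<le> Re (leibniz_det n A)"
    and psd_det_Suc: "n = Suc m \<Longrightarrow> Re (leibniz_det n A) \<le> Re (leibniz_det m A) * Re (A m m)"
proof -
  let ?A = "\<lambda>\<epsilon> i j. A i j + of_real \<epsilon> * kron i j"
  have ent: "((\<lambda>\<epsilon>. ?A \<epsilon> i j) \<longlongrightarrow> A i j) (at_right 0)" for i j
  proof -
    have "((\<lambda>\<epsilon>. ?A \<epsilon> i j) \<longlongrightarrow> A i j + of_real 0 * kron i j) (at_right 0)"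
      by (intro tendsto_intros)
    then show ?thesis by simp
  qed
  have lim: "((\<lambda>\<epsilon>. leibniz_det k (?A \<epsilon>)) \<longlongrightarrow> leibniz_det k A) (at_right 0)" for k
    by (rule tendsto_leibniz_det) (rule ent)
  have ev: "\<forall>\<^sub>F \<epsilon> in at_right (0::real). pd n (?A \<epsilon>)"
    using psd_perturb_pd[OF assms] by (auto simp: eventually_at_filter)
  have "((\<lambda>\<epsilon>. Im (leibniz_det n (?A \<epsilon>))) \<longlongrightarrow> Im (leibniz_det n A)) (at_right 0)"
    by (intro tendsto_intros lim)
  moreover have "\<forall>\<^sub>F \<epsilon> in at_right (0::real). Im (leibniz_det n (?A \<epsilon>)) = 0"
    using ev by eventually_elim (use pd_det_pos in blast)
  then have "((\<lambda>\<epsilon>. Im (leibniz_det n (?A \<epsilon>))) \<longlongrightarrow> 0) (at_right 0)"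
    by (rule tendsto_eventually)
  ultimately show "Im (leibniz_det n A) = 0"
    using tendsto_unique trivial_limit_at_right_real by blast
  show "0 \<le> Re (leibniz_det n A)"
  proof (rule tendsto_lowerbound)
    show "((\<lambda>\<epsilon>. Re (leibniz_det n (?A \<epsilon>))) \<longlongrightarrow> Re (leibniz_det n A)) (at_right 0)"
      by (intro tendsto_intros lim)
    show "\<forall>\<^sub>F \<epsilon> in at_right (0::real). 0 \<le> Re (leibniz_det n (?A \<epsilon>))"
      using ev by eventually_elim (use pd_det_pos in force)
  qed auto
  show "Re (leibniz_det n A) \<le> Re (leibniz_det m A) * Re (A m m)" if "n = Suc m"
  proof (rule tendsto_le)
    show "((\<lambda>\<epsilon>. Re (leibniz_det n (?A \<epsilon>))) \<longlongrightarrow> Re (leibniz_det n A)) (at_right 0)"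
      by (intro tendsto_intros lim)
    show "((\<lambda>\<epsilon>. Re (leibniz_det m (?A \<epsilon>)) * Re (?A \<epsilon> m m)) \<longlongrightarrow> Re (leibniz_det m A) * Re (A m m)) (at_right 0)"
      by (intro tendsto_mult tendsto_Re lim ent)
    show "\<forall>\<^sub>F \<epsilon> in at_right (0::real). Re (leibniz_det n (?A \<epsilon>)) \<le> Re (leibniz_det m (?A \<epsilon>)) * Re (?A \<epsilon> m m)"
      using ev by eventually_elim (use pd_det_pos(2) that in blast)
  qed auto
qed

lemma psd_det_le_diag: "psd n A \<Longrightarrow> Re (leibniz_det n A) \<le> (\<Prod>i<n. Re (A i i))"
proof (induction n)
  case (Suc n)
  have "Re (leibniz_det (Suc n) A) \<le> Re (leibniz_det n A) * Re (A n n)"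
    using psd_det_Suc[OF Suc.prems] by simp
  also have "\<dots> \<le> (\<Prod>i<n. Re (A i i)) * Re (A n n)"
    using Suc.IH[OF psd_SucD[OF Suc.prems]] psd_diag[OF Suc.prems, of n] by (intro mult_right_mono) auto
  finally show ?case by simp
qed simp

text \<open>If the diagonal of a positive semidefinite matrix is at most one, enlarging the matrix
  can only decrease the determinant.\<close>
lemma psd_det_antimono:
  assumes "psd n A" "m \<le> n" "\<And>i. i < n \<Longrightarrow> Re (A i i) \<le> 1"
  shows "Re (leibniz_det n A) \<le> Re (leibniz_det m A)"
  using assms(2,1,3)
proof (induction n rule: dec_induct)
  case (step n)
  have "Re (leibniz_det (Suc n) A) \<le> Re (leibniz_det n A) * Re (A n n)"
    using psd_det_Suc[OF step.prems(1)] by simp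
  also have "\<dots> \<le> Re (leibniz_det n A)"
    using psd_det_nonneg[OF psd_SucD[OF step.prems(1)]] step.prems(2)[of n]
    by (intro mult_left_le) auto
  also have "\<dots> \<le> Re (leibniz_det m A)"
    using step.IH psd_SucD[OF step.prems(1)] step.prems(2) by simp
  finally show ?case .
qed simp

text \<open>The matrix \<open>M M\<^sup>*\<close> is positive semidefinite, with determinant \<open>\<bar>det M\<bar>\<^sup>2\<close>.\<close>
lemma hadamard_inequality:
  "(cmod (leibniz_det n M))\<^sup>2 \<le> (\<Prod>i<n. \<Sum>j<n. (cmod (M i j))\<^sup>2)"
proof -
  let ?B = "\<lambda>i j. \<Sum>k<n. M i k * cnj (M j k)"
  have q: "quad_form n ?B c = of_real (\<Sum>k<n. (cmod (\<Sum>i<n. cnj (c i) * M i k))\<^sup>2)" for c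
  proof -
    have "quad_form n ?B c = (\<Sum>i<n. \<Sum>j<n. \<Sum>k<n. (cnj (c i) * M i k) * cnj (cnj (c j) * M j k))"
      by (simp add: quad_form_def sum_distrib_left sum_distrib_right mult_ac)
    also have "\<dots> = (\<Sum>i<n. \<Sum>k<n. \<Sum>j<n. (cnj (c i) * M i k) * cnj (cnj (c j) * M j k))"
      by (intro sum.cong refl sum.swap)
    also have "\<dots> = (\<Sum>k<n. \<Sum>i<n. \<Sum>j<n. (cnj (c i) * M i k) * cnj (cnj (c j) * M j k))"
      by (rule sum.swap)
    also have "\<dots> = (\<Sum>k<n. (\<Sum>i<n. cnj (c i) * M i k) * cnj (\<Sum>i<n. cnj (c i) * M i k))"
      by (simp add: sum_product cnj_sum)
    finally show ?thesis by (simp only: complex_norm_square[symmetric]) simp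
  qed
  have psd: "psd n ?B" unfolding psd_def q by (simp add: sum_nonneg)
  have "leibniz_det n ?B = leibniz_det n M * leibniz_det n (\<lambda>i j. cnj (M j i))"
    by (rule leibniz_det_mult)
  also have "\<dots> = of_real ((cmod (leibniz_det n M))\<^sup>2)"
    unfolding leibniz_det_cnj_transpose by (simp only: complex_norm_square)
  finally have "(cmod (leibniz_det n M))\<^sup>2 = Re (leibniz_det n ?B)" by simp
  also have "\<dots> \<le> (\<Prod>i<n. Re (?B i i))" by (rule psd_det_le_diag[OF psd])
  also have "\<dots> = (\<Prod>i<n. \<Sum>j<n. (cmod (M i j))\<^sup>2)"
    by (simp add: complex_mult_cnj cmod_power2 del: of_real_add)
  finally show ?thesis .
qed

lemma leibniz_det_scale:
  "leibniz_det n (\<lambda>i j. f i * A i j * g j) = (\<Prod>i<n. f i) * (\<Prod>i<n. g i) * leibniz_det n A"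
proof -
  have "(\<Prod>i<n. f i * A i (\<pi> i) * g (\<pi> i)) = (\<Prod>i<n. f i) * (\<Prod>i<n. g i) * (\<Prod>i<n. A i (\<pi> i))"
    if "\<pi> permutes {..<n}" for \<pi>
    using prod.permute[OF that, of g] by (simp add: prod.distrib o_def)
  then show ?thesis
    unfolding leibniz_det_def sum_distrib_left by (intro sum.cong) auto
qed

lemma leibniz_det_unit_last_row:
  assumes "\<And>j. j \<le> n \<Longrightarrow> M n j = kron n j"
  shows "leibniz_det (Suc n) M = leibniz_det n M"
proof -
  let ?M = "Matrix.mat n n (\<lambda>(i, j). M i j)"
  have "Matrix.mat (Suc n) (Suc n) (\<lambda>(i, j). M i j)
     = four_block_mat ?M (Matrix.mat n 1 (\<lambda>(i, j). M i n)) (0\<^sub>m 1 n) (1\<^sub>m 1)"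
    by (intro eq_matI) (auto simp: less_Suc_eq assms kron_def)
  then show ?thesis
    unfolding leibniz_det_eq_det by (simp add: det_four_block_mat_lower_left_zero[of _ n _ 1])
qed

lemma leibniz_det_diff_Suc:
  "leibniz_det (Suc n) (\<lambda>i j. kron i j - A i j) - leibniz_det n (\<lambda>i j. kron i j - A i j)
   = leibniz_det (Suc n) (\<lambda>i j. (if i = n then 0 else kron i j) - A i j)"
proof -
  let ?L = "\<lambda>r i j. if i = n then r j else kron i j - A i j"
  have lin: "leibniz_det (Suc n) (?L (\<lambda>j. r j + r' j)) = leibniz_det (Suc n) (?L r) + leibniz_det (Suc n) (?L r')" for r r'
    unfolding leibniz_det_def by (simp add: sum.distrib[symmetric] algebra_simps)
  have "leibniz_det (Suc n) (\<lambda>i j. kron i j - A i j) = leibniz_det (Suc n) (?L (\<lambda>j. kron n j + (- A n j)))"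
    by (rule leibniz_det_cong) auto
  also have "\<dots> = leibniz_det (Suc n) (?L (kron n)) + leibniz_det (Suc n) (?L (\<lambda>j. - A n j))"
    by (rule lin)
  also have "leibniz_det (Suc n) (?L (kron n)) = leibniz_det n (?L (kron n))"
    by (rule leibniz_det_unit_last_row) simp
  also have "\<dots> = leibniz_det n (\<lambda>i j. kron i j - A i j)"
    by (rule leibniz_det_cong) auto
  also have "leibniz_det (Suc n) (?L (\<lambda>j. - A n j)) = leibniz_det (Suc n) (\<lambda>i j. (if i = n then 0 else kron i j) - A i j)"
    by (rule leibniz_det_cong) auto
  finally show ?thesis by simp
qed

section \<open>Determinants of nuclear perturbations of the identity\<close>

text \<open>Every estimate below depends on the matrix only through a bound \<open>s\<close> for the sum of the products
  of its row and column weights.  It is therefore uniform over all compressions of a nuclear operator.\<close>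
definition det_const :: "real \<Rightarrow> real" where
  "det_const s = exp (s\<^sup>2 + 4 * s)"

lemma det_const_mono: "0 \<le> s \<Longrightarrow> s \<le> s' \<Longrightarrow> det_const s \<le> det_const s'"
  unfolding det_const_def by (simp add: power_mono add_mono)

lemma det_const_pos: "0 < det_const s" by (simp add: det_const_def)

text \<open>The substitute for continuity of the determinant in the trace norm.  Adding a row and a column
  changes the determinant by a determinant whose last row is that of \<open>- A\<close>.  Conjugation by the
  diagonal matrix of \<open>sqrt (q i / p i)\<close> makes the bound on the entries symmetric, \<open>r i * r j\<close> with
  \<open>r i = sqrt (p i * q i)\<close>; dividing the last row and the last column by \<open>r n\<close> extracts the factor
  \<open>p n * q n\<close>.  The remaining row \<open>i\<close> has squared norm at most \<open>1 + O(p i * q i)\<close>, so that the product in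
  Hadamard's inequality stays bounded.\<close>
lemma leibniz_det_step_pos:
  assumes p: "\<And>i. i \<le> n \<Longrightarrow> 0 < p i" and q: "\<And>i. i \<le> n \<Longrightarrow> 0 < q i"
    and A: "\<And>i j. i \<le> n \<Longrightarrow> j \<le> n \<Longrightarrow> cmod (A i j) \<le> p i * q j"
    and s: "(\<Sum>i\<le>n. p i * q i) \<le> s"
  shows "cmod (leibniz_det (Suc n) (\<lambda>i j. kron i j - A i j) - leibniz_det n (\<lambda>i j. kron i j - A i j))
     \<le> p n * q n * det_const s"
proof -
  define r where "r i = sqrt (p i * q i)" for i
  define d where "d i = sqrt (q i / p i)" for i
  define f where "f i = (if i = n then 1 / p n else d i)" for i
  define g where "g i = (if i = n then 1 / q n else 1 / d i)" for i
  let ?M = "\<lambda>i j. (if i = n then 0 else kron i j) - A i j"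
  let ?N = "\<lambda>i j. of_real (f i) * ?M i j * of_real (g j)"
  have r0: "0 < r i" and d0: "0 < d i" and r2: "(r i)\<^sup>2 = p i * q i"
    and dp: "d i * p i = r i" and dq: "q i / d i = r i" if "i \<le> n" for i
  proof -
    note pq = p[OF that] q[OF that]
    show "0 < r i" "0 < d i" "(r i)\<^sup>2 = p i * q i" using pq by (auto simp: r_def d_def)
    show "d i * p i = r i"
      using pq real_sqrt_mult[of "q i / p i" "(p i)\<^sup>2"] by (simp add: r_def d_def power2_eq_square mult.commute)
    have "r i * d i = q i"
      using pq real_sqrt_mult[of "p i * q i" "q i / p i"] by (simp add: r_def d_def)
    then show "q i / d i = r i" using \<open>0 < d i\<close> by (simp add: field_simps)
  qed
  have sr: "(\<Sum>i<n. (r i)\<^sup>2) \<le> s"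
  proof -
    have "(\<Sum>i<n. (r i)\<^sup>2) = (\<Sum>i<n. p i * q i)" using r2 by (intro sum.cong) auto
    also have "\<dots> \<le> (\<Sum>i\<le>n. p i * q i)"
      using p q by (intro sum_mono2) (auto simp: less_imp_le)
    finally show ?thesis using s by simp
  qed
  then have s0: "0 \<le> s" using sum_nonneg[of "{..<n}" "\<lambda>i. (r i)\<^sup>2"] by simp
  have "(\<Prod>i<Suc n. f i) * (\<Prod>i<Suc n. g i) = (\<Prod>i<n. f i * g i) * (f n * g n)"
    by (simp add: prod.distrib)
  also have "(\<Prod>i<n. f i * g i) = 1"
    using d0 by (intro prod.neutral) (auto simp: f_def g_def less_imp_le less_imp_neq[symmetric])
  finally have fg: "(\<Prod>i<Suc n. f i) * (\<Prod>i<Suc n. g i) = 1 / (p n * q n)"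
    by (simp add: f_def g_def)
  have "leibniz_det (Suc n) ?N = of_real (1 / (p n * q n)) * leibniz_det (Suc n) ?M"
    unfolding leibniz_det_scale fg[symmetric] by simp
  then have M: "leibniz_det (Suc n) ?M = of_real (p n * q n) * leibniz_det (Suc n) ?N"
    using p[of n] q[of n] by simp
  have row: "(\<Sum>j<Suc n. (cmod (?N i j))\<^sup>2) \<le> exp ((r i)\<^sup>2 * (3 + s))" if i: "i < n" for i
  proof -
    have e: "(cmod (?N i j))\<^sup>2 \<le> (if i = j then 1 + 2 * (r i)\<^sup>2 else 0) + (r i)\<^sup>2 * (r j)\<^sup>2" if j: "j < n" for j
    proof -
      have eq: "?N i j = kron i j - of_real (d i / d j) * A i j"
        using i j d0[of j] by (auto simp: f_def g_def kron_def algebra_simps)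
      have "cmod (of_real (d i / d j) * A i j) = d i / d j * cmod (A i j)"
        using d0[of i] d0[of j] i j by (simp add: norm_mult norm_divide)
      also have "\<dots> \<le> d i / d j * (p i * q j)"
        using d0[of i] d0[of j] i j A[of i j] by (intro mult_left_mono) auto
      also have "\<dots> = (d i * p i) * (q j / d j)" by simp
      also have "\<dots> = r i * r j" using dp[of i] dq[of j] i j by simp
      finally have b: "cmod (of_real (d i / d j) * A i j) \<le> r i * r j" .
      show ?thesis
      proof (cases "i = j")
        case True
        have "cmod (?N i j) \<le> 1 + r i * r j"
          unfolding eq using norm_triangle_ineq4[of "kron i j" "of_real (d i / d j) * A i j"] b
          by (simp add: kron_def True)
        then have "(cmod (?N i j))\<^sup>2 \<le> (1 + r i * r j)\<^sup>2" by (intro power_mono) auto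
        also have "\<dots> = 1 + 2 * (r i)\<^sup>2 + (r i)\<^sup>2 * (r j)\<^sup>2"
          using True by (simp add: power2_eq_square algebra_simps)
        finally show ?thesis using True by simp
      next
        case False
        have "cmod (?N i j) \<le> r i * r j" unfolding eq using b False by (simp add: kron_def)
        then have "(cmod (?N i j))\<^sup>2 \<le> (r i * r j)\<^sup>2" by (intro power_mono) auto
        then show ?thesis using False by (simp add: power_mult_distrib)
      qed
    qed
    have last: "(cmod (?N i n))\<^sup>2 \<le> (r i)\<^sup>2"
    proof (rule power_mono)
      have "cmod (?N i n) = d i * cmod (A i n) / q n"
        using i d0[of i] q[of n] by (simp add: f_def g_def kron_def norm_mult norm_divide)
      also have "\<dots> \<le> d i * (p i * q n) / q n"
        using i d0[of i] q[of n] A[of i n] by (intro divide_right_mono mult_left_mono) auto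
      also have "\<dots> = r i" using dp[of i] q[of n] i by simp
      finally show "cmod (?N i n) \<le> r i" .
    qed simp
    have "(\<Sum>j<Suc n. (cmod (?N i j))\<^sup>2) \<le> (\<Sum>j<n. (if i = j then 1 + 2 * (r i)\<^sup>2 else 0) + (r i)\<^sup>2 * (r j)\<^sup>2) + (r i)\<^sup>2"
      unfolding sum.lessThan_Suc by (intro add_mono sum_mono last e) simp
    also have "\<dots> = 1 + 2 * (r i)\<^sup>2 + (r i)\<^sup>2 * (\<Sum>j<n. (r j)\<^sup>2) + (r i)\<^sup>2"
      using i by (simp add: sum.distrib sum_distrib_left)
    also have "\<dots> \<le> 1 + 2 * (r i)\<^sup>2 + (r i)\<^sup>2 * s + (r i)\<^sup>2"
      using sr by (intro add_mono mult_left_mono) auto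
    also have "\<dots> = 1 + (r i)\<^sup>2 * (3 + s)" by (simp add: algebra_simps)
    also have "\<dots> \<le> exp ((r i)\<^sup>2 * (3 + s))" by (rule exp_ge_add_one_self)
    finally show ?thesis .
  qed
  have lastrow: "(\<Sum>j<Suc n. (cmod (?N n j))\<^sup>2) \<le> exp s"
  proof -
    have e: "(cmod (?N n j))\<^sup>2 \<le> (r j)\<^sup>2" if j: "j < n" for j
    proof (rule power_mono)
      have "cmod (?N n j) = cmod (A n j) / (p n * d j)"
        using j d0[of j] p[of n] by (simp add: f_def g_def norm_mult norm_divide)
      also have "\<dots> \<le> (p n * q j) / (p n * d j)"
        using j d0[of j] p[of n] A[of n j] by (intro divide_right_mono) auto
      also have "\<dots> = r j" using dq[of j] p[of n] j by simp
      finally show "cmod (?N n j) \<le> r j" .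
    qed simp
    have l: "(cmod (?N n n))\<^sup>2 \<le> 1"
    proof -
      have "cmod (?N n n) = cmod (A n n) / (p n * q n)"
        using q[of n] p[of n] by (simp add: f_def g_def norm_mult norm_divide)
      also have "\<dots> \<le> (p n * q n) / (p n * q n)"
        using q[of n] p[of n] A[of n n] by (intro divide_right_mono) auto
      also have "\<dots> = 1" using q[of n] p[of n] by simp
      finally show ?thesis by (simp add: power_le_one)
    qed
    have "(\<Sum>j<Suc n. (cmod (?N n j))\<^sup>2) \<le> (\<Sum>j<n. (r j)\<^sup>2) + 1"
      unfolding sum.lessThan_Suc by (intro add_mono sum_mono e l) simp
    also have "\<dots> \<le> 1 + s" using sr by simp
    also have "\<dots> \<le> exp s" by (rule exp_ge_add_one_self)
    finally show ?thesis .
  qed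
  have "(cmod (leibniz_det (Suc n) ?N))\<^sup>2 \<le> (\<Prod>i<Suc n. \<Sum>j<Suc n. (cmod (?N i j))\<^sup>2)"
    by (rule hadamard_inequality)
  also have "\<dots> \<le> (\<Prod>i<n. exp ((r i)\<^sup>2 * (3 + s))) * exp s"
    unfolding prod.lessThan_Suc[of _ n]
    by (intro mult_mono prod_mono conjI row lastrow sum_nonneg prod_nonneg) auto
  also have "\<dots> = exp ((\<Sum>i<n. (r i)\<^sup>2) * (3 + s) + s)"
    by (simp add: exp_sum[symmetric] exp_add sum_distrib_right)
  also have "\<dots> \<le> exp (s * (3 + s) + s)"
    using sr s0 by (simp add: mult_right_mono)
  also have "\<dots> = det_const s" by (simp add: det_const_def power2_eq_square algebra_simps)
  finally have sq: "(cmod (leibniz_det (Suc n) ?N))\<^sup>2 \<le> det_const s" .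
  have "1 \<le> det_const s" using s0 by (simp add: det_const_def)
  then have "det_const s \<le> (det_const s)\<^sup>2" by (simp add: power2_eq_square)
  with sq have "(cmod (leibniz_det (Suc n) ?N))\<^sup>2 \<le> (det_const s)\<^sup>2" by linarith
  then have "cmod (leibniz_det (Suc n) ?N) \<le> det_const s"
    using det_const_pos[of s] by (meson less_imp_le power2_le_imp_le)
  then show ?thesis
    unfolding leibniz_det_diff_Suc M using p[of n] q[of n]
    by (simp add: norm_mult mult_left_mono)
qed

text \<open>Vanishing weights are reached by a limit.\<close>
lemma leibniz_det_step:
  assumes p: "\<And>i. 0 \<le> p i" and q: "\<And>i. 0 \<le> q i"
    and A: "\<And>i j. cmod (A i j) \<le> p i * q j"
    and s: "(\<Sum>i\<le>n. p i * q i) \<le> s"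
  shows "cmod (leibniz_det (Suc n) (\<lambda>i j. kron i j - A i j) - leibniz_det n (\<lambda>i j. kron i j - A i j))
     \<le> p n * q n * det_const s"
proof -
  let ?s = "\<Sum>i\<le>n. p i * q i"
  let ?L = "cmod (leibniz_det (Suc n) (\<lambda>i j. kron i j - A i j) - leibniz_det n (\<lambda>i j. kron i j - A i j))"
  let ?f = "\<lambda>\<epsilon>. (p n + \<epsilon>) * (q n + \<epsilon>) * det_const (\<Sum>i\<le>n. (p i + \<epsilon>) * (q i + \<epsilon>))"
  have "isCont ?f 0"
    unfolding det_const_def by (intro continuous_intros)
  then have "(?f \<longlongrightarrow> ?f 0) (at_right 0)"
    by (auto simp: isCont_def intro: filterlim_mono at_le)
  moreover have "\<forall>\<^sub>F \<epsilon> in at_right 0. ?L \<le> ?f \<epsilon>"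
  proof -
    have "?L \<le> ?f \<epsilon>" if "\<epsilon> > 0" for \<epsilon>
    proof (rule leibniz_det_step_pos)
      fix i j
      have "cmod (A i j) \<le> p i * q j" by (rule A)
      also have "\<dots> \<le> (p i + \<epsilon>) * (q j + \<epsilon>)"
        using that p[of i] q[of j] by (intro mult_mono) auto
      finally show "cmod (A i j) \<le> (p i + \<epsilon>) * (q j + \<epsilon>)" .
    qed (use that p q in \<open>auto intro: add_nonneg_pos\<close>)
    then show ?thesis by (auto simp: eventually_at_filter)
  qed
  ultimately have "?L \<le> ?f 0"
    by (intro tendsto_lowerbound[of ?f "?f 0" "at_right 0"]) auto
  also have "\<dots> \<le> p n * q n * det_const s"
    using s p q by (auto intro!: mult_left_mono det_const_mono sum_nonneg)
  finally show ?thesis .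
qed

lemma leibniz_det_tail:
  assumes p: "\<And>i. 0 \<le> p i" and q: "\<And>i. 0 \<le> q i"
    and A: "\<And>i j. cmod (A i j) \<le> p i * q j"
    and sm: "summable (\<lambda>i. p i * q i)" and s: "(\<Sum>i. p i * q i) \<le> s" and "N \<le> n"
  shows "cmod (leibniz_det n (\<lambda>i j. kron i j - A i j) - leibniz_det N (\<lambda>i j. kron i j - A i j))
     \<le> det_const s * (\<Sum>i. p (i + N) * q (i + N))"
proof -
  let ?D = "\<lambda>n. leibniz_det n (\<lambda>i j. kron i j - A i j)"
  have "cmod (?D n - ?D N) \<le> (\<Sum>i=N..<n. p i * q i * det_const s)"
    using \<open>N \<le> n\<close>
  proof (induction n rule: dec_induct)
    case (step n)
    have "(\<Sum>i\<le>n. p i * q i) \<le> (\<Sum>i. p i * q i)"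
      using p q by (intro sum_le_suminf[OF sm]) auto
    with s have "(\<Sum>i\<le>n. p i * q i) \<le> s" by linarith
    from leibniz_det_step[OF p q A this] step
      norm_triangle_ineq[of "?D (Suc n) - ?D n" "?D n - ?D N"]
    show ?case by simp
  qed simp
  also have "\<dots> = (\<Sum>i<n-N. p (i + N) * q (i + N)) * det_const s"
    unfolding sum_distrib_right[symmetric]
    by (subst sum.atLeastLessThan_shift_0) (simp add: atLeast0LessThan o_def add.commute[of N])
  also have "\<dots> \<le> (\<Sum>i. p (i + N) * q (i + N)) * det_const s"
    using p q sm det_const_pos[of s]
    by (intro mult_right_mono sum_le_suminf) (auto simp: summable_iff_shift[of "\<lambda>i. p i * q i"])
  finally show ?thesis by (simp add: mult.commute)
qed

lemma suminf_tail_tendsto_0: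
  fixes f :: "nat \<Rightarrow> real"
  assumes "summable f" shows "(\<lambda>N. \<Sum>i. f (i + N)) \<longlonglongrightarrow> 0"
  using suminf_exist_split2[OF assms] by simp

lemma leibniz_det_convergent:
  assumes p: "\<And>i. 0 \<le> p i" and q: "\<And>i. 0 \<le> q i"
    and A: "\<And>i j. cmod (A i j) \<le> p i * q j"
    and sm: "summable (\<lambda>i. p i * q i)"
  shows "convergent (\<lambda>n. leibniz_det n (\<lambda>i j. kron i j - A i j))"
proof (rule Cauchy_convergent)
  let ?D = "\<lambda>n. leibniz_det n (\<lambda>i j. kron i j - A i j)"
  let ?s = "\<Sum>i. p i * q i"
  show "Cauchy ?D"
  proof (rule metric_CauchyI)
    fix e :: real assume "e > 0"
    have "(\<lambda>N. det_const ?s * (\<Sum>i. p (i + N) * q (i + N))) \<longlonglongrightarrow> det_const ?s * 0"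
      by (intro tendsto_mult tendsto_const suminf_tail_tendsto_0[OF sm])
    then have "\<forall>\<^sub>F N in sequentially. det_const ?s * (\<Sum>i. p (i + N) * q (i + N)) < e / 2"
      using \<open>e > 0\<close> by (intro order_tendstoD) auto
    then obtain N where N: "det_const ?s * (\<Sum>i. p (i + N) * q (i + N)) < e / 2"
      by (auto simp: eventually_sequentially)
    have b: "dist (?D n) (?D N) < e / 2" if "n \<ge> N" for n
      using leibniz_det_tail[OF p q A sm order_refl that] N by (simp add: dist_norm)
    show "\<exists>M. \<forall>m\<ge>M. \<forall>n\<ge>M. dist (?D m) (?D n) < e"
      using dist_triangle_half_l[OF b b] by blast
  qed
qed

lemma leibniz_det_limit_tail:
  assumes p: "\<And>i. 0 \<le> p i" and q: "\<And>i. 0 \<le> q i"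
    and A: "\<And>i j. cmod (A i j) \<le> p i * q j"
    and sm: "summable (\<lambda>i. p i * q i)" and s: "(\<Sum>i. p i * q i) \<le> s"
    and L: "(\<lambda>n. leibniz_det n (\<lambda>i j. kron i j - A i j)) \<longlonglongrightarrow> L"
  shows "cmod (L - leibniz_det N (\<lambda>i j. kron i j - A i j))
     \<le> det_const s * (\<Sum>i. p (i + N) * q (i + N))"
proof (rule tendsto_upperbound)
  show "(\<lambda>n. cmod (leibniz_det n (\<lambda>i j. kron i j - A i j) - leibniz_det N (\<lambda>i j. kron i j - A i j)))
     \<longlonglongrightarrow> cmod (L - leibniz_det N (\<lambda>i j. kron i j - A i j))"
    by (intro tendsto_intros L)
  show "\<forall>\<^sub>F n in sequentially. cmod (leibniz_det n (\<lambda>i j. kron i j - A i j) - leibniz_det N (\<lambda>i j. kron i j - A i j))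
     \<le> det_const s * (\<Sum>i. p (i + N) * q (i + N))"
    using eventually_ge_at_top[of N] by eventually_elim (rule leibniz_det_tail[OF p q A sm s])
qed simp

section \<open>The Hilbert space of the half-line\<close>

definition half_line :: "real measure" where
  "half_line = restrict_space lborel {0<..}"

lemma space_half_line [simp]: "space half_line = {0<..}"
  by (simp add: half_line_def space_restrict_space)

lemma set_lebesgue_integral_half_line:
  fixes f :: "real \<Rightarrow> 'b::{banach, second_countable_topology}"
  shows "(LINT x:{0<..}|lborel. f x) = (\<integral>x. f x \<partial>half_line)"
  unfolding half_line_def set_lebesgue_integral_def by (subst integral_restrict_space) auto

lemma set_integrable_half_line:
  fixes f :: "real \<Rightarrow> 'b::{banach, second_countable_topology}"
  shows "set_integrable lborel {0<..} f \<longleftrightarrow> integrable half_line f"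
  unfolding half_line_def by (subst set_integrable_eq) auto

lemma set_borel_measurable_half_line:
  fixes f :: "real \<Rightarrow> 'b::real_normed_vector"
  shows "set_borel_measurable lborel {0<..} f \<longleftrightarrow> f \<in> borel_measurable half_line"
  unfolding half_line_def set_borel_measurable_def by (subst borel_measurable_restrict_space_iff) auto

lemma measurable_half_line [measurable (raw)]: "f \<in> borel_measurable borel \<Longrightarrow> f \<in> borel_measurable half_line"
  unfolding half_line_def by (rule measurable_restrict_space1) simp

definition cdot :: "complex^'m \<Rightarrow> complex^'m \<Rightarrow> complex" where
  "cdot a b = (\<Sum>i\<in>UNIV. cnj (a $ i) * b $ i)"

lemma cdot_self: "cdot a a = of_real ((norm a)\<^sup>2)"
proof -
  have "cdot a a = (\<Sum>i\<in>UNIV. of_real ((cmod (a $ i))\<^sup>2))"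
    unfolding cdot_def by (simp add: complex_norm_square mult.commute del: of_real_power)
  also have "\<dots> = of_real ((norm a)\<^sup>2)"
    by (simp add: norm_vec_def L2_set_def sum_nonneg del: of_real_power)
  finally show ?thesis .
qed

lemma norm_cdot_le: "cmod (cdot a b) \<le> norm a * norm b"
proof -
  have "cmod (cdot a b) \<le> (\<Sum>i\<in>UNIV. \<bar>cmod (a $ i)\<bar> * \<bar>cmod (b $ i)\<bar>)"
    unfolding cdot_def by (rule order.trans[OF norm_sum]) (simp add: norm_mult)
  also have "\<dots> \<le> norm a * norm b"
    unfolding norm_vec_def by (rule L2_set_mult_ineq)
  finally show ?thesis .
qed

lemma norm_cvec_scale: "norm (c *s a) = cmod c * norm (a :: complex^'m)"
  by (simp add: norm_vec_def L2_set_def norm_mult power_mult_distrib sum_distrib_left[symmetric] real_sqrt_mult)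

lemma borel_measurable_vec_nth [measurable (raw)]:
  "f \<in> borel_measurable M \<Longrightarrow> (\<lambda>x. (f x :: complex^'m::finite) $ i) \<in> borel_measurable M"
  by (rule borel_measurable_continuous_on[of "\<lambda>v::complex^'m. v $ i" f M])
     (rule linear_continuous_on[OF bounded_linear_vec_nth])

lemma borel_measurable_cdot [measurable (raw)]:
  "f \<in> borel_measurable M \<Longrightarrow> g \<in> borel_measurable M \<Longrightarrow>
    (\<lambda>x. cdot (f x :: complex^'m::finite) (g x)) \<in> borel_measurable M"
  unfolding cdot_def
  by (intro borel_measurable_sum borel_measurable_times borel_measurable_vec_nth
        borel_measurable_continuous_on[of cnj]) (auto intro: continuous_intros)

lemma borel_measurable_vecI:
  assumes "\<And>i. (\<lambda>x. (f x :: complex^'m::finite) $ i) \<in> borel_measurable M"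
  shows "f \<in> borel_measurable M"
proof -
  have "(\<lambda>x. f x \<bullet> b) \<in> borel_measurable M" if "b \<in> Basis" for b :: "complex^'m"
  proof -
    from that obtain i c where "b = axis i c" by (auto simp: Basis_vec_def)
    then have "(\<lambda>x. f x \<bullet> b) = (\<lambda>x. f x $ i \<bullet> c)" by (simp add: inner_axis)
    then show ?thesis using assms[of i] by simp
  qed
  then show ?thesis by (subst borel_measurable_euclidean_space) blast
qed

lemma borel_measurable_cvec_scale [measurable (raw)]:
  "f \<in> borel_measurable M \<Longrightarrow> (\<lambda>x. c *s (f x :: complex^'m::finite)) \<in> borel_measurable M"
  by (rule borel_measurable_vecI) simp

lemma diff_conv_scale: "a - b = a + (- 1) *s (b :: complex^'m)"
  by (simp add: vec_eq_iff)

lemma L2_iff: "f \<in> L2 \<longleftrightarrow> f \<in> borel_measurable half_line \<and> integrable half_line (\<lambda>x. (norm (f x))\<^sup>2)"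
  by (simp add: L2_def set_borel_measurable_half_line set_integrable_half_line)

lemma l2_inner_eq: "l2_inner f g = (\<integral>x. cdot (f x) (g x) \<partial>half_line)"
  by (simp add: l2_inner_def set_lebesgue_integral_half_line cdot_def)

lemma l2_norm_eq: "l2_norm f = sqrt (\<integral>x. (norm (f x))\<^sup>2 \<partial>half_line)"
  by (simp add: l2_norm_def set_lebesgue_integral_half_line)

lemma l2_norm_nonneg [simp]: "0 \<le> l2_norm f"
  by (simp add: l2_norm_eq)

lemma l2_norm_square: "(l2_norm f)\<^sup>2 = (\<integral>x. (norm (f x))\<^sup>2 \<partial>half_line)"
  by (simp add: l2_norm_eq)

lemma L2_measurable: "f \<in> L2 \<Longrightarrow> f \<in> borel_measurable half_line"
  and L2_integrable: "f \<in> L2 \<Longrightarrow> integrable half_line (\<lambda>x. (norm (f x))\<^sup>2)"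
  by (simp_all add: L2_iff)

lemma L2_I_bound:
  assumes "f \<in> borel_measurable half_line" "integrable half_line g" "\<And>x. 0 < x \<Longrightarrow> (norm (f x))\<^sup>2 \<le> g x"
  shows "f \<in> L2"
  unfolding L2_iff
proof
  show "integrable half_line (\<lambda>x. (norm (f x))\<^sup>2)"
  proof (rule Bochner_Integration.integrable_bound[OF assms(2)])
    show "AE x in half_line. norm ((norm (f x))\<^sup>2) \<le> norm (g x)"
      using assms(3) by (intro AE_I2) (auto intro: order.trans[OF _ abs_ge_self])
  qed (use assms(1) in measurable)
qed fact

lemma L2_zero [simp]: "(\<lambda>x. 0) \<in> L2"
  by (simp add: L2_iff)

lemma L2_add_scale:
  assumes "f \<in> L2" "g \<in> L2"
  shows "(\<lambda>x. f x + c *s g x) \<in> L2"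
proof (rule L2_I_bound)
  show "(\<lambda>x. f x + c *s g x) \<in> borel_measurable half_line"
    by (intro borel_measurable_add borel_measurable_cvec_scale L2_measurable assms)
  show "integrable half_line (\<lambda>x. 2 * (norm (f x))\<^sup>2 + 2 * ((cmod c)\<^sup>2 * (norm (g x))\<^sup>2))"
    using assms by (auto intro!: L2_integrable)
  fix x
  have "(norm (f x + c *s g x))\<^sup>2 \<le> (norm (f x) + cmod c * norm (g x))\<^sup>2"
    by (intro power_mono) (auto intro: norm_triangle_le simp: norm_cvec_scale)
  also have "\<dots> \<le> 2 * (norm (f x))\<^sup>2 + 2 * ((cmod c)\<^sup>2 * (norm (g x))\<^sup>2)"
    using sum_squares_ge_zero[of "norm (f x) - cmod c * norm (g x)" 0]
    by (simp add: power2_eq_square algebra_simps)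
  finally show "(norm (f x + c *s g x))\<^sup>2 \<le> \<dots>" .
qed

lemma L2_scale: "g \<in> L2 \<Longrightarrow> (\<lambda>x. c *s g x) \<in> L2"
  using L2_add_scale[OF L2_zero, of g c] by simp

lemma L2_diff: "f \<in> L2 \<Longrightarrow> g \<in> L2 \<Longrightarrow> (\<lambda>x. f x - g x) \<in> L2"
  unfolding diff_conv_scale by (rule L2_add_scale)

lemma L2_sum: "(\<And>k. k < n \<Longrightarrow> e k \<in> L2) \<Longrightarrow> (\<lambda>x. \<Sum>k<n. c k *s e k x) \<in> L2" for n :: nat
  by (induction n) (auto intro: L2_add_scale)

lemma integrable_norm_mult:
  assumes "f \<in> L2" "g \<in> L2"
  shows "integrable half_line (\<lambda>x. norm (f x) * norm (g x))"
proof (rule Bochner_Integration.integrable_bound)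
  show "integrable half_line (\<lambda>x. (norm (f x))\<^sup>2 + (norm (g x))\<^sup>2)"
    using assms by (auto intro!: L2_integrable)
  have [measurable]: "f \<in> borel_measurable half_line" "g \<in> borel_measurable half_line"
    using assms by (auto intro: L2_measurable)
  show "(\<lambda>x. norm (f x) * norm (g x)) \<in> borel_measurable half_line"
    by measurable
  show "AE x in half_line. norm (norm (f x) * norm (g x)) \<le> norm ((norm (f x))\<^sup>2 + (norm (g x))\<^sup>2)"
  proof (rule AE_I2)
    fix x
    have "2 * (norm (f x) * norm (g x)) \<le> (norm (f x))\<^sup>2 + (norm (g x))\<^sup>2"
      using sum_squares_bound[of "norm (f x)" "norm (g x)"] by (simp add: mult.assoc)
    moreover have "0 \<le> norm (f x) * norm (g x)" by simp
    ultimately have "norm (f x) * norm (g x) \<le> (norm (f x))\<^sup>2 + (norm (g x))\<^sup>2" by linarith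
    then show "norm (norm (f x) * norm (g x)) \<le> norm ((norm (f x))\<^sup>2 + (norm (g x))\<^sup>2)"
      by simp
  qed
qed

lemma integral_norm_mult_le:
  assumes "f \<in> L2" "g \<in> L2"
  shows "(\<integral>x. norm (f x) * norm (g x) \<partial>half_line) \<le> l2_norm f * l2_norm g"
proof -
  have [measurable]: "f \<in> borel_measurable half_line" "g \<in> borel_measurable half_line"
    using assms by (auto intro: L2_measurable)
  let ?I = "\<integral>x. norm (f x) * norm (g x) \<partial>half_line"
  have I0: "0 \<le> ?I" by simp
  have "(\<integral>\<^sup>+x. ennreal (norm (f x)) * ennreal (norm (g x)) \<partial>half_line)\<^sup>2
     \<le> (\<integral>\<^sup>+x. (ennreal (norm (f x)))\<^sup>2 \<partial>half_line) * (\<integral>\<^sup>+x. (ennreal (norm (g x)))\<^sup>2 \<partial>half_line)"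
    by (rule Cauchy_Schwarz_nn_integral) auto
  also have "(\<integral>\<^sup>+x. ennreal (norm (f x)) * ennreal (norm (g x)) \<partial>half_line) = ennreal ?I"
    using nn_integral_eq_integral[OF integrable_norm_mult[OF assms]] by (simp add: ennreal_mult)
  also have "(\<integral>\<^sup>+x. (ennreal (norm (f x)))\<^sup>2 \<partial>half_line) = ennreal ((l2_norm f)\<^sup>2)"
    unfolding l2_norm_square
    using nn_integral_eq_integral[OF L2_integrable[OF assms(1)]] by (simp add: ennreal_power)
  also have "(\<integral>\<^sup>+x. (ennreal (norm (g x)))\<^sup>2 \<partial>half_line) = ennreal ((l2_norm g)\<^sup>2)"
    unfolding l2_norm_square
    using nn_integral_eq_integral[OF L2_integrable[OF assms(2)]] by (simp add: ennreal_power)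
  finally have "ennreal (?I\<^sup>2) \<le> ennreal ((l2_norm f * l2_norm g)\<^sup>2)"
    using I0 by (simp add: ennreal_power ennreal_mult power_mult_distrib)
  then have "?I\<^sup>2 \<le> (l2_norm f * l2_norm g)\<^sup>2" by simp
  then show ?thesis by (rule power2_le_imp_le) simp
qed

lemma integrable_cdot:
  assumes "f \<in> L2" "g \<in> L2"
  shows "integrable half_line (\<lambda>x. cdot (f x) (g x))"
proof (rule Bochner_Integration.integrable_bound[OF integrable_norm_mult[OF assms]])
  show "(\<lambda>x. cdot (f x) (g x)) \<in> borel_measurable half_line"
    using assms by (auto intro!: borel_measurable_cdot L2_measurable)
qed (auto simp: norm_cdot_le)

lemma l2_cauchy_schwarz:
  assumes "f \<in> L2" "g \<in> L2"
  shows "cmod (l2_inner f g) \<le> l2_norm f * l2_norm g"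
proof -
  have "cmod (l2_inner f g) \<le> (\<integral>x. cmod (cdot (f x) (g x)) \<partial>half_line)"
    unfolding l2_inner_eq by (rule integral_norm_bound)
  also have "\<dots> \<le> (\<integral>x. norm (f x) * norm (g x) \<partial>half_line)"
    by (intro integral_mono integrable_norm integrable_cdot integrable_norm_mult assms norm_cdot_le)
  also have "\<dots> \<le> l2_norm f * l2_norm g" by (rule integral_norm_mult_le[OF assms])
  finally show ?thesis .
qed

lemma l2_inner_self: "l2_inner f f = of_real ((l2_norm f)\<^sup>2)"
  unfolding l2_inner_eq cdot_self l2_norm_square by (rule integral_complex_of_real)

lemma l2_inner_commute: "l2_inner g f = cnj (l2_inner f g)"
proof -
  have "cdot (g x) (f x) = cnj (cdot (f x) (g x))" for x
    by (simp add: cdot_def mult.commute)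
  then show ?thesis unfolding l2_inner_eq by simp
qed

lemma l2_inner_add_scale_right:
  assumes "h \<in> L2" "f \<in> L2" "g \<in> L2"
  shows "l2_inner h (\<lambda>x. f x + c *s g x) = l2_inner h f + c * l2_inner h g"
proof -
  have "cdot (h x) (f x + c *s g x) = cdot (h x) (f x) + c * cdot (h x) (g x)" for x
    by (simp add: cdot_def sum.distrib sum_distrib_left algebra_simps)
  then show ?thesis
    unfolding l2_inner_eq using assms by (simp add: integrable_cdot)
qed

lemma l2_inner_diff_right:
  "h \<in> L2 \<Longrightarrow> f \<in> L2 \<Longrightarrow> g \<in> L2 \<Longrightarrow> l2_inner h (\<lambda>x. f x - g x) = l2_inner h f - l2_inner h g"
  unfolding diff_conv_scale by (subst l2_inner_add_scale_right) auto

lemma l2_inner_zero_right [simp]: "l2_inner h (\<lambda>x. 0) = 0"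
  by (simp add: l2_inner_eq cdot_def)

lemma l2_inner_scale_right:
  "h \<in> L2 \<Longrightarrow> g \<in> L2 \<Longrightarrow> l2_inner h (\<lambda>x. c *s g x) = c * l2_inner h g"
  using l2_inner_add_scale_right[of h "\<lambda>x. 0" g c] by simp

lemma l2_inner_sum_right:
  fixes n :: nat
  assumes "h \<in> L2"
  shows "(\<And>k. k < n \<Longrightarrow> e k \<in> L2) \<Longrightarrow> l2_inner h (\<lambda>x. \<Sum>k<n. c k *s e k x) = (\<Sum>k<n. c k * l2_inner h (e k))"
  by (induction n) (auto simp: l2_inner_add_scale_right[OF assms] L2_sum)

lemma l2_norm_scale: "l2_norm (\<lambda>x. c *s g x) = cmod c * l2_norm g"
  unfolding l2_norm_eq by (simp add: norm_cvec_scale power_mult_distrib real_sqrt_mult)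

section \<open>Orthonormal families\<close>

definition l2_subspace :: "(real \<Rightarrow> complex^'m) set \<Rightarrow> bool" where
  "l2_subspace V \<longleftrightarrow> V \<subseteq> L2 \<and> (\<lambda>x. 0) \<in> V \<and> (\<forall>f\<in>V. \<forall>g\<in>V. \<forall>c. (\<lambda>x. f x + c *s g x) \<in> V)"

definition orthonormal :: "nat \<Rightarrow> (nat \<Rightarrow> real \<Rightarrow> complex^'m::finite) \<Rightarrow> bool" where
  "orthonormal m e \<longleftrightarrow> (\<forall>i<m. e i \<in> L2) \<and> (\<forall>i<m. \<forall>j<m. l2_inner (e i) (e j) = kron i j)"

text \<open>That \<open>w\<close> agrees almost everywhere with its orthogonal projection on the span of \<open>e\<close>,
  in the form of Parseval's identity.\<close>
definition spans :: "nat \<Rightarrow> (nat \<Rightarrow> real \<Rightarrow> complex^'m::finite) \<Rightarrow> (real \<Rightarrow> complex^'m) \<Rightarrow> bool" where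
  "spans m e w \<longleftrightarrow> (\<forall>y\<in>L2. l2_inner y w = (\<Sum>k<m. l2_inner y (e k) * l2_inner (e k) w))"

lemma l2_subspace_add_scale:
  "l2_subspace V \<Longrightarrow> f \<in> V \<Longrightarrow> g \<in> V \<Longrightarrow> (\<lambda>x. f x + c *s g x) \<in> V"
  by (auto simp: l2_subspace_def)

lemma l2_subspace_sum:
  fixes n :: nat
  assumes "l2_subspace V"
  shows "(\<And>k. k < n \<Longrightarrow> e k \<in> V) \<Longrightarrow> (\<lambda>x. \<Sum>k<n. c k *s e k x) \<in> V"
  using assms by (induction n) (auto simp: l2_subspace_def)

text \<open>If the residual of \<open>w\<close> has norm zero, then \<open>w\<close> is spanned already; otherwise the normalised residual is
  appended.  Vectors spanned before are orthogonal to it and so remain spanned.\<close>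
lemma gram_schmidt_step:
  fixes e :: "nat \<Rightarrow> real \<Rightarrow> complex^'m::finite"
  assumes V: "l2_subspace V" and e: "orthonormal m e" "\<And>i. i < m \<Longrightarrow> e i \<in> V" and w: "w \<in> V"
  obtains m' e' where "m \<le> m'" "\<And>i. i < m \<Longrightarrow> e' i = e i" "orthonormal m' e'"
    "\<And>i. i < m' \<Longrightarrow> e' i \<in> V" "spans m' e' w" "\<And>x. x \<in> L2 \<Longrightarrow> spans m e x \<Longrightarrow> spans m' e' x"
proof -
  define r where "r = (\<lambda>x. w x - (\<Sum>k<m. l2_inner (e k) w *s e k x))"
  have wL: "w \<in> L2" using V w by (auto simp: l2_subspace_def)
  have eL: "e i \<in> L2" if "i < m" for i using e(1) that by (auto simp: orthonormal_def)
  have sV: "(\<lambda>x. \<Sum>k<m. l2_inner (e k) w *s e k x) \<in> V"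
    using V e(2) by (rule l2_subspace_sum)
  then have sL: "(\<lambda>x. \<Sum>k<m. l2_inner (e k) w *s e k x) \<in> L2" using V by (auto simp: l2_subspace_def)
  have "(\<lambda>x. w x + (-1) *s (\<Sum>k<m. l2_inner (e k) w *s e k x)) \<in> V"
    by (rule l2_subspace_add_scale[OF V w sV])
  then have rV: "r \<in> V" unfolding r_def diff_conv_scale .
  then have rL: "r \<in> L2" using V by (auto simp: l2_subspace_def)
  have inner_r: "l2_inner y r = l2_inner y w - (\<Sum>k<m. l2_inner y (e k) * l2_inner (e k) w)" if "y \<in> L2" for y
    unfolding r_def using that wL sL
    by (simp add: l2_inner_diff_right l2_inner_sum_right eL mult.commute)
  have er: "l2_inner (e i) r = 0" if "i < m" for i
  proof -
    have "(\<Sum>k<m. l2_inner (e i) (e k) * l2_inner (e k) w) = (\<Sum>k<m. kron i k * l2_inner (e k) w)"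
      using e(1) that by (intro sum.cong) (auto simp: orthonormal_def)
    also have "\<dots> = l2_inner (e i) w"
      using that by (simp add: kron_def if_distrib[of "\<lambda>t. t * _"] cong: if_cong)
    finally show ?thesis using inner_r[OF eL[OF that]] by simp
  qed
  show ?thesis
  proof (cases "l2_norm r = 0")
    case True
    have "l2_inner y r = 0" if "y \<in> L2" for y
      using l2_cauchy_schwarz[OF that rL] True by simp
    then have "spans m e w" unfolding spans_def using inner_r by simp
    then show ?thesis using that[of m e] e by auto
  next
    case False
    then have r0: "0 < l2_norm r" by (simp add: order_less_le)
    define z where "z = (\<lambda>x. of_real (1 / l2_norm r) *s r x)"
    define e' where "e' = e(m := z)"
    have zL: "z \<in> L2" unfolding z_def by (rule L2_scale[OF rL])
    have zV: "z \<in> V" using V rV l2_subspace_sum[of V 1 "\<lambda>_. r" "\<lambda>_. of_real (1 / l2_norm r)"] by (simp add: z_def)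
    have yz: "l2_inner y z = of_real (1 / l2_norm r) * l2_inner y r" if "y \<in> L2" for y
      unfolding z_def by (rule l2_inner_scale_right[OF that rL])
    have ez: "l2_inner (e i) z = 0" "l2_inner z (e i) = 0" if "i < m" for i
      using yz[OF eL[OF that]] er[OF that] l2_inner_commute[of z "e i"] by auto
    have zr: "l2_inner z r = of_real (l2_norm r)"
    proof -
      have "l2_inner r z = of_real (l2_norm r)"
        using yz[OF rL] r0 by (simp add: l2_inner_self power2_eq_square)
      then show ?thesis using l2_inner_commute[of z r] by simp
    qed
    have zz: "l2_inner z z = 1" using yz[OF zL] zr r0 by simp
    have zw: "l2_inner z w = of_real (l2_norm r)"
      using inner_r[OF zL] zr ez by simp
    have on: "orthonormal (Suc m) e'"
      using e(1) zL ez zz by (auto simp: orthonormal_def e'_def less_Suc_eq kron_def)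
    have sp: "(\<Sum>k<Suc m. l2_inner y (e' k) * l2_inner (e' k) x)
       = (\<Sum>k<m. l2_inner y (e k) * l2_inner (e k) x) + l2_inner y z * l2_inner z x" for x y
      by (simp add: e'_def)
    show ?thesis
    proof (rule that[of "Suc m" e'])
      show "spans (Suc m) e' w"
        unfolding spans_def sp using inner_r yz zw r0 by simp
      fix x assume x: "x \<in> L2" "spans m e x"
      have "l2_inner z x = 0" using x(2) zL ez by (simp add: spans_def)
      then show "spans (Suc m) e' x" using x(2) unfolding spans_def sp by simp
    next
      fix i assume "i < Suc m"
      then show "e' i \<in> V" using e(2) zV by (auto simp: e'_def less_Suc_eq)
    qed (use on in \<open>auto simp: e'_def\<close>)
  qed
qed

text \<open>Prescribing the first vectors and the subspace for the others makes one compression of an operator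
  a principal minor of another.\<close>
lemma gram_schmidt:
  fixes e :: "nat \<Rightarrow> real \<Rightarrow> complex^'m::finite"
  assumes V: "l2_subspace V" and e: "orthonormal m e" "\<And>i. i < m \<Longrightarrow> e i \<in> V" and ws: "set ws \<subseteq> V"
  obtains m' e' where "m \<le> m'" "\<And>i. i < m \<Longrightarrow> e' i = e i" "orthonormal m' e'"
    "\<And>i. i < m' \<Longrightarrow> e' i \<in> V" "\<And>w. w \<in> set ws \<Longrightarrow> spans m' e' w"
  using ws
proof (induction ws arbitrary: thesis)
  case Nil
  show ?case using Nil(1)[of m e] e by auto
next
  case (Cons w ws)
  from Cons.prems have wV: "w \<in> V" and wsV: "set ws \<subseteq> V" by auto
  obtain m1 e1 where 1: "m \<le> m1" "\<And>i. i < m \<Longrightarrow> e1 i = e i" "orthonormal m1 e1"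
    "\<And>i. i < m1 \<Longrightarrow> e1 i \<in> V" "\<And>w. w \<in> set ws \<Longrightarrow> spans m1 e1 w"
    using Cons.IH[OF _ wsV] by blast
  obtain m2 e2 where 2: "m1 \<le> m2" "\<And>i. i < m1 \<Longrightarrow> e2 i = e1 i" "orthonormal m2 e2"
    "\<And>i. i < m2 \<Longrightarrow> e2 i \<in> V" "spans m2 e2 w" "\<And>x. x \<in> L2 \<Longrightarrow> spans m1 e1 x \<Longrightarrow> spans m2 e2 x"
    using gram_schmidt_step[OF V 1(3,4) wV] by blast
  have "set ws \<subseteq> L2" using wsV V by (auto simp: l2_subspace_def)
  then have "spans m2 e2 w'" if "w' \<in> set (w # ws)" for w'
    using that 1(5) 2(5,6) by auto
  moreover have "e2 i = e i" if "i < m" for i using 1(1,2) 2(2) that by simp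
  ultimately show ?case
    using Cons.prems(1)[of m2 e2] 1(1) 2(1,3,4) by simp
qed

lemma l2_norm_comb:
  assumes "orthonormal m e"
  shows "(l2_norm (\<lambda>x. \<Sum>k<m. c k *s e k x))\<^sup>2 = (\<Sum>k<m. (cmod (c k))\<^sup>2)"
proof -
  let ?f = "\<lambda>x. \<Sum>k<m. c k *s e k x"
  have eL: "e i \<in> L2" if "i < m" for i using assms that by (auto simp: orthonormal_def)
  have fL: "?f \<in> L2" by (rule L2_sum[OF eL])
  have ef: "l2_inner (e i) ?f = c i" if "i < m" for i
  proof -
    have "l2_inner (e i) ?f = (\<Sum>k<m. c k * kron i k)"
      using assms that by (subst l2_inner_sum_right) (auto simp: eL orthonormal_def)
    then show ?thesis using that by (simp add: kron_def if_distrib[of "\<lambda>t. _ * t"] cong: if_cong)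
  qed
  have "l2_inner ?f ?f = (\<Sum>k<m. c k * l2_inner ?f (e k))"
    by (rule l2_inner_sum_right[OF fL eL])
  also have "\<dots> = (\<Sum>k<m. c k * cnj (c k))"
    by (intro sum.cong refl) (simp add: l2_inner_commute[of ?f] ef)
  also have "\<dots> = of_real (\<Sum>k<m. (cmod (c k))\<^sup>2)"
    by (simp only: complex_norm_square[symmetric]) simp
  finally show ?thesis unfolding l2_inner_self using of_real_eq_iff by blast
qed

lemma bessel_inequality:
  assumes "orthonormal m e" "f \<in> L2"
  shows "(\<Sum>k<m. (cmod (l2_inner (e k) f))\<^sup>2) \<le> (l2_norm f)\<^sup>2"
proof -
  let ?s = "\<lambda>x. \<Sum>k<m. l2_inner (e k) f *s e k x"
  let ?S = "\<Sum>k<m. (cmod (l2_inner (e k) f))\<^sup>2"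
  have eL: "e i \<in> L2" if "i < m" for i using assms that by (auto simp: orthonormal_def)
  have sL: "?s \<in> L2" by (rule L2_sum[OF eL])
  have "l2_inner f ?s = (\<Sum>k<m. l2_inner (e k) f * cnj (l2_inner (e k) f))"
    using assms(2) by (subst l2_inner_sum_right) (auto simp: eL l2_inner_commute[of f])
  also have "\<dots> = of_real ?S"
    by (simp only: complex_norm_square[symmetric]) simp
  finally have "?S = cmod (l2_inner f ?s)" by (simp add: sum_nonneg del: of_real_sum)
  also have "\<dots> \<le> l2_norm f * l2_norm ?s" by (rule l2_cauchy_schwarz[OF assms(2) sL])
  finally have "?S \<le> l2_norm f * l2_norm ?s" .
  moreover have "?S = l2_norm ?s * l2_norm ?s"
    using l2_norm_comb[OF assms(1), of "\<lambda>k. l2_inner (e k) f"] by (simp add: power2_eq_square)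
  ultimately have le: "l2_norm ?s * l2_norm ?s \<le> l2_norm f * l2_norm ?s" by simp
  have "l2_norm ?s \<le> l2_norm f"
  proof (cases "l2_norm ?s = 0")
    case False
    then have "0 < l2_norm ?s" using l2_norm_nonneg[of ?s] by linarith
    with le show ?thesis by (rule mult_right_le_imp_le)
  qed simp
  then have "(l2_norm ?s)\<^sup>2 \<le> (l2_norm f)\<^sup>2" by (intro power_mono) auto
  then show ?thesis using l2_norm_comb[OF assms(1)] by simp
qed

section \<open>Fredholm determinants\<close>

abbreviation compressed_det ::
  "nat \<Rightarrow> (nat \<Rightarrow> real \<Rightarrow> complex^'m::finite) \<Rightarrow> 'm operator \<Rightarrow> complex" where
  "compressed_det m e T \<equiv> leibniz_det m (\<lambda>i j. kron i j - l2_inner (e i) (T (e j)))"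

definition nuclear_det :: "(nat \<Rightarrow> real \<Rightarrow> complex^'m::finite) \<Rightarrow> (nat \<Rightarrow> real \<Rightarrow> complex^'m) \<Rightarrow> nat \<Rightarrow> complex" where
  "nuclear_det u v n = leibniz_det n (\<lambda>i j. kron i j - l2_inner (v i) (u j))"

lemma l2_inner_sum_left:
  fixes n :: nat
  assumes "h \<in> L2" "\<And>k. k < n \<Longrightarrow> e k \<in> L2"
  shows "l2_inner (\<lambda>x. \<Sum>k<n. c k *s e k x) h = (\<Sum>k<n. cnj (c k) * l2_inner (e k) h)"
proof -
  have "l2_inner (\<lambda>x. \<Sum>k<n. c k *s e k x) h = cnj (\<Sum>k<n. c k * l2_inner h (e k))"
    by (subst l2_inner_commute, subst l2_inner_sum_right) (use assms in auto)
  also have "\<dots> = (\<Sum>k<n. cnj (c k) * l2_inner (e k) h)"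
    unfolding cnj_sum complex_cnj_mult
    by (intro sum.cong refl arg_cong2[where f = "(*)"] l2_inner_commute[symmetric])
  finally show ?thesis .
qed

lemma nuclear_rep_L2:
  assumes "nuclear_representation T u v"
  shows "u i \<in> L2" "v i \<in> L2" "f \<in> L2 \<Longrightarrow> T f \<in> L2"
    "summable (\<lambda>i. l2_norm (v i) * l2_norm (u i))"
  using assms by (auto simp: nuclear_representation_def mult.commute)

lemma nuclear_rep_inner_sums:
  assumes T: "nuclear_representation T u v" and f: "f \<in> L2" and g: "g \<in> L2"
  shows "(\<lambda>k. l2_inner g (u k) * l2_inner (v k) f) sums l2_inner g (T f)"
  unfolding sums_def
proof (rule LIM_zero_cancel)
  note L2 = nuclear_rep_L2[OF T]
  let ?P = "\<lambda>n x. \<Sum>i<n. l2_inner (v i) f *s u i x"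
  have eq: "l2_inner g (\<lambda>x. T f x - ?P n x) = l2_inner g (T f) - (\<Sum>k<n. l2_inner g (u k) * l2_inner (v k) f)" for n
    by (subst l2_inner_diff_right) (auto simp: L2 f g L2_sum l2_inner_sum_right mult.commute)
  have PL: "(\<lambda>x. T f x - ?P n x) \<in> L2" for n
    by (intro L2_diff L2_sum L2 f)
  have "(\<lambda>n. l2_norm g * l2_norm (\<lambda>x. T f x - ?P n x)) \<longlonglongrightarrow> l2_norm g * 0"
    using T f by (intro tendsto_mult tendsto_const) (auto simp: nuclear_representation_def)
  then have lim: "(\<lambda>n. l2_norm g * l2_norm (\<lambda>x. T f x - ?P n x)) \<longlonglongrightarrow> 0" by simp
  show "(\<lambda>n. (\<Sum>k<n. l2_inner g (u k) * l2_inner (v k) f) - l2_inner g (T f)) \<longlonglongrightarrow> 0"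
  proof (rule Lim_null_comparison[OF _ lim])
    show "\<forall>\<^sub>F n in sequentially. cmod ((\<Sum>k<n. l2_inner g (u k) * l2_inner (v k) f) - l2_inner g (T f))
        \<le> l2_norm g * l2_norm (\<lambda>x. T f x - ?P n x)"
      using l2_cauchy_schwarz[OF g PL] unfolding eq by (simp add: norm_minus_commute)
  qed
qed

lemma norm_sum_mult_le_L2_set:
  "cmod (\<Sum>k<m. a k * b k) \<le> L2_set (\<lambda>k. cmod (a k)) {..<m} * L2_set (\<lambda>k. cmod (b k)) {..<m}" for m :: nat
proof -
  have "cmod (\<Sum>k<m. a k * b k) \<le> (\<Sum>k<m. \<bar>cmod (a k)\<bar> * \<bar>cmod (b k)\<bar>)"
    by (rule order.trans[OF norm_sum]) (simp add: norm_mult)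
  also have "\<dots> \<le> L2_set (\<lambda>k. cmod (a k)) {..<m} * L2_set (\<lambda>k. cmod (b k)) {..<m}"
    by (rule L2_set_mult_ineq)
  finally show ?thesis .
qed

lemma bessel_L2_set:
  assumes "orthonormal m e" "f \<in> L2"
  shows "L2_set (\<lambda>k. cmod (l2_inner (e k) f)) {..<m} \<le> l2_norm f"
    "L2_set (\<lambda>k. cmod (l2_inner f (e k))) {..<m} \<le> l2_norm f"
proof -
  show 1: "L2_set (\<lambda>k. cmod (l2_inner (e k) f)) {..<m} \<le> l2_norm f"
    unfolding L2_set_def using bessel_inequality[OF assms] by (simp add: real_le_lsqrt)
  have "cmod (l2_inner f (e k)) = cmod (l2_inner (e k) f)" for k
    using l2_inner_commute[of f "e k"] by simp
  with 1 show "L2_set (\<lambda>k. cmod (l2_inner f (e k))) {..<m} \<le> l2_norm f" by simp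
qed

lemma compressed_inner_le:
  assumes "orthonormal m e" "f \<in> L2" "g \<in> L2"
  shows "cmod (\<Sum>k<m. l2_inner f (e k) * l2_inner (e k) g) \<le> l2_norm f * l2_norm g"
  by (rule order.trans[OF norm_sum_mult_le_L2_set])
     (intro mult_mono bessel_L2_set[OF assms(1)] assms L2_set_nonneg l2_norm_nonneg)

lemma nuclear_det_convergent:
  assumes "nuclear_representation T u v"
  shows "convergent (nuclear_det u v)"
proof -
  note L2 = nuclear_rep_L2[OF assms]
  have "convergent (\<lambda>n. leibniz_det n (\<lambda>i j. kron i j - l2_inner (v i) (u j)))"
    by (rule leibniz_det_convergent[of "\<lambda>i. l2_norm (v i)" "\<lambda>i. l2_norm (u i)"])
       (auto intro: l2_cauchy_schwarz L2)
  then show ?thesis by (simp add: nuclear_det_def[abs_def])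
qed

text \<open>By Sylvester's identity the compressed Gram matrices have the determinants of finite sections.\<close>
lemma compressed_det_tendsto:
  assumes T: "nuclear_representation T u v" and e: "orthonormal m e"
  shows "(\<lambda>N. leibniz_det N (\<lambda>i j. kron i j - (\<Sum>k<m. l2_inner (v i) (e k) * l2_inner (e k) (u j))))
     \<longlonglongrightarrow> compressed_det m e T"
proof -
  have eq: "leibniz_det N (\<lambda>i j. kron i j - (\<Sum>k<m. l2_inner (v i) (e k) * l2_inner (e k) (u j)))
      = leibniz_det m (\<lambda>i j. kron i j - (\<Sum>k<N. l2_inner (e i) (u k) * l2_inner (v k) (e j)))" for N
    by (rule leibniz_det_sylvester)
  show ?thesis
    unfolding eq
  proof (intro tendsto_leibniz_det tendsto_intros)
    fix i j assume "i < m" "j < m"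
    then have "e i \<in> L2" "e j \<in> L2" using e by (auto simp: orthonormal_def)
    from nuclear_rep_inner_sums[OF T this(2,1)]
    show "(\<lambda>N. \<Sum>k<N. l2_inner (e i) (u k) * l2_inner (v k) (e j)) \<longlonglongrightarrow> l2_inner (e i) (T (e j))"
      by (simp add: sums_def)
  qed
qed

text \<open>As long as \<open>e\<close> spans \<open>u j\<close> for \<open>j < N\<close>, compressing to \<open>e\<close> leaves the leading \<open>N \<times> N\<close>
  Gram matrix unchanged, and what is lost beyond it obeys the same tail bound with and without
  the compression.  The compressed determinant involves \<open>T\<close> but not its representation.\<close>
lemma nuclear_det_approximation:
  assumes T: "nuclear_representation T u v" and L: "nuclear_det u v \<longlonglongrightarrow> L"
  shows "\<exists>\<epsilon>::nat \<Rightarrow> real. \<epsilon> \<longlonglongrightarrow> 0 \<and> (\<forall>N m e. orthonormal m e \<longrightarrow> (\<forall>j<N. spans m e (u j)) \<longrightarrow>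
       cmod (L - compressed_det m e T) \<le> \<epsilon> N)"
proof -
  note L2 = nuclear_rep_L2[OF T]
  let ?p = "\<lambda>i. l2_norm (v i)" and ?q = "\<lambda>i. l2_norm (u i)"
  let ?S = "\<Sum>i. ?p i * ?q i"
  define \<epsilon> where "\<epsilon> N = det_const ?S * (\<Sum>i. ?p (i + N) * ?q (i + N))" for N
  have "(\<lambda>N. 2 * \<epsilon> N) \<longlonglongrightarrow> 2 * (det_const ?S * 0)"
    unfolding \<epsilon>_def by (intro tendsto_mult tendsto_const suminf_tail_tendsto_0[OF L2(4)])
  then have lim: "(\<lambda>N. 2 * \<epsilon> N) \<longlonglongrightarrow> 0" by simp
  show ?thesis
  proof (intro exI conjI allI impI, rule lim)
    fix N m e assume e: "orthonormal m e" and sp: "\<forall>j<N. spans m e (u j)"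
    let ?A = "\<lambda>i j. \<Sum>k<m. l2_inner (v i) (e k) * l2_inner (e k) (u j)"
    let ?D = "compressed_det m e T"
    have "nuclear_det u v N = leibniz_det N (\<lambda>i j. kron i j - ?A i j)"
      unfolding nuclear_det_def using sp L2(2) by (intro leibniz_det_cong) (auto simp: spans_def)
    moreover have "cmod (L - nuclear_det u v N) \<le> \<epsilon> N"
      unfolding \<epsilon>_def nuclear_det_def
      by (rule leibniz_det_limit_tail[OF _ _ _ L2(4) order_refl L[unfolded nuclear_det_def[abs_def]]])
         (auto intro: l2_cauchy_schwarz L2)
    moreover have "cmod (?D - leibniz_det N (\<lambda>i j. kron i j - ?A i j)) \<le> \<epsilon> N"
      unfolding \<epsilon>_def
      by (rule leibniz_det_limit_tail[OF _ _ _ L2(4) order_refl compressed_det_tendsto[OF T e]])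
         (auto intro: compressed_inner_le[OF e] L2)
    ultimately show "cmod (L - ?D) \<le> 2 * \<epsilon> N"
      using norm_triangle_ineq4[of "L - nuclear_det u v N" "?D - nuclear_det u v N"] by simp
  qed
qed

lemma l2_subspace_L2: "l2_subspace L2"
  by (simp add: l2_subspace_def L2_add_scale)

lemma orthonormal_0: "orthonormal 0 e"
  by (simp add: orthonormal_def)

text \<open>Compress to a family that spans the first \<open>N\<close> vectors of both representations.\<close>
lemma nuclear_det_limit_unique:
  assumes T: "nuclear_representation T u v" "nuclear_representation T u' v'"
    and L: "nuclear_det u v \<longlonglongrightarrow> L" "nuclear_det u' v' \<longlonglongrightarrow> L'"
  shows "L = L'"
proof -
  obtain \<epsilon> where \<epsilon>: "\<epsilon> \<longlonglongrightarrow> 0"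
    "\<forall>N m e. orthonormal m e \<longrightarrow> (\<forall>j<N. spans m e (u j)) \<longrightarrow>
       cmod (L - compressed_det m e T) \<le> \<epsilon> N"
    using nuclear_det_approximation[OF T(1) L(1)] by (elim exE conjE) (rule that)
  obtain \<epsilon>' where \<epsilon>': "\<epsilon>' \<longlonglongrightarrow> 0"
    "\<forall>N m e. orthonormal m e \<longrightarrow> (\<forall>j<N. spans m e (u' j)) \<longrightarrow>
       cmod (L' - compressed_det m e T) \<le> \<epsilon>' N"
    using nuclear_det_approximation[OF T(2) L(2)] by (elim exE conjE) (rule that)
  have "cmod (L - L') \<le> \<epsilon> N + \<epsilon>' N" for N
  proof -
    have ws: "set (map u [0..<N] @ map u' [0..<N]) \<subseteq> L2"
      using nuclear_rep_L2(1)[OF T(1)] nuclear_rep_L2(1)[OF T(2)] by auto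
    obtain m e where e: "orthonormal m e"
      "\<And>w. w \<in> set (map u [0..<N] @ map u' [0..<N]) \<Longrightarrow> spans m e w"
      by (rule gram_schmidt[OF l2_subspace_L2 orthonormal_0[of "\<lambda>_ _. 0"] _ ws]) auto
    let ?D = "compressed_det m e T"
    have "cmod (L - ?D) \<le> \<epsilon> N" "cmod (L' - ?D) \<le> \<epsilon>' N"
      using \<epsilon>(2) \<epsilon>'(2) e by simp_all
    then show ?thesis using norm_triangle_ineq4[of "L - ?D" "L' - ?D"] by simp
  qed
  moreover have "(\<lambda>N. \<epsilon> N + \<epsilon>' N) \<longlonglongrightarrow> 0"
    using tendsto_add[OF \<epsilon>(1) \<epsilon>'(1)] by simp
  ultimately have "cmod (L - L') \<le> 0"
    by (intro LIMSEQ_le_const) auto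
  then show ?thesis by simp
qed

theorem nuclear_det_tendsto_fredholm_det:
  assumes "nuclear_representation T u v"
  shows "nuclear_det u v \<longlonglongrightarrow> fredholm_det T"
proof -
  obtain L where L: "nuclear_det u v \<longlonglongrightarrow> L"
    using nuclear_det_convergent[OF assms] by (auto simp: convergent_def)
  have ex: "nuclear_det u' v' \<longlonglongrightarrow> L" if T': "nuclear_representation T u' v'" for u' v'
  proof -
    obtain L' where L': "nuclear_det u' v' \<longlonglongrightarrow> L'"
      using nuclear_det_convergent[OF T'] by (auto simp: convergent_def)
    with nuclear_det_limit_unique[OF assms T' L L'] show ?thesis by simp
  qed
  have "fredholm_det T = (THE d. \<forall>u v. nuclear_representation T u v \<longrightarrow> nuclear_det u v \<longlonglongrightarrow> d)"
    unfolding fredholm_det_def nuclear_det_def[abs_def] kron_def ..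
  also have "\<dots> = L"
  proof (rule the_equality)
    show "\<forall>u v. nuclear_representation T u v \<longrightarrow> nuclear_det u v \<longlonglongrightarrow> L" using ex by blast
    fix d assume "\<forall>u v. nuclear_representation T u v \<longrightarrow> nuclear_det u v \<longlonglongrightarrow> d"
    then have "nuclear_det u v \<longlonglongrightarrow> d" using assms by blast
    then show "d = L" using L by (rule LIMSEQ_unique)
  qed
  finally show ?thesis using L by simp
qed

section \<open>Contractions\<close>

text \<open>The inverse \<open>R\<close> of \<open>I - F\<close> has norm at most \<open>1 / (1 - r)\<close> and satisfies \<open>R = I + R F\<close>.  It is thus a
  nuclear perturbation of the identity as well, and its determinant obeys the general upper bound.\<close>
lemma contraction_section_det_bound:
  fixes x y :: "nat \<Rightarrow> nat \<Rightarrow> complex" and P Q :: "nat \<Rightarrow> real"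
  assumes F: "\<And>i j. i < m \<Longrightarrow> j < m \<Longrightarrow> (\<lambda>k. x k i * y k j) sums F i j"
    and x: "\<And>k. L2_set (\<lambda>i. cmod (x k i)) {..<m} \<le> Q k"
    and y: "\<And>k. L2_set (\<lambda>i. cmod (y k i)) {..<m} \<le> P k"
    and sm: "summable (\<lambda>k. P k * Q k)" and r: "0 \<le> r" "r < 1"
    and contr: "\<And>c. L2_set (\<lambda>i. cmod (\<Sum>j<m. F i j * c j)) {..<m} \<le> r * L2_set (\<lambda>i. cmod (c i)) {..<m}"
  defines "s \<equiv> (\<Sum>k. P k * Q k) / (1 - r)"
  shows "1 \<le> (1 + det_const s * s) * cmod (leibniz_det m (\<lambda>i j. kron i j - F i j))"
proof -
  let ?n = "\<lambda>c. L2_set (\<lambda>i. cmod (c i)) {..<m}"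
  let ?M = "\<lambda>i j. kron i j - F i j"
  have P0: "0 \<le> P k" and Q0: "0 \<le> Q k" for k
    using x[of k] y[of k] L2_set_nonneg order.trans by blast+
  have M: "(\<Sum>j<m. ?M i j * c j) = c i - (\<Sum>j<m. F i j * c j)" if "i < m" for i c
    using that by (simp add: left_diff_distrib sum_subtractf kron_def if_distrib[of "\<lambda>t. t * _"] cong: if_cong)
  have inv_bound: "?n d \<le> ?n (\<lambda>i. \<Sum>j<m. ?M i j * d j) / (1 - r)" for d
  proof -
    have "?n d \<le> L2_set (\<lambda>i. cmod (\<Sum>j<m. ?M i j * d j) + cmod (\<Sum>j<m. F i j * d j)) {..<m}"
    proof (rule L2_set_mono)
      fix i assume "i \<in> {..<m}"
      then have "d i = (\<Sum>j<m. ?M i j * d j) + (\<Sum>j<m. F i j * d j)" using M by simp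
      then show "cmod (d i) \<le> cmod (\<Sum>j<m. ?M i j * d j) + cmod (\<Sum>j<m. F i j * d j)"
        by (metis norm_triangle_ineq)
    qed simp
    also have "\<dots> \<le> ?n (\<lambda>i. \<Sum>j<m. ?M i j * d j) + ?n (\<lambda>i. \<Sum>j<m. F i j * d j)"
      by (rule L2_set_triangle_ineq)
    also have "\<dots> \<le> ?n (\<lambda>i. \<Sum>j<m. ?M i j * d j) + r * ?n d"
      using contr by simp
    finally have "?n d * (1 - r) \<le> ?n (\<lambda>i. \<Sum>j<m. ?M i j * d j)" by (simp add: algebra_simps)
    then show ?thesis using r by (simp add: pos_le_divide_eq)
  qed
  have nz: "leibniz_det m ?M \<noteq> 0"
  proof
    assume "leibniz_det m ?M = 0"
    then obtain c where c: "\<exists>i<m. c i \<noteq> 0" "\<And>i. i < m \<Longrightarrow> (\<Sum>j<m. ?M i j * c j) = 0"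
      using leibniz_det_eq_0_kernel by blast
    have "?n (\<lambda>i. \<Sum>j<m. ?M i j * c j) = 0" using c(2) by (simp add: L2_set_eq_0_iff)
    with inv_bound[of c] L2_set_nonneg[of "\<lambda>i. cmod (c i)" "{..<m}"] have "?n c = 0" by simp
    with c(1) show False by (auto simp: L2_set_eq_0_iff)
  qed
  then obtain R where R: "\<And>i j. i < m \<Longrightarrow> j < m \<Longrightarrow> (\<Sum>k<m. ?M i k * R k j) = kron i j"
    and R': "\<And>i j. i < m \<Longrightarrow> j < m \<Longrightarrow> (\<Sum>k<m. R i k * ?M k j) = kron i j"
    by (rule leibniz_det_inverse) auto
  have Rb: "?n (\<lambda>i. \<Sum>j<m. R i j * c j) \<le> ?n c / (1 - r)" for c
  proof -
    have "(\<Sum>j<m. ?M i j * (\<Sum>k<m. R j k * c k)) = c i" if "i < m" for i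
    proof -
      have "(\<Sum>j<m. ?M i j * (\<Sum>k<m. R j k * c k)) = (\<Sum>k<m. (\<Sum>j<m. ?M i j * R j k) * c k)"
        by (simp only: sum_distrib_left sum_distrib_right mult.assoc) (rule sum.swap)
      also have "\<dots> = (\<Sum>k<m. kron i k * c k)" using R that by (intro sum.cong) auto
      also have "\<dots> = c i" using that by (simp add: kron_def if_distrib[of "\<lambda>t. t * _"] cong: if_cong)
      finally show ?thesis .
    qed
    then have "?n (\<lambda>i. \<Sum>j<m. ?M i j * (\<Sum>k<m. R j k * c k)) = ?n c"
      by (intro L2_set_cong) auto
    with inv_bound[of "\<lambda>i. \<Sum>j<m. R i j * c j"] show ?thesis by simp
  qed
  let ?z = "\<lambda>l i. \<Sum>k<m. R i k * x l k"
  let ?B = "\<lambda>i j. \<Sum>k<m. y i k * (- ?z j k)"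
  have B: "cmod (?B i j) \<le> P i * (Q j / (1 - r))" for i j
  proof -
    have "cmod (?B i j) \<le> ?n (y i) * ?n (\<lambda>k. - ?z j k)"
      by (rule norm_sum_mult_le_L2_set)
    also have "\<dots> = ?n (y i) * ?n (?z j)" by simp
    also have "\<dots> \<le> P i * (Q j / (1 - r))"
    proof (intro mult_mono y L2_set_nonneg P0)
      show "?n (?z j) \<le> Q j / (1 - r)"
        using order.trans[OF Rb divide_right_mono[OF x[of j]]] r by simp
    qed
    finally show ?thesis .
  qed
  have sm': "summable (\<lambda>k. P k * (Q k / (1 - r)))" using summable_divide[OF sm, of "1 - r"] by simp
  have s: "(\<Sum>k. P k * (Q k / (1 - r))) = s"
    unfolding s_def using suminf_divide[OF sm, of "1 - r"] by simp
  have detB: "cmod (leibniz_det N (\<lambda>i j. kron i j - ?B i j)) \<le> 1 + det_const s * s" for N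
  proof -
    have "cmod (leibniz_det N (\<lambda>i j. kron i j - ?B i j) - leibniz_det 0 (\<lambda>i j. kron i j - ?B i j))
       \<le> det_const s * s"
      using leibniz_det_tail[OF P0 _ B sm' eq_refl[OF s], of 0 N] r unfolding add_0_right s by (simp add: Q0)
    then show ?thesis using norm_triangle_ineq2[of "leibniz_det N (\<lambda>i j. kron i j - ?B i j)" 1] by simp
  qed
  \<comment> \<open>The finite parts of \<open>R = I + R F\<close>; Sylvester's identity turns them into the Gram matrices \<open>I - ?B\<close>.\<close>
  have lim: "(\<lambda>N. leibniz_det m (\<lambda>i j. kron i j - (\<Sum>l<N. - ?z l i * y l j))) \<longlonglongrightarrow> leibniz_det m R"
  proof (rule tendsto_leibniz_det)
    fix i j assume ij: "i < m" "j < m"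
    have "(\<Sum>k<m. R i k * ?M k j) = R i j - (\<Sum>k<m. R i k * F k j)"
      using ij by (simp add: right_diff_distrib sum_subtractf kron_def if_distrib[of "\<lambda>t. _ * t"] cong: if_cong)
    then have Rij: "R i j = kron i j + (\<Sum>k<m. R i k * F k j)" using R'[OF ij] by simp
    have "(\<lambda>N. kron i j + (\<Sum>k<m. R i k * (\<Sum>l<N. x l k * y l j))) \<longlonglongrightarrow> R i j"
      unfolding Rij using F ij by (intro tendsto_intros) (auto simp: sums_def)
    moreover have "(\<Sum>k<m. R i k * (\<Sum>l<N. x l k * y l j)) = - (\<Sum>l<N. - ?z l i * y l j)" for N
    proof -
      have "(\<Sum>k<m. R i k * (\<Sum>l<N. x l k * y l j)) = (\<Sum>k<m. \<Sum>l<N. R i k * x l k * y l j)"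
        by (simp only: sum_distrib_left mult.assoc)
      also have "\<dots> = (\<Sum>l<N. \<Sum>k<m. R i k * x l k * y l j)" by (rule sum.swap)
      also have "\<dots> = (\<Sum>l<N. ?z l i * y l j)" by (simp only: sum_distrib_right)
      finally show ?thesis by (simp add: sum_negf)
    qed
    ultimately show "(\<lambda>N. kron i j - (\<Sum>l<N. - ?z l i * y l j)) \<longlonglongrightarrow> R i j" by simp
  qed
  have syl: "leibniz_det m (\<lambda>i j. kron i j - (\<Sum>l<N. - ?z l i * y l j)) = leibniz_det N (\<lambda>i j. kron i j - ?B i j)" for N
    by (rule leibniz_det_sylvester)
  have "cmod (leibniz_det m R) \<le> 1 + det_const s * s"
  proof (rule tendsto_upperbound)
    show "(\<lambda>N. cmod (leibniz_det N (\<lambda>i j. kron i j - ?B i j))) \<longlonglongrightarrow> cmod (leibniz_det m R)"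
      using tendsto_norm[OF lim] unfolding syl .
  qed (use detB in auto)
  moreover have "leibniz_det m ?M * leibniz_det m R = 1"
  proof -
    have "leibniz_det m ?M * leibniz_det m R = leibniz_det m (\<lambda>i j. \<Sum>k<m. ?M i k * R k j)"
      by (rule leibniz_det_mult[symmetric])
    also have "\<dots> = leibniz_det m kron" by (rule leibniz_det_cong) (rule R)
    finally show ?thesis by simp
  qed
  then have "cmod (leibniz_det m R) * cmod (leibniz_det m ?M) = 1"
    by (simp only: norm_mult[symmetric] mult.commute[of "leibniz_det m R"] norm_one)
  ultimately show ?thesis
    using mult_right_mono[of "cmod (leibniz_det m R)" "1 + det_const s * s" "cmod (leibniz_det m ?M)"] by simp
qed

lemma nuclear_rep_inner_comb:
  assumes T: "nuclear_representation T u v" and e: "orthonormal m e" and g: "g \<in> L2"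
  shows "l2_inner g (T (\<lambda>x. \<Sum>j<m. c j *s e j x)) = (\<Sum>j<m. l2_inner g (T (e j)) * c j)"
proof -
  have eL: "e i \<in> L2" if "i < m" for i using e that by (auto simp: orthonormal_def)
  have "(\<lambda>k. \<Sum>j<m. l2_inner g (u k) * l2_inner (v k) (e j) * c j) sums (\<Sum>j<m. l2_inner g (T (e j)) * c j)"
    by (intro sums_sum sums_mult2 nuclear_rep_inner_sums[OF T] g eL) auto
  moreover have "(\<Sum>j<m. l2_inner g (u k) * l2_inner (v k) (e j) * c j)
      = l2_inner g (u k) * l2_inner (v k) (\<lambda>x. \<Sum>j<m. c j *s e j x)" for k
    by (subst l2_inner_sum_right) (auto simp: nuclear_rep_L2[OF T] eL sum_distrib_left mult_ac)
  ultimately have "(\<lambda>k. l2_inner g (u k) * l2_inner (v k) (\<lambda>x. \<Sum>j<m. c j *s e j x))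
      sums (\<Sum>j<m. l2_inner g (T (e j)) * c j)" by simp
  moreover have "(\<lambda>k. l2_inner g (u k) * l2_inner (v k) (\<lambda>x. \<Sum>j<m. c j *s e j x))
      sums l2_inner g (T (\<lambda>x. \<Sum>j<m. c j *s e j x))"
    by (rule nuclear_rep_inner_sums[OF T _ g]) (rule L2_sum[OF eL])
  ultimately show ?thesis using sums_unique2 by blast
qed

text \<open>The lower bound on the determinants of the compressions is uniform and survives in the limit.\<close>
theorem fredholm_det_contraction_nonzero:
  assumes T: "nuclear_representation T u v" and r: "0 \<le> r" "r < 1"
    and contr: "\<And>f. f \<in> L2 \<Longrightarrow> l2_norm (T f) \<le> r * l2_norm f"
  shows "fredholm_det T \<noteq> 0"
proof
  assume zero: "fredholm_det T = 0"
  note L2 = nuclear_rep_L2[OF T]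
  let ?s = "(\<Sum>k. l2_norm (v k) * l2_norm (u k)) / (1 - r)"
  let ?C = "1 + det_const ?s * ?s"
  have C: "0 \<le> ?C"
    using r L2(4) det_const_pos[of ?s] by (intro add_nonneg_nonneg mult_nonneg_nonneg divide_nonneg_nonneg suminf_nonneg) auto
  obtain \<epsilon> where \<epsilon>: "\<epsilon> \<longlonglongrightarrow> 0"
    "\<forall>N m e. orthonormal m e \<longrightarrow> (\<forall>j<N. spans m e (u j)) \<longrightarrow>
       cmod (fredholm_det T - compressed_det m e T) \<le> \<epsilon> N"
    using nuclear_det_approximation[OF T nuclear_det_tendsto_fredholm_det[OF T]] by (elim exE conjE) (rule that)
  have "1 \<le> ?C * \<epsilon> N" for N
  proof -
    have ws: "set (map u [0..<N]) \<subseteq> L2" using L2(1) by auto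
    obtain m e where e: "orthonormal m e" "\<And>w. w \<in> set (map u [0..<N]) \<Longrightarrow> spans m e w"
      by (rule gram_schmidt[OF l2_subspace_L2 orthonormal_0[of "\<lambda>_ _. 0"] _ ws]) auto
    have eL: "e i \<in> L2" if "i < m" for i using e(1) that by (auto simp: orthonormal_def)
    let ?D = "compressed_det m e T"
    have 1: "1 \<le> ?C * cmod ?D"
    proof (rule contraction_section_det_bound[where x = "\<lambda>k i. l2_inner (e i) (u k)" and y = "\<lambda>k i. l2_inner (v k) (e i)"])
      fix c
      let ?f = "\<lambda>x. \<Sum>j<m. c j *s e j x"
      have fL: "?f \<in> L2" by (rule L2_sum[OF eL])
      have nf: "l2_norm ?f = L2_set (\<lambda>i. cmod (c i)) {..<m}"
        unfolding L2_set_def l2_norm_comb[OF e(1), symmetric] by simp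
      have "L2_set (\<lambda>i. cmod (\<Sum>j<m. l2_inner (e i) (T (e j)) * c j)) {..<m}
          = L2_set (\<lambda>i. cmod (l2_inner (e i) (T ?f))) {..<m}"
        by (intro L2_set_cong refl) (simp add: nuclear_rep_inner_comb[OF T e(1)] eL)
      also have "\<dots> \<le> l2_norm (T ?f)" by (rule bessel_L2_set[OF e(1) L2(3)[OF fL]])
      also have "\<dots> \<le> r * l2_norm ?f" by (rule contr[OF fL])
      finally show "L2_set (\<lambda>i. cmod (\<Sum>j<m. l2_inner (e i) (T (e j)) * c j)) {..<m}
          \<le> r * L2_set (\<lambda>i. cmod (c i)) {..<m}" unfolding nf .
    qed (auto intro: nuclear_rep_inner_sums[OF T] bessel_L2_set[OF e(1)] eL L2 r)
    have "cmod (fredholm_det T - ?D) \<le> \<epsilon> N"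
      using \<epsilon>(2) e by simp
    then have "cmod ?D \<le> \<epsilon> N" by (simp add: zero)
    with 1 C show ?thesis by (meson mult_left_mono order.trans)
  qed
  moreover have "(\<lambda>N. ?C * \<epsilon> N) \<longlonglongrightarrow> ?C * 0"
    by (intro tendsto_mult tendsto_const \<epsilon>(1))
  ultimately have "1 \<le> ?C * 0" by (intro LIMSEQ_le_const) auto
  then show False by simp
qed

section \<open>Truncations\<close>

definition L2_beyond :: "real \<Rightarrow> (real \<Rightarrow> complex^'m::finite) set" where
  "L2_beyond t = {f \<in> L2. \<forall>x. 0 < x \<longrightarrow> x < t \<longrightarrow> f x = 0}"

lemma l2_subspace_L2_beyond: "l2_subspace (L2_beyond t)"
  by (auto simp: l2_subspace_def L2_beyond_def L2_add_scale)

lemma L2_beyond_mono: "t \<le> t' \<Longrightarrow> L2_beyond t' \<subseteq> L2_beyond t"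
  by (auto simp: L2_beyond_def)

lemma L2_truncate:
  fixes f :: "real \<Rightarrow> complex^'m::finite"
  assumes "f \<in> L2"
  shows "(\<lambda>x. indicator {t..} x *\<^sub>R f x) \<in> L2_beyond t"
    and "l2_norm (\<lambda>x. indicator {t..} x *\<^sub>R f x) \<le> l2_norm f"
proof -
  have f [measurable]: "f \<in> borel_measurable half_line" by (rule L2_measurable[OF assms])
  have m: "(\<lambda>x. indicator {t..} x *\<^sub>R f x) \<in> borel_measurable half_line"
    by (intro borel_measurable_scaleR measurable_half_line f) auto
  have L: "(\<lambda>x. indicator {t..} x *\<^sub>R f x) \<in> L2"
    by (rule L2_I_bound[OF m L2_integrable[OF assms]]) (auto simp: indicator_def)
  then show "(\<lambda>x. indicator {t..} x *\<^sub>R f x) \<in> L2_beyond t"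
    by (auto simp: L2_beyond_def)
  show "l2_norm (\<lambda>x. indicator {t..} x *\<^sub>R f x) \<le> l2_norm f"
    unfolding l2_norm_eq
    by (intro real_sqrt_le_mono integral_mono L2_integrable L assms) (auto simp: indicator_def)
qed

lemma nuclear_rep_truncate:
  assumes T: "nuclear_representation T u v"
  shows "nuclear_representation (truncate t T) (\<lambda>i x. indicator {t..} x *\<^sub>R u i x) v"
  unfolding nuclear_representation_def
proof (intro conjI allI ballI)
  note L2 = nuclear_rep_L2[OF T]
  show "(\<lambda>x. indicator {t..} x *\<^sub>R u i x) \<in> L2" "v i \<in> L2" for i
    using L2_truncate[OF L2(1)] L2(2) by (auto simp: L2_beyond_def)
  have "summable (\<lambda>i. l2_norm (u i) * l2_norm (v i))"
    using T by (simp add: nuclear_representation_def)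
  then show "summable (\<lambda>i. l2_norm (\<lambda>x. indicator {t..} x *\<^sub>R u i x) * l2_norm (v i))"
    by (rule summable_comparison_test'[where N = 0])
       (auto intro!: mult_right_mono L2_truncate(2) L2)
  fix f :: "real \<Rightarrow> complex^'a" assume f: "f \<in> L2"
  show "truncate t T f \<in> L2"
    using L2_truncate(1)[OF L2(3)[OF f]] by (simp add: Defs.truncate_def L2_beyond_def)
  let ?d = "\<lambda>n x. T f x - (\<Sum>i<n. l2_inner (v i) f *s u i x)"
  have lim: "(\<lambda>n. l2_norm (?d n)) \<longlonglongrightarrow> 0" using T f by (simp add: nuclear_representation_def)
  have dL: "?d n \<in> L2" for n by (intro L2_diff L2_sum L2 f)
  have eq: "(\<lambda>x. truncate t T f x - (\<Sum>i<n. l2_inner (v i) f *s (indicator {t..} x *\<^sub>R u i x)))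
      = (\<lambda>x. indicator {t..} x *\<^sub>R ?d n x)" for n
    by (auto simp: Defs.truncate_def indicator_def)
  show "(\<lambda>n. l2_norm (\<lambda>x. truncate t T f x - (\<Sum>i<n. l2_inner (v i) f *s (indicator {t..} x *\<^sub>R u i x)))) \<longlonglongrightarrow> 0"
    unfolding eq
    by (rule Lim_null_comparison[OF _ lim]) (auto intro!: always_eventually L2_truncate(2) dL)
qed

lemma l2_inner_truncate:
  fixes e g :: "real \<Rightarrow> complex^'m::finite"
  assumes "e \<in> L2_beyond t"
  shows "l2_inner e (\<lambda>x. indicator {t..} x *\<^sub>R g x) = l2_inner e g"
  unfolding l2_inner_eq
proof (rule Bochner_Integration.integral_cong)
  fix x assume "x \<in> space half_line"
  then show "cdot (e x) (indicator {t..} x *\<^sub>R g x) = cdot (e x) (g x)"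
    using assms by (cases "x < t") (auto simp: L2_beyond_def cdot_def)
qed simp

text \<open>Finite sections of \<open>I - K\<close> inherit \<open>0 \<le> I - K \<le> I\<close>.\<close>
lemma positive_contraction_section:
  assumes T: "nuclear_representation T u v" and pos: "zero_le_op_le_id T" and e: "orthonormal m e"
  shows "psd m (\<lambda>i j. kron i j - l2_inner (e i) (T (e j)))"
    and "i < m \<Longrightarrow> Re (kron i i - l2_inner (e i) (T (e i))) \<le> 1"
proof -
  have eL: "e i \<in> L2" if "i < m" for i using e that by (auto simp: orthonormal_def)
  show "psd m (\<lambda>i j. kron i j - l2_inner (e i) (T (e j)))"
    unfolding psd_def
  proof
    fix c
    let ?f = "\<lambda>x. \<Sum>j<m. c j *s e j x"
    have fL: "?f \<in> L2" by (rule L2_sum[OF eL])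
    have "l2_inner ?f (T ?f) = (\<Sum>i<m. cnj (c i) * l2_inner (e i) (T ?f))"
      by (rule l2_inner_sum_left) (auto simp: eL nuclear_rep_L2[OF T] fL)
    also have "\<dots> = (\<Sum>i<m. \<Sum>j<m. cnj (c i) * l2_inner (e i) (T (e j)) * c j)"
      by (intro sum.cong refl) (simp add: nuclear_rep_inner_comb[OF T e] eL sum_distrib_left mult.assoc)
    finally have fT: "l2_inner ?f (T ?f) = (\<Sum>i<m. \<Sum>j<m. cnj (c i) * l2_inner (e i) (T (e j)) * c j)" .
    have "l2_inner ?f ?f = (\<Sum>i<m. cnj (c i) * l2_inner (e i) ?f)"
      by (rule l2_inner_sum_left) (auto simp: eL fL)
    also have "\<dots> = (\<Sum>i<m. \<Sum>j<m. cnj (c i) * kron i j * c j)"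
    proof (intro sum.cong refl)
      fix i assume "i \<in> {..<m}"
      then show "cnj (c i) * l2_inner (e i) ?f = (\<Sum>j<m. cnj (c i) * kron i j * c j)"
        using e by (subst l2_inner_sum_right) (auto simp: eL sum_distrib_left orthonormal_def mult_ac intro!: sum.cong)
    qed
    finally have "quad_form m (\<lambda>i j. kron i j - l2_inner (e i) (T (e j))) c = l2_inner ?f ?f - l2_inner ?f (T ?f)"
      unfolding quad_form_def fT by (simp add: right_diff_distrib left_diff_distrib sum_subtractf)
    moreover have "Im (l2_inner ?f (T ?f)) = 0" "Re (l2_inner ?f (T ?f)) \<le> Re (l2_inner ?f ?f)"
      using pos fL by (auto simp: zero_le_op_le_id_def complex_is_Real_iff)
    moreover have "Im (l2_inner ?f ?f) = 0" by (simp add: l2_inner_self)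
    ultimately show "Im (quad_form m (\<lambda>i j. kron i j - l2_inner (e i) (T (e j))) c) = 0 \<and>
        0 \<le> Re (quad_form m (\<lambda>i j. kron i j - l2_inner (e i) (T (e j))) c)" by simp
  qed
  show "Re (kron i i - l2_inner (e i) (T (e i))) \<le> 1" if "i < m"
    using pos eL[OF that] by (auto simp: zero_le_op_le_id_def kron_def)
qed

text \<open>An orthonormal family in \<open>L\<^sup>2(t', \<infinity>)\<close> that almost determines \<open>\<tau>(t')\<close> is extended to one in \<open>L\<^sup>2(t, \<infinity>)\<close>
  that almost determines \<open>\<tau>(t)\<close>.  The first compression of \<open>I - T\<close> is then a leading principal minor of the
  second, and passing to it does not decrease the determinant.\<close>
theorem tau_positive_contraction:
  assumes T: "nuclear_representation T u v" and pos: "zero_le_op_le_id T" and t: "t \<le> t'"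
  shows "Im (tau T t) = 0" "0 \<le> Re (tau T t)" "Re (tau T t) \<le> Re (tau T t')"
proof -
  let ?u = "\<lambda>t i x. indicator {t..} x *\<^sub>R u i x"
  have approx: "\<exists>\<epsilon>::nat \<Rightarrow> real. \<epsilon> \<longlonglongrightarrow> 0 \<and> (\<forall>N m e. orthonormal m e \<longrightarrow> (\<forall>j<N. spans m e (?u t j)) \<longrightarrow>
       cmod (tau T t - compressed_det m e (truncate t T)) \<le> \<epsilon> N)" for t
    unfolding tau_def
    by (rule nuclear_det_approximation[OF nuclear_rep_truncate nuclear_det_tendsto_fredholm_det[OF nuclear_rep_truncate]])
       (rule T)+
  have truncate: "compressed_det m e (truncate t T)
        = compressed_det m e T" if "\<And>i. i < m \<Longrightarrow> e i \<in> L2_beyond t" for m e t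
    using that by (intro leibniz_det_cong) (simp add: Defs.truncate_def l2_inner_truncate)
  obtain \<epsilon> where \<epsilon>: "\<epsilon> \<longlonglongrightarrow> 0" and ap: "\<forall>N m e. orthonormal m e \<longrightarrow> (\<forall>j<N. spans m e (?u t j)) \<longrightarrow>
       cmod (tau T t - compressed_det m e (truncate t T)) \<le> \<epsilon> N"
    using approx[of t] by (elim exE conjE) (rule that)
  obtain \<epsilon>' where \<epsilon>': "\<epsilon>' \<longlonglongrightarrow> 0" and ap': "\<forall>N m e. orthonormal m e \<longrightarrow> (\<forall>j<N. spans m e (?u t' j)) \<longrightarrow>
       cmod (tau T t' - compressed_det m e (truncate t' T)) \<le> \<epsilon>' N"
    using approx[of t'] by (elim exE conjE) (rule that)
  have "\<exists>a b. cmod (tau T t - a) \<le> \<epsilon> N \<and> cmod (tau T t' - b) \<le> \<epsilon>' N \<and> Im a = 0 \<and> 0 \<le> Re a \<and> Re a \<le> Re b" for N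
  proof -
    have ws: "set (map (?u s) [0..<N]) \<subseteq> L2_beyond s" for s
      using L2_truncate(1)[OF nuclear_rep_L2(1)[OF T]] by auto
    obtain m1 e1 where e1: "orthonormal m1 e1" "\<And>i. i < m1 \<Longrightarrow> e1 i \<in> L2_beyond t'"
       "\<And>w. w \<in> set (map (?u t') [0..<N]) \<Longrightarrow> spans m1 e1 w"
      by (rule gram_schmidt[OF l2_subspace_L2_beyond[of t'] orthonormal_0[of "\<lambda>_ _. 0"] _ ws[of t']]) auto
    have e1t: "\<And>i. i < m1 \<Longrightarrow> e1 i \<in> L2_beyond t" using e1(2) L2_beyond_mono[OF t] by blast
    obtain m2 e2 where e2: "m1 \<le> m2" "\<And>i. i < m1 \<Longrightarrow> e2 i = e1 i" "orthonormal m2 e2"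
       "\<And>i. i < m2 \<Longrightarrow> e2 i \<in> L2_beyond t" "\<And>w. w \<in> set (map (?u t) [0..<N]) \<Longrightarrow> spans m2 e2 w"
      by (rule gram_schmidt[OF l2_subspace_L2_beyond[of t] e1(1) e1t ws[of t]]) auto
    let ?B = "\<lambda>i j. kron i j - l2_inner (e2 i) (T (e2 j))"
    note sec = positive_contraction_section[OF T pos e2(3)]
    have "leibniz_det m2 ?B = compressed_det m2 e2 (truncate t T)"
      by (rule truncate[symmetric]) (rule e2(4))
    then have "cmod (tau T t - leibniz_det m2 ?B) \<le> \<epsilon> N"
      using ap e2(3,5) by simp
    moreover have "leibniz_det m1 ?B = compressed_det m1 e1 T"
      using e2(2) by (intro leibniz_det_cong) simp
    then have "leibniz_det m1 ?B = compressed_det m1 e1 (truncate t' T)"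
      using truncate[of m1 e1 t'] e1(2) by simp
    then have "cmod (tau T t' - leibniz_det m1 ?B) \<le> \<epsilon>' N"
      using ap' e1(1,3) by simp
    moreover have "Re (leibniz_det m2 ?B) \<le> Re (leibniz_det m1 ?B)"
      by (rule psd_det_antimono[OF sec(1) e2(1) sec(2)])
    ultimately show ?thesis
      using psd_det_real[OF sec(1)] psd_det_nonneg[OF sec(1)] by blast
  qed
  then obtain a b where ab: "cmod (tau T t - a N) \<le> \<epsilon> N" "cmod (tau T t' - b N) \<le> \<epsilon>' N"
     "Im (a N) = 0" "0 \<le> Re (a N)" "Re (a N) \<le> Re (b N)" for N by metis
  have "a \<longlonglongrightarrow> tau T t"
    by (rule LIM_zero_cancel, rule Lim_null_comparison[OF _ \<epsilon>]) (use ab(1) in \<open>auto simp: norm_minus_commute\<close>)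
  moreover have "b \<longlonglongrightarrow> tau T t'"
    by (rule LIM_zero_cancel, rule Lim_null_comparison[OF _ \<epsilon>']) (use ab(2) in \<open>auto simp: norm_minus_commute\<close>)
  ultimately have lim: "(\<lambda>N. Im (a N)) \<longlonglongrightarrow> Im (tau T t)" "(\<lambda>N. Re (a N)) \<longlonglongrightarrow> Re (tau T t)"
    "(\<lambda>N. Re (b N)) \<longlonglongrightarrow> Re (tau T t')" by (auto intro: tendsto_intros)
  show "Im (tau T t) = 0" using lim(1) ab(3) by (simp add: LIMSEQ_const_iff)
  show "0 \<le> Re (tau T t)" using ab(4) by (intro LIMSEQ_le_const[OF lim(2)]) auto
  show "Re (tau T t) \<le> Re (tau T t')" using ab(5) by (intro LIMSEQ_le[OF lim(2,3)]) auto
qed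

definition expo :: "real \<Rightarrow> 'm \<Rightarrow> real \<Rightarrow> complex^'m::finite" where
  "expo r i x = of_real (exp (- r * x)) *s axis i 1"

lemma expo_nth: "expo r i x $ j = (if j = i then of_real (exp (- r * x)) else 0)"
  by (simp add: expo_def axis_def)

lemma cdot_expo: "cdot (expo r i x) a = of_real (exp (- r * x)) * a $ i"
  unfolding cdot_def expo_nth
  by (simp add: if_distrib[of cnj] if_distrib[of "\<lambda>t. t * _"] cong: if_cong)

lemma norm_expo: "norm (expo r i x) = exp (- r * x)"
  unfolding expo_def norm_cvec_scale by simp

lemma borel_measurable_expo [measurable]: "expo r i \<in> borel_measurable half_line"
  by (rule borel_measurable_vecI) (simp add: expo_nth)

lemma has_bochner_integral_exp_half_line:
  assumes r: "0 < r" and t: "0 \<le> t"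
  shows "has_bochner_integral half_line (\<lambda>x. indicator {t..} x * exp (- r * x)) (exp (- r * t) / r)"
proof (rule has_bochner_integral_nn_integral)
  show "(\<lambda>x. indicator {t..} x * exp (- r * x)) \<in> borel_measurable half_line"
    by (rule measurable_half_line) measurable
  have lim: "((\<lambda>x. - exp (- r * x) / r) \<longlongrightarrow> - 0 / r) at_top"
    using r by (intro tendsto_intros filterlim_compose[OF exp_at_bot]
       filterlim_tendsto_neg_mult_at_bot[OF tendsto_const] filterlim_ident) auto
  have "(\<integral>\<^sup>+x. ennreal (indicator {t..} x * exp (- r * x)) \<partial>half_line)
     = (\<integral>\<^sup>+x. ennreal (indicator {t..} x * exp (- r * x)) * indicator {0<..} x \<partial>lborel)"
    unfolding half_line_def by (rule nn_integral_restrict_space) simp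
  also have "\<dots> = (\<integral>\<^sup>+x. ennreal (exp (- r * x)) * indicator {t..} x \<partial>lborel)"
  proof (rule nn_integral_cong_AE)
    show "AE x in lborel. ennreal (indicator {t..} x * exp (- r * x)) * indicator {0<..} x
        = ennreal (exp (- r * x)) * indicator {t..} x"
      using AE_lborel_singleton[of 0] by eventually_elim (use t in \<open>auto simp: indicator_def\<close>)
  qed
  also have "\<dots> = ennreal (- 0 / r - (- exp (- r * t) / r))"
    by (rule nn_integral_FTC_atLeast[OF _ _ _ lim]) (use r in \<open>auto intro!: derivative_eq_intros\<close>)
  finally show "(\<integral>\<^sup>+x. ennreal (indicator {t..} x * exp (- r * x)) \<partial>half_line) = ennreal (exp (- r * t) / r)"
    by simp
qed (use r in auto)

lemma
  assumes "0 < r"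
  shows integrable_exp_half_line: "integrable half_line (\<lambda>x. exp (- r * x))"
    and integral_exp_half_line: "(\<integral>x. exp (- r * x) \<partial>half_line) = 1 / r"
proof -
  have "has_bochner_integral half_line (\<lambda>x. indicator {0..} x * exp (- r * x)) (1 / r)"
    using has_bochner_integral_exp_half_line[OF assms order_refl] by simp
  also have "?this \<longleftrightarrow> has_bochner_integral half_line (\<lambda>x. exp (- r * x)) (1 / r)"
    by (intro has_bochner_integral_cong) auto
  finally show "integrable half_line (\<lambda>x. exp (- r * x))" "(\<integral>x. exp (- r * x) \<partial>half_line) = 1 / r"
    by (auto simp: has_bochner_integral_iff)
qed

lemma exp_square: "(exp (- r * x))\<^sup>2 = exp (- (2 * r) * x)" for r x :: real
  by (simp add: power2_eq_square exp_add[symmetric])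

lemma expo_L2: "0 < r \<Longrightarrow> expo r i \<in> L2"
  unfolding L2_iff norm_expo exp_square using integrable_exp_half_line[of "2 * r"] by simp

lemma l2_norm_expo: "0 < r \<Longrightarrow> l2_norm (expo r i) = sqrt (1 / (2 * r))"
  unfolding l2_norm_eq norm_expo exp_square using integral_exp_half_line[of "2 * r"] by simp

lemma l2_norm_le_exp:
  assumes "f \<in> L2" "0 < c" "0 \<le> R" "\<And>x. 0 < x \<Longrightarrow> norm (f x) \<le> R * exp (- c * x)"
  shows "l2_norm f \<le> R * sqrt (1 / (2 * c))"
proof -
  have "(\<integral>x. (norm (f x))\<^sup>2 \<partial>half_line) \<le> (\<integral>x. R\<^sup>2 * exp (- (2 * c) * x) \<partial>half_line)"
  proof (rule integral_mono)
    fix x assume "x \<in> space half_line"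
    then have "(norm (f x))\<^sup>2 \<le> (R * exp (- c * x))\<^sup>2" using assms(4) by (intro power_mono) auto
    then show "(norm (f x))\<^sup>2 \<le> R\<^sup>2 * exp (- (2 * c) * x)"
      by (simp only: power_mult_distrib exp_square)
  qed (use assms integrable_exp_half_line[of "2 * c"] in \<open>auto intro!: L2_integrable\<close>)
  also have "\<dots> = R\<^sup>2 * (1 / (2 * c))"
    using assms(2) integral_exp_half_line[of "2 * c"] by simp
  finally have "l2_norm f \<le> sqrt (R\<^sup>2 * (1 / (2 * c)))" unfolding l2_norm_eq by simp
  also have "\<dots> = R * sqrt (1 / (2 * c))" unfolding real_sqrt_mult using assms(3) by simp
  finally show ?thesis .
qed

lemma l2_inner_expo: "l2_inner (expo r i) f = (\<integral>y. of_real (exp (- r * y)) * f y $ i \<partial>half_line)"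
  unfolding l2_inner_eq cdot_expo ..

lemma l2_inner_expo_truncated:
  assumes "0 < r" "0 < r'" "0 \<le> t"
  shows "l2_inner (expo r i) (\<lambda>x. indicator {t..} x *\<^sub>R expo r' j x)
     = (if i = j then of_real (exp (- (r + r') * t) / (r + r')) else 0)"
proof (cases "i = j")
  case True
  have "l2_inner (expo r i) (\<lambda>x. indicator {t..} x *\<^sub>R expo r' j x)
      = (\<integral>x. of_real (indicator {t..} x * exp (- (r + r') * x)) \<partial>half_line)"
    unfolding l2_inner_expo using True
    by (intro Bochner_Integration.integral_cong)
       (auto simp: expo_nth indicator_def exp_add[symmetric] of_real_mult[symmetric] algebra_simps simp del: of_real_mult)
  also have "\<dots> = of_real (exp (- (r + r') * t) / (r + r'))"
    unfolding integral_complex_of_real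
    using has_bochner_integral_integral_eq[OF has_bochner_integral_exp_half_line[of "r + r'" t]] assms by simp
  finally show ?thesis using True by simp
qed (simp add: l2_inner_expo expo_nth)

lemma l2_inner_expo_expo:
  assumes "0 < r" "0 < r'"
  shows "l2_inner (expo r i) (expo r' j) = (if i = j then of_real (1 / (r + r')) else 0)"
proof -
  have "l2_inner (expo r i) (expo r' j) = l2_inner (expo r i) (\<lambda>x. indicator {0..} x *\<^sub>R expo r' j x)"
    unfolding l2_inner_eq by (intro Bochner_Integration.integral_cong) auto
  then show ?thesis using l2_inner_expo_truncated[OF assms order_refl, of i j] by simp
qed

lemma norm_le_sum_nth: "norm (a :: complex^'m::finite) \<le> (\<Sum>i\<in>UNIV. cmod (a $ i))"
  unfolding norm_vec_def by (rule L2_set_le_sum) simp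

lemma sums_vecI:
  fixes f :: "nat \<Rightarrow> complex^'m::finite"
  assumes "\<And>i. (\<lambda>l. f l $ i) sums (S $ i)"
  shows "f sums (S :: complex^'m::finite)"
  using assms unfolding sums_def by (intro vec_tendstoI) (simp add: sum_component)

lemma sums_nth: "f sums S \<Longrightarrow> (\<lambda>l. f l $ i) sums (S $ i)" for S :: "complex^'m::finite"
  by (rule bounded_linear.sums[OF bounded_linear_vec_nth])

lemma integral_vec_nth:
  fixes f :: "real \<Rightarrow> complex^'m::finite"
  assumes "integrable M f"
  shows "integral\<^sup>L M f $ i = (\<integral>x. f x $ i \<partial>M)"
  by (rule integral_bounded_linear[OF bounded_linear_vec_nth assms, symmetric])

section \<open>Sums of decaying exponentials\<close>

locale exponents =
  fixes \<mu> :: "nat \<Rightarrow> real" and c :: real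
  assumes c_pos: "0 < c" and c_le: "c \<le> \<mu> l"
begin

lemma mu_pos: "0 < \<mu> l" using c_pos c_le[of l] by linarith

lemma exp_mu_le: "0 \<le> x \<Longrightarrow> exp (- \<mu> l * x) \<le> exp (- c * x)"
  using c_le[of l] by (simp add: mult_right_mono)

lemma l2_norm_expo_le: "l2_norm (expo (\<mu> l) i) \<le> sqrt (1 / (2 * c))"
  using c_pos c_le[of l] mu_pos[of l] by (simp add: l2_norm_expo frac_le)

lemma norm_l2_inner_expo_le:
  assumes "f \<in> L2" shows "cmod (l2_inner (expo (\<mu> l) i) f) \<le> sqrt (1 / (2 * c)) * l2_norm f"
  by (rule order.trans[OF l2_cauchy_schwarz[OF expo_L2[OF mu_pos] assms]])
     (intro mult_right_mono l2_norm_expo_le l2_norm_nonneg)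

lemma norm_series_le:
  assumes h: "(\<lambda>l. of_real (exp (- \<mu> l * x)) * H l) sums S"
    and H: "\<And>l. cmod (H l) \<le> \<eta> l" "summable \<eta>" and x: "0 \<le> x"
  shows "cmod S \<le> suminf \<eta> * exp (- c * x)"
proof -
  have le: "cmod (of_real (exp (- \<mu> l * x)) * H l) \<le> \<eta> l * exp (- c * x)" for l
  proof -
    have "cmod (of_real (exp (- \<mu> l * x)) * H l) = cmod (H l) * exp (- \<mu> l * x)"
      by (simp add: norm_mult)
    also have "\<dots> \<le> \<eta> l * exp (- c * x)"
      using H(1)[of l] order.trans[OF norm_ge_zero H(1)[of l]] by (intro mult_mono exp_mu_le x) auto
    finally show ?thesis .
  qed
  have "cmod (suminf (\<lambda>l. of_real (exp (- \<mu> l * x)) * H l)) \<le> (\<Sum>l. \<eta> l * exp (- c * x))"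
    by (rule norm_suminf_le[OF le]) (intro summable_mult2 H)
  then show ?thesis using h suminf_mult2[OF H(2)] by (simp add: sums_iff)
qed

lemma
  fixes h :: "real \<Rightarrow> complex^'m::finite"
  assumes h: "\<And>x i. 0 < x \<Longrightarrow> (\<lambda>l. of_real (exp (- \<mu> l * x)) * H l i) sums (h x $ i)"
    and H: "\<And>l i. cmod (H l i) \<le> \<eta> l" "summable \<eta>"
  shows exponential_series_L2: "h \<in> L2"
    and l2_inner_exponential_series:
      "0 < r \<Longrightarrow> (\<lambda>l. H l j / of_real (r + \<mu> l)) sums l2_inner (expo r j) h"
proof -
  let ?E = "suminf \<eta>"
  have E0: "0 \<le> ?E"
    using order.trans[OF norm_ge_zero H(1)] by (intro suminf_nonneg H) auto
  have hm: "h \<in> borel_measurable half_line"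
  proof (rule borel_measurable_vecI)
    fix i
    show "(\<lambda>x. h x $ i) \<in> borel_measurable half_line"
      by (rule borel_measurable_LIMSEQ_metric[where f = "\<lambda>n x. \<Sum>l<n. of_real (exp (- \<mu> l * x)) * H l i"])
         (use h in \<open>auto simp: sums_def intro!: measurable_half_line\<close>)
  qed
  have bd: "norm (h x) \<le> real CARD('m) * ?E * exp (- c * x)" if "0 < x" for x
  proof -
    have "norm (h x) \<le> (\<Sum>i\<in>UNIV. cmod (h x $ i))" by (rule norm_le_sum_nth)
    also have "\<dots> \<le> (\<Sum>i\<in>(UNIV::'m set). ?E * exp (- c * x))"
      using that by (intro sum_mono norm_series_le[OF h H]) auto
    finally show ?thesis by simp
  qed
  show "h \<in> L2"
  proof (rule L2_I_bound[OF hm])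
    show "integrable half_line (\<lambda>x. (real CARD('m) * ?E)\<^sup>2 * exp (- (2 * c) * x))"
      using c_pos integrable_exp_half_line[of "2 * c"] by simp
    fix x :: real assume "0 < x"
    from power_mono[OF bd[OF this], of 2]
    show "(norm (h x))\<^sup>2 \<le> (real CARD('m) * ?E)\<^sup>2 * exp (- (2 * c) * x)"
      by (simp only: power_mult_distrib exp_square norm_ge_zero)
  qed
  assume r: "0 < r"
  let ?f = "\<lambda>l x. of_real (exp (- (r + \<mu> l) * x)) * H l j"
  have r\<mu>: "0 < r + \<mu> l" for l using r mu_pos[of l] by linarith
  have int: "integrable half_line (?f l)" for l
    using integrable_exp_half_line[OF r\<mu>[of l]] by (intro integrable_mult_left integrable_of_real) 
  have val: "(\<integral>x. ?f l x \<partial>half_line) = H l j / of_real (r + \<mu> l)" for l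
    unfolding integral_mult_left_zero integral_complex_of_real integral_exp_half_line[OF r\<mu>[of l]] by simp
  have sums: "(\<lambda>l. ?f l x) sums (of_real (exp (- r * x)) * h x $ j)" if "0 < x" for x
  proof -
    have eq: "?f l x = of_real (exp (- r * x)) * (of_real (exp (- \<mu> l * x)) * H l j)" for l
    proof -
      have "exp (- (r + \<mu> l) * x) = exp (- r * x) * exp (- \<mu> l * x)"
        by (simp add: exp_add[symmetric] algebra_simps)
      then show ?thesis by (simp only: of_real_mult mult.assoc)
    qed
    show ?thesis unfolding eq by (rule sums_mult[OF h[OF that]])
  qed
  have "(\<lambda>l. \<integral>x. ?f l x \<partial>half_line) sums (\<integral>x. (\<Sum>l. ?f l x) \<partial>half_line)"
  proof (rule sums_integral[OF int])
    show "AE x in half_line. summable (\<lambda>l. norm (?f l x))"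
    proof (rule AE_I2)
      fix x assume "x \<in> space half_line"
      then have x: "0 < x" by simp
      show "summable (\<lambda>l. norm (?f l x))"
      proof (rule summable_comparison_test'[OF H(2), of 0])
        fix l
        have "- (r + \<mu> l) * x \<le> 0" using r\<mu>[of l] x by (intro mult_nonpos_nonneg) auto
        then have "exp (- (r + \<mu> l) * x) \<le> 1" by (simp only: exp_le_one_iff)
        then have "exp (- (r + \<mu> l) * x) * cmod (H l j) \<le> 1 * \<eta> l"
          by (intro mult_mono H) auto
        then show "norm (norm (?f l x)) \<le> \<eta> l" by (simp add: norm_mult)
      qed
    qed
    have "(\<integral>x. norm (?f l x) \<partial>half_line) = cmod (H l j) / (r + \<mu> l)" for l
      using integral_exp_half_line[OF r\<mu>[of l]] by (simp add: norm_mult del: mult_minus_left)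
    then show "summable (\<lambda>l. \<integral>x. norm (?f l x) \<partial>half_line)"
    proof (simp only:, intro summable_comparison_test'[OF summable_divide[OF H(2), of r], of 0])
      fix l
      have "cmod (H l j) / (r + \<mu> l) \<le> \<eta> l / r"
        using H(1)[of l j] r mu_pos[of l] by (intro frac_le) (auto intro: order.trans[OF norm_ge_zero])
      then show "norm (cmod (H l j) / (r + \<mu> l)) \<le> \<eta> l / r" using r\<mu>[of l] by simp
    qed
  qed
  also have "(\<integral>x. (\<Sum>l. ?f l x) \<partial>half_line) = l2_inner (expo r j) h"
    unfolding l2_inner_expo
    by (intro Bochner_Integration.integral_cong refl) (use sums in \<open>auto simp: sums_iff\<close>)
  finally show "(\<lambda>l. H l j / of_real (r + \<mu> l)) sums l2_inner (expo r j) h"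
    unfolding val .
qed

text \<open>Summation and integration are interchanged, with \<open>exp (- c * y) * norm (f y)\<close> as dominating function.\<close>
lemma hankel_exponential_series:
  fixes f :: "real \<Rightarrow> complex^'m::finite"
  assumes \<Phi>: "\<And>x i j. 0 < x \<Longrightarrow> (\<lambda>l. of_real (exp (- \<mu> l * x)) * D l $ i $ j) sums (\<Phi> x $ i $ j)"
    and D: "\<And>l i j. cmod (D l $ i $ j) \<le> d l" "summable d"
    and f: "f \<in> L2" and x: "0 < x"
  shows "(\<lambda>l. of_real (exp (- \<mu> l * x)) * (\<Sum>j\<in>UNIV. D l $ i $ j * l2_inner (expo (\<mu> l) j) f))
     sums (hankel \<Phi> f x $ i)"
proof -
  let ?n = "real CARD('m)"
  define h where "h l y = (\<chi> i. \<Sum>j\<in>UNIV. of_real (exp (- \<mu> l * (x + y))) * D l $ i $ j * f y $ j)" for l y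
  have d0: "0 \<le> d l" for l using order.trans[OF norm_ge_zero D(1)] .
  have fm [measurable]: "f \<in> borel_measurable half_line" by (rule L2_measurable[OF f])
  let ?G = "\<lambda>y. exp (- c * y) * norm (f y)"
  have G: "integrable half_line ?G"
    using integrable_norm_mult[OF expo_L2[OF c_pos] f] unfolding norm_expo .
  have bd: "cmod (of_real (exp (- \<mu> l * (x + y))) * D l $ i $ j * f y $ j) \<le> d l * ?G y" if "0 < y" for l y i j
  proof -
    have "exp (- \<mu> l * (x + y)) \<le> exp (- \<mu> l * y)" using x mu_pos[of l] by simp
    also have "\<dots> \<le> exp (- c * y)" using that by (intro exp_mu_le) simp
    finally have "exp (- \<mu> l * (x + y)) * (cmod (D l $ i $ j) * cmod (f y $ j)) \<le> exp (- c * y) * (d l * norm (f y))"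
      by (intro mult_mono D Finite_Cartesian_Product.norm_nth_le d0 mult_nonneg_nonneg) auto
    then show ?thesis by (simp add: norm_mult mult_ac)
  qed
  have hb: "norm (h l y) \<le> ?n * ?n * d l * ?G y" if "0 < y" for l y
  proof -
    have "norm (h l y) \<le> (\<Sum>i\<in>UNIV. cmod (h l y $ i))" by (rule norm_le_sum_nth)
    also have "\<dots> \<le> (\<Sum>i\<in>(UNIV::'m set). \<Sum>j\<in>(UNIV::'m set). d l * ?G y)"
      unfolding h_def vec_lambda_beta
      by (intro sum_mono order.trans[OF norm_sum]) (rule bd[OF that])
    finally show ?thesis by (simp add: mult_ac)
  qed
  have hm [measurable]: "h l \<in> borel_measurable half_line" for l
  proof (rule borel_measurable_vecI)
    fix i
    have [measurable]: "(\<lambda>y. complex_of_real (exp (- \<mu> l * (x + y)))) \<in> borel_measurable half_line"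
      by (rule measurable_half_line) measurable
    show "(\<lambda>y. h l y $ i) \<in> borel_measurable half_line"
      unfolding h_def vec_lambda_beta by measurable
  qed
  have int: "integrable half_line (h l)" for l
  proof (rule Bochner_Integration.integrable_bound[where f = "\<lambda>y. ?n * ?n * d l * ?G y"])
    show "AE y in half_line. norm (h l y) \<le> norm (?n * ?n * d l * ?G y)"
      using hb d0[of l] by (intro AE_I2) (simp add: abs_mult)
  qed (use G in auto)
  have sums: "(\<lambda>l. h l y) sums (\<Phi> (x + y) *v f y)" if "0 < y" for y
  proof (rule sums_vecI)
    fix i
    have "(\<lambda>l. \<Sum>j\<in>UNIV. of_real (exp (- \<mu> l * (x + y))) * D l $ i $ j * f y $ j) sums (\<Sum>j\<in>UNIV. \<Phi> (x + y) $ i $ j * f y $ j)"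
      using x that by (intro sums_sum sums_mult2 \<Phi>) auto
    then show "(\<lambda>l. h l y $ i) sums ((\<Phi> (x + y) *v f y) $ i)"
      by (simp add: h_def matrix_vector_mult_def)
  qed
  have AEs: "AE y in half_line. summable (\<lambda>l. norm (h l y))"
  proof (rule AE_I2)
    fix y assume "y \<in> space half_line"
    then have y: "0 < y" by simp
    have "summable (\<lambda>l. ?n * ?n * d l * ?G y)" by (intro summable_mult2 summable_mult D)
    then show "summable (\<lambda>l. norm (h l y))"
      by (rule summable_comparison_test'[where N = 0]) (use hb[OF y] in simp)
  qed
  have sumi: "summable (\<lambda>l. \<integral>y. norm (h l y) \<partial>half_line)"
  proof (rule summable_comparison_test'[where N = 0])
    show "summable (\<lambda>l. ?n * ?n * d l * (\<integral>y. ?G y \<partial>half_line))" by (intro summable_mult2 summable_mult D)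
    fix l
    have "(\<integral>y. norm (h l y) \<partial>half_line) \<le> (\<integral>y. ?n * ?n * d l * ?G y \<partial>half_line)"
    proof (rule integral_mono[OF integrable_norm[OF int]])
      show "integrable half_line (\<lambda>y. ?n * ?n * d l * ?G y)" using G by (rule integrable_mult_right)
      show "norm (h l y) \<le> ?n * ?n * d l * ?G y" if "y \<in> space half_line" for y
        using that by (intro hb) simp
    qed
    then show "norm (\<integral>y. norm (h l y) \<partial>half_line) \<le> ?n * ?n * d l * (\<integral>y. ?G y \<partial>half_line)" by simp
  qed
  have "(\<lambda>l. \<integral>y. h l y \<partial>half_line) sums (\<integral>y. (\<Sum>l. h l y) \<partial>half_line)"
    by (rule sums_integral[OF int AEs sumi])
  also have "(\<integral>y. (\<Sum>l. h l y) \<partial>half_line) = (\<integral>y. \<Phi> (x + y) *v f y \<partial>half_line)"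
    by (intro Bochner_Integration.integral_cong refl) (use sums in \<open>auto simp: sums_iff\<close>)
  also have "\<dots> = hankel \<Phi> f x"
    by (simp add: hankel_def set_lebesgue_integral_half_line)
  finally have "(\<lambda>l. (\<integral>y. h l y \<partial>half_line) $ i) sums (hankel \<Phi> f x $ i)" by (rule sums_nth)
  moreover have "(\<integral>y. h l y \<partial>half_line) $ i
      = of_real (exp (- \<mu> l * x)) * (\<Sum>j\<in>UNIV. D l $ i $ j * l2_inner (expo (\<mu> l) j) f)" for l
  proof -
    have fint: "integrable half_line (\<lambda>y. of_real (exp (- \<mu> l * y)) * f y $ j)" for j
      using integrable_cdot[OF expo_L2[OF mu_pos[of l], of j] f] unfolding cdot_expo .
    have "(\<integral>y. h l y \<partial>half_line) $ i = (\<integral>y. h l y $ i \<partial>half_line)" by (rule integral_vec_nth[OF int])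
    also have "\<dots> = (\<integral>y. (\<Sum>j\<in>UNIV. of_real (exp (- \<mu> l * x)) * D l $ i $ j * (of_real (exp (- \<mu> l * y)) * f y $ j)) \<partial>half_line)"
    proof (intro Bochner_Integration.integral_cong refl)
      fix y
      have "exp (- \<mu> l * (x + y)) = exp (- \<mu> l * x) * exp (- \<mu> l * y)"
        by (simp only: exp_add[symmetric] distrib_left)
      then show "h l y $ i = (\<Sum>j\<in>UNIV. of_real (exp (- \<mu> l * x)) * D l $ i $ j * (of_real (exp (- \<mu> l * y)) * f y $ j))"
        unfolding h_def vec_lambda_beta by (simp only: of_real_mult mult_ac)
    qed
    also have "\<dots> = (\<Sum>j\<in>UNIV. of_real (exp (- \<mu> l * x)) * D l $ i $ j * l2_inner (expo (\<mu> l) j) f)"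
      unfolding l2_inner_expo
      by (subst Bochner_Integration.integral_sum[OF integrable_mult_right[OF fint]])
         (rule sum.cong[OF refl integral_mult_right_zero])
    finally show ?thesis by (simp add: sum_distrib_left mult.assoc)
  qed
  ultimately show ?thesis by simp
qed

lemma
  fixes f :: "real \<Rightarrow> complex^'m::finite"
  assumes \<Phi>: "\<And>x i j. 0 < x \<Longrightarrow> (\<lambda>l. of_real (exp (- \<mu> l * x)) * D l $ i $ j) sums (\<Phi> x $ i $ j)"
    and D: "\<And>l i j. cmod (D l $ i $ j) \<le> d l" "summable d"
    and f: "f \<in> L2"
  shows hankel_exponential_L2: "hankel \<Phi> f \<in> L2"
    and matrix_hankel_exponential_L2: "(\<lambda>x. \<sigma> *v hankel \<Phi> f x) \<in> L2"
    and l2_inner_matrix_hankel_exponential: "(\<lambda>m. (\<Sum>p\<in>UNIV. \<sigma> $ k $ p * (\<Sum>j\<in>UNIV. D m $ p $ j * l2_inner (expo (\<mu> m) j) f)) / of_real (\<mu> l + \<mu> m))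
       sums l2_inner (expo (\<mu> l) k) (\<lambda>x. \<sigma> *v hankel \<Phi> f x)"
proof -
  let ?H = "\<lambda>l i. \<Sum>j\<in>UNIV. D l $ i $ j * l2_inner (expo (\<mu> l) j) f"
  let ?b = "real CARD('m) * (sqrt (1 / (2 * c)) * l2_norm f)"
  have d0: "0 \<le> d l" for l using order.trans[OF norm_ge_zero D(1)] .
  have H: "cmod (?H l i) \<le> d l * ?b" for l i
  proof -
    have "cmod (?H l i) \<le> (\<Sum>j\<in>(UNIV::'m set). d l * (sqrt (1 / (2 * c)) * l2_norm f))"
      unfolding norm_mult by (intro sum_norm_le, simp only: norm_mult, intro mult_mono D norm_l2_inner_expo_le f d0) auto
    then show ?thesis by (simp add: mult_ac)
  qed
  show "hankel \<Phi> f \<in> L2"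
    by (rule exponential_series_L2[OF hankel_exponential_series[OF \<Phi> D f] H]) (auto intro: summable_mult2 D)
  let ?s = "\<Sum>k\<in>UNIV. \<Sum>p\<in>UNIV. cmod (\<sigma> $ k $ p)"
  have s0: "(\<Sum>p\<in>UNIV. cmod (\<sigma> $ k $ p)) \<le> ?s" for k
    by (rule member_le_sum) (auto intro: sum_nonneg)
  have ser: "(\<lambda>l. of_real (exp (- \<mu> l * x)) * (\<Sum>p\<in>UNIV. \<sigma> $ k $ p * ?H l p)) sums ((\<sigma> *v hankel \<Phi> f x) $ k)"
    if "0 < x" for x k
  proof -
    have "(\<lambda>l. \<Sum>p\<in>UNIV. \<sigma> $ k $ p * (of_real (exp (- \<mu> l * x)) * ?H l p)) sums (\<Sum>p\<in>UNIV. \<sigma> $ k $ p * hankel \<Phi> f x $ p)"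
      by (intro sums_sum sums_mult hankel_exponential_series[OF \<Phi> D f that])
    then show ?thesis by (simp add: matrix_vector_mult_def sum_distrib_left mult.left_commute)
  qed
  have serb: "cmod (\<Sum>p\<in>UNIV. \<sigma> $ k $ p * ?H l p) \<le> ?s * (d l * ?b)" for k l
  proof -
    have "cmod (\<Sum>p\<in>UNIV. \<sigma> $ k $ p * ?H l p) \<le> (\<Sum>p\<in>UNIV. cmod (\<sigma> $ k $ p) * (d l * ?b))"
      by (intro sum_norm_le, simp only: norm_mult, intro mult_mono H order_refl) auto
    also have "\<dots> = (\<Sum>p\<in>UNIV. cmod (\<sigma> $ k $ p)) * (d l * ?b)" by (simp only: sum_distrib_right)
    also have "\<dots> \<le> ?s * (d l * ?b)"
      using s0 d0 c_pos by (intro mult_right_mono mult_nonneg_nonneg) auto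
    finally show ?thesis .
  qed
  have sb: "summable (\<lambda>l. ?s * (d l * ?b))" by (intro summable_mult summable_mult2 D)
  show "(\<lambda>x. \<sigma> *v hankel \<Phi> f x) \<in> L2"
    by (rule exponential_series_L2[OF ser serb sb])
  show "(\<lambda>m. (\<Sum>p\<in>UNIV. \<sigma> $ k $ p * ?H m p) / of_real (\<mu> l + \<mu> m)) sums l2_inner (expo (\<mu> l) k) (\<lambda>x. \<sigma> *v hankel \<Phi> f x)"
    by (rule l2_inner_exponential_series[OF ser serb sb mu_pos])
qed

end

lemma has_sum_quadruple:
  fixes g :: "nat \<times> nat \<times> 'm::finite \<times> 'm \<Rightarrow> complex"
  assumes g: "g summable_on UNIV"
    and inner: "\<And>l. (\<lambda>m. \<Sum>i\<in>UNIV. \<Sum>j\<in>UNIV. g (l, m, i, j)) sums G l" and outer: "G sums S"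
  shows "(g has_sum S) UNIV"
proof -
  have U: "UNIV = Sigma UNIV (\<lambda>_. UNIV)" by auto
  have "(\<lambda>y. g (l, y)) summable_on UNIV" for l
    using summable_on_SigmaD1[of "\<lambda>x y. g (x, y)" UNIV "\<lambda>_. UNIV" l] g by (simp add: U[symmetric])
  then have hl: "((\<lambda>y. g (l, y)) has_sum infsum (\<lambda>y. g (l, y)) UNIV) UNIV" for l
    by (rule has_sum_infsum)
  have "infsum (\<lambda>y. g (l, y)) UNIV = G l" for l
  proof -
    have "((\<lambda>m. \<Sum>i\<in>UNIV. \<Sum>j\<in>UNIV. g (l, m, i, j)) has_sum infsum (\<lambda>y. g (l, y)) UNIV) UNIV"
    proof (rule has_sum_SigmaD)
      show "((\<lambda>y. g (l, y)) has_sum infsum (\<lambda>y. g (l, y)) UNIV) (Sigma UNIV (\<lambda>_. UNIV))"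
        using hl by (simp add: U[symmetric])
      show "((\<lambda>y. g (l, m, y)) has_sum (\<Sum>i\<in>UNIV. \<Sum>j\<in>UNIV. g (l, m, i, j))) UNIV" for m
        by (rule has_sum_finiteI) (auto simp: sum.cartesian_product split_def)
    qed
    then show ?thesis using inner sums_unique2 has_sum_imp_sums by blast
  qed
  with hl have "((\<lambda>y. g (l, y)) has_sum G l) UNIV" for l by metis
  then have "(G has_sum infsum g UNIV) UNIV"
    by (intro has_sum_SigmaD[where A = UNIV and B = "\<lambda>_. UNIV" and f = g])
       (use has_sum_infsum[OF g] in \<open>simp_all add: U[symmetric]\<close>)
  then have "infsum g UNIV = S" using outer sums_unique2 has_sum_imp_sums by blast
  then show ?thesis using has_sum_infsum[OF g] by simp
qed

lemma summable_on_quadruple: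
  fixes \<gamma> :: "nat \<Rightarrow> real"
  assumes "summable \<gamma>" "\<And>l. 0 \<le> \<gamma> l"
  shows "(\<lambda>(l, m, i, j). \<gamma> l * \<gamma> m) summable_on (UNIV :: (nat \<times> nat \<times> 'm::finite \<times> 'm) set)"
proof -
  have U: "UNIV = Sigma UNIV (\<lambda>_. UNIV)" by auto
  let ?N = "real (card (UNIV :: ('m \<times> 'm) set))"
  have \<gamma>: "(\<gamma> has_sum suminf \<gamma>) UNIV"
    using assms by (intro norm_summable_imp_has_sum) (auto intro: summable_sums)
  have fin: "((\<lambda>y. \<gamma> l * \<gamma> m) has_sum (?N * \<gamma> l * \<gamma> m)) (UNIV :: ('m \<times> 'm) set)" for l m
    by (rule has_sum_finiteI) auto
  have out: "((\<lambda>m. ?N * \<gamma> l * \<gamma> m) has_sum (?N * \<gamma> l * suminf \<gamma>)) UNIV" for l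
    by (intro has_sum_cmult_right \<gamma>)
  have inner: "((\<lambda>(m, y). \<gamma> l * \<gamma> m) has_sum (?N * \<gamma> l * suminf \<gamma>)) (Sigma UNIV (\<lambda>_. UNIV :: ('m \<times> 'm) set))" for l
  proof (rule has_sum_SigmaI)
    show "((\<lambda>y. case (m, y) of (m, y) \<Rightarrow> \<gamma> l * \<gamma> m) has_sum (?N * \<gamma> l * \<gamma> m)) (UNIV :: ('m \<times> 'm) set)" for m
      using fin by simp
    show "(\<lambda>(m, y). \<gamma> l * \<gamma> m) summable_on Sigma UNIV (\<lambda>_. UNIV :: ('m \<times> 'm) set)"
    proof (rule summable_on_SigmaI)
      show "((\<lambda>y. case (m, y) of (m, y) \<Rightarrow> \<gamma> l * \<gamma> m) has_sum (?N * \<gamma> l * \<gamma> m)) (UNIV :: ('m \<times> 'm) set)" for m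
        using fin by simp
      show "(\<lambda>m. ?N * \<gamma> l * \<gamma> m) summable_on UNIV" using out by (rule has_sum_imp_summable)
    qed (use assms in auto)
  qed (rule out)
  have "(\<lambda>(l, m, y). \<gamma> l * \<gamma> m) summable_on Sigma UNIV (\<lambda>_. UNIV :: (nat \<times> 'm \<times> 'm) set)"
  proof (rule summable_on_SigmaI)
    show "((\<lambda>y. case (l, y) of (l, m, y) \<Rightarrow> \<gamma> l * \<gamma> m) has_sum (?N * \<gamma> l * suminf \<gamma>)) (UNIV :: (nat \<times> 'm \<times> 'm) set)" for l
      using inner[of l] by (simp add: U[symmetric] split_def)
    show "(\<lambda>l. ?N * \<gamma> l * suminf \<gamma>) summable_on UNIV"
      using \<gamma> by (intro summable_on_cmult_left summable_on_cmult_right) (rule has_sum_imp_summable)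
  qed (use assms in auto)
  then show ?thesis by (simp add: U[symmetric] split_def)
qed

section \<open>Operator norms\<close>

lemma bounded_linear_matrix_vector_mult: "bounded_linear (\<lambda>x. (A :: complex^'n::finite^'m::finite) *v x)"
proof -
  have "linear (\<lambda>x. A *v x)"
  proof (rule linearI)
    show "A *v (x + y) = A *v x + A *v y" for x y by (rule matrix_vector_right_distrib)
    show "A *v (r *\<^sub>R x) = r *\<^sub>R (A *v x)" for r x
      by (simp add: Finite_Cartesian_Product.vec_eq_iff matrix_vector_mult_def scaleR_sum_right)
  qed
  then show ?thesis by (simp add: linear_conv_bounded_linear)
qed

lemma norm_matrix_vector_le: "norm (A *v x) \<le> mat_norm A * norm x"
  for A :: "complex^'n::finite^'m::finite"
  unfolding mat_norm_def by (rule onorm[OF bounded_linear_matrix_vector_mult])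

lemma mat_norm_nonneg: "0 \<le> mat_norm (A :: complex^'n::finite^'m::finite)"
  unfolding mat_norm_def by (rule onorm_pos_le[OF bounded_linear_matrix_vector_mult])

lemma mat_norm_le_entries:
  "mat_norm (A :: complex^'n::finite^'m::finite) \<le> (\<Sum>i\<in>UNIV. \<Sum>j\<in>UNIV. cmod (A $ i $ j))"
  unfolding mat_norm_def
proof (rule onorm_bound)
  fix x :: "complex^'n"
  have "norm (A *v x) \<le> (\<Sum>i\<in>UNIV. cmod ((A *v x) $ i))" by (rule norm_le_sum_nth)
  also have "\<dots> \<le> (\<Sum>i\<in>UNIV. \<Sum>j\<in>UNIV. cmod (A $ i $ j) * norm x)"
  proof (rule sum_mono)
    fix i
    have "cmod ((A *v x) $ i) \<le> (\<Sum>j\<in>UNIV. cmod (A $ i $ j * x $ j))"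
      by (simp add: matrix_vector_mult_def norm_sum)
    also have "\<dots> \<le> (\<Sum>j\<in>UNIV. cmod (A $ i $ j) * norm x)"
      by (intro sum_mono) (simp add: norm_mult mult_left_mono Finite_Cartesian_Product.norm_nth_le)
    finally show "cmod ((A *v x) $ i) \<le> (\<Sum>j\<in>UNIV. cmod (A $ i $ j) * norm x)" .
  qed
  also have "\<dots> = (\<Sum>i\<in>UNIV. \<Sum>j\<in>UNIV. cmod (A $ i $ j)) * norm x"
    by (simp add: sum_distrib_right)
  finally show "norm (A *v x) \<le> (\<Sum>i\<in>UNIV. \<Sum>j\<in>UNIV. cmod (A $ i $ j)) * norm x" .
qed (simp add: sum_nonneg)

lemma mat_norm_diff_le: "\<bar>mat_norm A - mat_norm B\<bar> \<le> mat_norm (A - B)"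
  for A B :: "complex^'n::finite^'m::finite"
proof -
  have 1: "mat_norm A \<le> mat_norm B + mat_norm (A - B)" for A B :: "complex^'n^'m"
  proof -
    have "(\<lambda>x. A *v x) = (\<lambda>x. B *v x + (A - B) *v x)"
      by (auto simp: matrix_vector_mult_diff_rdistrib)
    then show ?thesis
      unfolding mat_norm_def
      by (metis onorm_triangle[OF bounded_linear_matrix_vector_mult bounded_linear_matrix_vector_mult])
  qed
  have "(\<lambda>x. (B - A) *v x) = (\<lambda>x. - ((A - B) *v x))"
    by (auto simp: matrix_vector_mult_diff_rdistrib)
  then have "mat_norm (B - A) = mat_norm (A - B)"
    unfolding mat_norm_def by (simp add: onorm_neg)
  then show ?thesis using 1[of A B] 1[of B A] by simp
qed

lemma continuous_on_mat_norm: "continuous_on UNIV (mat_norm :: complex^'n::finite^'m::finite \<Rightarrow> real)"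
proof (rule lipschitz_on_continuous_on)
  show "(real CARD('m) * real CARD('n))-lipschitz_on UNIV (mat_norm :: complex^'n^'m \<Rightarrow> real)"
  proof (rule lipschitz_onI)
    fix A B :: "complex^'n^'m"
    have "cmod ((A - B) $ i $ j) \<le> norm (A - B)" for i j
      using order.trans[OF Finite_Cartesian_Product.norm_nth_le Finite_Cartesian_Product.norm_nth_le] .
    then have "(\<Sum>i\<in>(UNIV::'m set). \<Sum>j\<in>(UNIV::'n set). cmod ((A - B) $ i $ j))
        \<le> (\<Sum>i\<in>(UNIV::'m set). \<Sum>j\<in>(UNIV::'n set). norm (A - B))" by (intro sum_mono)
    then show "dist (mat_norm A) (mat_norm B) \<le> real CARD('m) * real CARD('n) * dist A B"
      unfolding dist_norm real_norm_def
      using order.trans[OF mat_norm_diff_le mat_norm_le_entries, of A B] by simp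
  qed simp
qed

lemma ennreal_l2_norm_square:
  "f \<in> L2 \<Longrightarrow> ennreal ((l2_norm f)\<^sup>2) = (\<integral>\<^sup>+x. ennreal ((norm (f x))\<^sup>2) \<partial>half_line)"
  unfolding l2_norm_square by (rule nn_integral_eq_integral[symmetric]) (auto intro: L2_integrable)

text \<open>A Hankel operator is dominated by the scalar integral operator whose Hilbert--Schmidt norm squared is
  \<open>\<integral>\<integral> \<parallel>\<Phi>(x + y)\<parallel>\<^sup>2 dx dy = \<integral> w \<parallel>\<Phi>(w)\<parallel>\<^sup>2 dw\<close>.\<close>
lemma hankel_norm_le:
  fixes \<Phi> :: "real \<Rightarrow> complex^'m::finite^'m"
  assumes \<Phi>: "\<Phi> \<in> borel_measurable half_line" and f: "f \<in> L2" and h: "hankel \<Phi> f \<in> L2"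
  shows "ennreal ((l2_norm (hankel \<Phi> f))\<^sup>2)
    \<le> (\<integral>\<^sup>+x\<in>{0<..}. ennreal (x * (mat_norm (\<Phi> x))\<^sup>2) \<partial>lborel) * ennreal ((l2_norm f)\<^sup>2)"
proof -
  define k where "k w = ennreal ((mat_norm (\<Phi> w))\<^sup>2) * indicator {0<..} w" for w
  have "(\<lambda>x. mat_norm (\<Phi> x)) \<in> borel_measurable half_line"
    by (rule borel_measurable_continuous_on[OF continuous_on_mat_norm \<Phi>])
  then have "(\<lambda>x. ennreal ((mat_norm (\<Phi> x))\<^sup>2)) \<in> borel_measurable half_line" by measurable
  then have k [measurable]: "k \<in> borel_measurable borel"
    unfolding half_line_def k_def by (subst (asm) borel_measurable_restrict_space_iff_ennreal) auto
  have fm [measurable]: "f \<in> borel_measurable half_line" by (rule L2_measurable[OF f])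
  let ?F = "ennreal ((l2_norm f)\<^sup>2)"
  have km: "(\<lambda>y. k (x + y)) \<in> borel_measurable half_line" for x
    by (rule measurable_half_line) measurable
  have pt: "ennreal ((norm (hankel \<Phi> f x))\<^sup>2) \<le> (\<integral>\<^sup>+y. k (x + y) \<partial>half_line) * ?F" if x: "0 < x" for x
  proof -
    have nm: "(\<lambda>y. ennreal (mat_norm (\<Phi> (x + y)))) \<in> borel_measurable half_line"
    proof -
      have "(\<lambda>y. ennreal (sqrt (enn2real (k (x + y))))) \<in> borel_measurable half_line"
        using km[of x] by measurable
      moreover have "ennreal (sqrt (enn2real (k (x + y)))) = ennreal (mat_norm (\<Phi> (x + y)))" if "0 < y" for y
        using that x by (simp add: k_def mat_norm_nonneg)
      ultimately show ?thesis
        using measurable_cong[of half_line "\<lambda>y. ennreal (sqrt (enn2real (k (x + y))))" "\<lambda>y. ennreal (mat_norm (\<Phi> (x + y)))" borel]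
        by simp
    qed
    have "ennreal (norm (hankel \<Phi> f x)) \<le> (\<integral>\<^sup>+y. ennreal (mat_norm (\<Phi> (x + y))) * ennreal (norm (f y)) \<partial>half_line)"
    proof (cases "integrable half_line (\<lambda>y. \<Phi> (x + y) *v f y)")
      case True
      have "ennreal (norm (hankel \<Phi> f x)) \<le> (\<integral>\<^sup>+y. ennreal (norm (\<Phi> (x + y) *v f y)) \<partial>half_line)"
        unfolding hankel_def set_lebesgue_integral_half_line by (rule integral_norm_bound_ennreal[OF True])
      also have "\<dots> \<le> (\<integral>\<^sup>+y. ennreal (mat_norm (\<Phi> (x + y))) * ennreal (norm (f y)) \<partial>half_line)"
        by (intro nn_integral_mono)
           (simp add: ennreal_mult[symmetric] mat_norm_nonneg norm_matrix_vector_le ennreal_leI)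
      finally show ?thesis .
    next
      case False
      then show ?thesis
        unfolding hankel_def set_lebesgue_integral_half_line by (simp add: not_integrable_integral_eq)
    qed
    then have "ennreal ((norm (hankel \<Phi> f x))\<^sup>2) \<le> (\<integral>\<^sup>+y. ennreal (mat_norm (\<Phi> (x + y))) * ennreal (norm (f y)) \<partial>half_line)\<^sup>2"
      by (simp add: ennreal_power[symmetric] power_mono)
    also have "\<dots> \<le> (\<integral>\<^sup>+y. (ennreal (mat_norm (\<Phi> (x + y))))\<^sup>2 \<partial>half_line) * (\<integral>\<^sup>+y. (ennreal (norm (f y)))\<^sup>2 \<partial>half_line)"
      by (rule Cauchy_Schwarz_nn_integral) (use nm in auto)
    also have "(\<integral>\<^sup>+y. (ennreal (norm (f y)))\<^sup>2 \<partial>half_line) = ?F"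
      unfolding ennreal_l2_norm_square[OF f] by (simp add: ennreal_power)
    also have "(\<integral>\<^sup>+y. (ennreal (mat_norm (\<Phi> (x + y))))\<^sup>2 \<partial>half_line) = (\<integral>\<^sup>+y. k (x + y) \<partial>half_line)"
      using x by (intro nn_integral_cong) (simp add: k_def ennreal_power mat_norm_nonneg)
    finally show ?thesis .
  qed
  have shift: "(\<integral>\<^sup>+y. k (x + y) \<partial>half_line) = (\<integral>\<^sup>+w. k w * indicator {x<..} w \<partial>lborel)" for x
  proof -
    have "(\<integral>\<^sup>+y. k (x + y) \<partial>half_line) = (\<integral>\<^sup>+y. k (x + y) * indicator {0<..} y \<partial>lborel)"
      unfolding half_line_def by (rule nn_integral_restrict_space) simp
    also have "\<dots> = (\<integral>\<^sup>+y. k (x + 1 * y) * indicator {x<..} (x + 1 * y) \<partial>lborel)"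
      by (intro nn_integral_cong) (simp add: indicator_def)
    also have "\<dots> = (\<integral>\<^sup>+w. k w * indicator {x<..} w \<partial>lborel)"
      by (subst (2) nn_integral_real_affine[of _ 1 x]) auto
    finally show ?thesis .
  qed
  have "ennreal ((l2_norm (hankel \<Phi> f))\<^sup>2) = (\<integral>\<^sup>+x. ennreal ((norm (hankel \<Phi> f x))\<^sup>2) \<partial>half_line)"
    by (rule ennreal_l2_norm_square[OF h])
  also have "\<dots> \<le> (\<integral>\<^sup>+x. (\<integral>\<^sup>+w. k w * indicator {x<..} w \<partial>lborel) * ?F \<partial>half_line)"
    unfolding shift[symmetric] by (intro nn_integral_mono pt) simp
  also have "\<dots> = (\<integral>\<^sup>+x. (\<integral>\<^sup>+w. k w * indicator {x<..} w \<partial>lborel) * ?F * indicator {0<..} x \<partial>lborel)"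
    unfolding half_line_def by (rule nn_integral_restrict_space) simp
  also have "\<dots> = (\<integral>\<^sup>+x. (\<integral>\<^sup>+w. k w * indicator {x<..} w * indicator {0<..} x \<partial>lborel) * ?F \<partial>lborel)"
  proof (intro nn_integral_cong)
    fix x :: real
    have [measurable]: "(\<lambda>w. k w * indicator {x<..} w) \<in> borel_measurable borel" by measurable
    show "(\<integral>\<^sup>+w. k w * indicator {x<..} w \<partial>lborel) * ?F * indicator {0<..} x
        = (\<integral>\<^sup>+w. k w * indicator {x<..} w * indicator {0<..} x \<partial>lborel) * ?F"
      by (subst nn_integral_multc) (auto simp: mult_ac)
  qed
  also have "\<dots> = (\<integral>\<^sup>+x. (\<integral>\<^sup>+w. k w * indicator {(x, w). 0 < x \<and> x < w} (x, w) \<partial>lborel) * ?F \<partial>lborel)"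
  proof -
    have "k w * indicator {x<..} w * indicator {0<..} x = k w * indicator {(x, w). 0 < x \<and> x < w} (x, w)" for x w
      by (auto simp: indicator_def)
    then show ?thesis by simp
  qed
  also have "\<dots> = (\<integral>\<^sup>+x. \<integral>\<^sup>+w. k w * indicator {(x, w). 0 < x \<and> x < w} (x, w) \<partial>lborel \<partial>lborel) * ?F"
    by (rule nn_integral_multc) measurable
  also have "(\<integral>\<^sup>+x. \<integral>\<^sup>+w. k w * indicator {(x, w). 0 < x \<and> x < w} (x, w) \<partial>lborel \<partial>lborel)
      = (\<integral>\<^sup>+w. \<integral>\<^sup>+x. k w * indicator {(x, w). 0 < x \<and> x < w} (x, w) \<partial>lborel \<partial>lborel)"
    by (rule lborel_pair.Fubini'[symmetric]) measurable
  also have "\<dots> = (\<integral>\<^sup>+w\<in>{0<..}. ennreal (w * (mat_norm (\<Phi> w))\<^sup>2) \<partial>lborel)"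
  proof (intro nn_integral_cong)
    fix w :: real
    have "(\<integral>\<^sup>+x. k w * indicator {(x, w). 0 < x \<and> x < w} (x, w) \<partial>lborel) = (\<integral>\<^sup>+x. k w * indicator {0<..<w} x \<partial>lborel)"
      by (intro nn_integral_cong) (simp add: indicator_def)
    also have "\<dots> = k w * emeasure lborel {0<..<w}"
      by (simp add: nn_integral_cmult_indicator)
    also have "\<dots> = ennreal (w * (mat_norm (\<Phi> w))\<^sup>2) * indicator {0<..} w"
      by (cases "0 < w") (auto simp: k_def ennreal_mult mult.commute)
    finally show "(\<integral>\<^sup>+x. k w * indicator {(x, w). 0 < x \<and> x < w} (x, w) \<partial>lborel)
        = ennreal (w * (mat_norm (\<Phi> w))\<^sup>2) * indicator {0<..} w" .
  qed
  finally show ?thesis .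
qed

section \<open>Hankel operators with exponentially decaying symbols\<close>

text \<open>The symmetry of \<open>\<Psi>\<close> turns the adjoint of the symbol shifted by \<open>cnj s\<close> into the symbol shifted by \<open>s\<close>;
  this is why the operators depend holomorphically, not antiholomorphically, on \<open>s\<close>.\<close>
locale exponential_symbol = exponents \<mu> c for \<mu> c +
  fixes \<Psi> :: "complex \<Rightarrow> complex^'m::finite^'m" and C :: "nat \<Rightarrow> complex^'m^'m"
    and \<gamma> :: "nat \<Rightarrow> real" and \<sigma> :: "complex^'m^'m"
  assumes summable_gamma: "summable \<gamma>" and C_le: "cmod (C l $ i $ j) \<le> \<gamma> l"
    and Psi_sums: "0 < Re z \<Longrightarrow> (\<lambda>l. exp (- of_real (\<mu> l) * z) * C l $ i $ j) sums (\<Psi> z $ i $ j)"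
    and Psi_symmetric: "0 < Re z \<Longrightarrow> cadjoint (\<Psi> (cnj z)) = \<Psi> z"
begin

abbreviation K :: "complex \<Rightarrow> 'm operator" where
  "K \<equiv> K_op \<Psi> \<sigma>"

definition shifted_coeff :: "complex \<Rightarrow> nat \<Rightarrow> complex^'m^'m" where
  "shifted_coeff s l = (\<chi> i j. exp (- 2 * of_real (\<mu> l) * s) * C l $ i $ j)"

lemma gamma_nonneg: "0 \<le> \<gamma> l"
  using order.trans[OF norm_ge_zero C_le] .

lemma norm_exp_shift_le: "0 \<le> Re s \<Longrightarrow> cmod (exp (- 2 * of_real (\<mu> l) * s)) \<le> 1"
  using mu_pos[of l] by simp

lemma shifted_coeff_le:
  assumes "0 \<le> Re s" shows "cmod (shifted_coeff s l $ i $ j) \<le> \<gamma> l"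
proof -
  have "cmod (exp (- 2 * of_real (\<mu> l) * s)) * cmod (C l $ i $ j) \<le> 1 * \<gamma> l"
    by (intro mult_mono norm_exp_shift_le assms C_le) auto
  then show ?thesis unfolding shifted_coeff_def vec_lambda_beta norm_mult by simp
qed

lemma shift_sym_sums:
  assumes "0 \<le> Re s" "0 < x"
  shows "(\<lambda>l. of_real (exp (- \<mu> l * x)) * shifted_coeff s l $ i $ j) sums (shift_sym \<Psi> s x $ i $ j)"
proof -
  have "exp (- of_real (\<mu> l) * (of_real x + 2 * s)) * C l $ i $ j
      = of_real (exp (- \<mu> l * x)) * shifted_coeff s l $ i $ j" for l
    unfolding shifted_coeff_def vec_lambda_beta exp_of_real[symmetric]
    by (simp add: exp_add[symmetric] mult.assoc[symmetric]) (simp add: algebra_simps)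
  then show ?thesis
    using Psi_sums[of "of_real x + 2 * s" i j] assms by (simp add: shift_sym_def)
qed

lemma shift_sym_star_eq:
  assumes "0 \<le> Re s" "0 < x"
  shows "shift_sym_star \<Psi> s x = shift_sym \<Psi> s x"
  using Psi_symmetric[of "of_real x + 2 * s"] assms by (simp add: shift_sym_star_def shift_sym_def)

lemma shift_sym_star_sums:
  assumes "0 \<le> Re s" "0 < x"
  shows "(\<lambda>l. of_real (exp (- \<mu> l * x)) * shifted_coeff s l $ i $ j) sums (shift_sym_star \<Psi> s x $ i $ j)"
  unfolding shift_sym_star_eq[OF assms] by (rule shift_sym_sums[OF assms])

lemma hankel_shift_L2:
  assumes "0 \<le> Re s" "f \<in> L2"
  shows "hankel (shift_sym \<Psi> s) f \<in> L2" "(\<lambda>x. \<sigma> *v hankel (shift_sym \<Psi> s) f x) \<in> L2"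
  using hankel_exponential_L2[OF shift_sym_sums[OF assms(1)] shifted_coeff_le[OF assms(1)] summable_gamma assms(2)]
    matrix_hankel_exponential_L2[OF shift_sym_sums[OF assms(1)] shifted_coeff_le[OF assms(1)] summable_gamma assms(2)]
  by auto

lemma K_L2: "0 \<le> Re s \<Longrightarrow> f \<in> L2 \<Longrightarrow> K s f \<in> L2"
  unfolding K_op_def
  by (rule hankel_exponential_L2[OF shift_sym_star_sums shifted_coeff_le summable_gamma hankel_shift_L2(2)])

text \<open>The coefficient of the rank one operator with kernel
  \<open>exp(- \<mu>\<^sub>l x - \<mu>\<^sub>m y)\<close> between the coordinates \<open>i\<close> and \<open>j\<close>.\<close>
definition kernel_coeff :: "complex \<Rightarrow> nat \<times> nat \<times> 'm \<times> 'm \<Rightarrow> complex" where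
  "kernel_coeff s = (\<lambda>(l, m, i, j). (\<Sum>p\<in>UNIV. \<Sum>q\<in>UNIV.
     shifted_coeff s l $ i $ p * \<sigma> $ p $ q * shifted_coeff s m $ q $ j) / of_real (\<mu> l + \<mu> m))"

definition sigma_entries :: real where
  "sigma_entries = (\<Sum>p\<in>UNIV. \<Sum>q\<in>UNIV. cmod (\<sigma> $ p $ q))"

text \<open>A majorant of the coefficients that is uniform in \<open>s\<close> on the closed half-plane.\<close>
definition weight :: "nat \<times> nat \<times> 'm \<times> 'm \<Rightarrow> real" where
  "weight = (\<lambda>(l, m, i, j). sigma_entries / (2 * c) * (\<gamma> l * \<gamma> m))"

lemma weight_nonneg: "0 \<le> weight a"
  unfolding weight_def sigma_entries_def using c_pos gamma_nonneg
  by (auto intro!: mult_nonneg_nonneg divide_nonneg_nonneg sum_nonneg split: prod.split)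

lemma weight_summable: "weight summable_on UNIV"
proof -
  have "(\<lambda>a. sigma_entries / (2 * c) * (case a of (l, m, i, j) \<Rightarrow> \<gamma> l * \<gamma> m)) summable_on (UNIV :: (nat \<times> nat \<times> 'm \<times> 'm) set)"
    by (intro summable_on_cmult_right summable_on_quadruple summable_gamma gamma_nonneg)
  then show ?thesis by (simp add: weight_def split_def)
qed

lemma kernel_coeff_shift:
  "kernel_coeff s (l, m, i, j) = exp (- 2 * of_real (\<mu> l + \<mu> m) * s) * kernel_coeff 0 (l, m, i, j)"
proof -
  have "exp (- 2 * of_real (\<mu> l + \<mu> m) * s) = exp (- 2 * of_real (\<mu> l) * s) * exp (- 2 * of_real (\<mu> m) * s)"
    by (simp add: exp_add[symmetric] algebra_simps)
  then show ?thesis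
    by (simp add: kernel_coeff_def shifted_coeff_def sum_distrib_left mult_ac)
qed

lemma kernel_coeff_0_le: "cmod (kernel_coeff 0 a) \<le> weight a"
proof -
  obtain l m i j where a: "a = (l, m, i, j)" by (cases a) auto
  let ?S = "\<Sum>p\<in>UNIV. \<Sum>q\<in>UNIV. shifted_coeff 0 l $ i $ p * \<sigma> $ p $ q * shifted_coeff 0 m $ q $ j"
  have "cmod ?S \<le> (\<Sum>p\<in>UNIV. \<Sum>q\<in>UNIV. \<gamma> l * cmod (\<sigma> $ p $ q) * \<gamma> m)"
    by (intro sum_norm_le, simp only: norm_mult, intro mult_mono shifted_coeff_le)
       (auto simp: gamma_nonneg)
  also have "\<dots> = sigma_entries * (\<gamma> l * \<gamma> m)"
    by (simp add: sigma_entries_def sum_distrib_left sum_distrib_right mult_ac)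
  finally have S: "cmod ?S \<le> sigma_entries * (\<gamma> l * \<gamma> m)" .
  have "cmod (kernel_coeff 0 a) = cmod ?S / (\<mu> l + \<mu> m)"
    using mu_pos[of l] mu_pos[of m] unfolding a kernel_coeff_def split_conv norm_divide norm_of_real by simp
  also have "\<dots> \<le> (sigma_entries * (\<gamma> l * \<gamma> m)) / (2 * c)"
    using S c_pos c_le[of l] c_le[of m] by (intro frac_le) (auto intro: order.trans[OF norm_ge_zero])
  finally show ?thesis by (simp add: a weight_def)
qed

lemma kernel_coeff_le:
  assumes "0 \<le> Re s"
  shows "cmod (kernel_coeff s a) \<le> exp (- (4 * c) * Re s) * weight a"
proof -
  obtain l m i j where a: "a = (l, m, i, j)" by (cases a) auto
  have "2 * c \<le> \<mu> l + \<mu> m" using c_le[of l] c_le[of m] by simp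
  from mult_right_mono[OF this assms]
  have "cmod (exp (- 2 * of_real (\<mu> l + \<mu> m) * s)) \<le> exp (- (4 * c) * Re s)"
    by (simp add: algebra_simps)
  then show ?thesis
    unfolding a kernel_coeff_shift[of s] norm_mult
    by (intro mult_mono kernel_coeff_0_le) auto
qed

lemma kernel_coeff_le_weight:
  assumes "0 \<le> Re s"
  shows "cmod (kernel_coeff s a) \<le> weight a"
proof -
  have "exp (- (4 * c) * Re s) \<le> 1" using c_pos assms by simp
  from mult_right_mono[OF this weight_nonneg[of a]] kernel_coeff_le[OF assms, of a]
  show ?thesis by simp
qed

definition index :: "nat \<Rightarrow> nat \<times> nat \<times> 'm \<times> 'm" where
  "index = from_nat_into UNIV"

lemma bij_index: "bij_betw index UNIV UNIV"
proof -
  have "infinite (UNIV :: (nat \<times> nat \<times> 'm \<times> 'm) set)"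
    by (simp add: finite_prod)
  then show ?thesis unfolding index_def by (intro bij_betw_from_nat_into) auto
qed

lemma summable_weight_index: "summable (\<lambda>k. weight (index k))"
proof -
  have "(\<lambda>k. weight (index k)) summable_on UNIV"
    unfolding summable_on_reindex_bij_betw[OF bij_index] by (rule weight_summable)
  then show ?thesis by (rule summable_on_imp_summable)
qed

definition left_vec :: "nat \<times> nat \<times> 'm \<times> 'm \<Rightarrow> real \<Rightarrow> complex^'m" where
  "left_vec = (\<lambda>(l, m, i, j). expo (\<mu> l) i)"

definition right_vec :: "complex \<Rightarrow> nat \<times> nat \<times> 'm \<times> 'm \<Rightarrow> real \<Rightarrow> complex^'m" where
  "right_vec s = (\<lambda>(l, m, i, j) x. cnj (kernel_coeff s (l, m, i, j)) *s expo (\<mu> m) j x)"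

lemma left_vec_L2: "left_vec a \<in> L2"
  by (cases a) (auto simp: left_vec_def intro: expo_L2 mu_pos)

lemma right_vec_L2: "right_vec s a \<in> L2"
  by (cases a) (auto simp: right_vec_def intro: L2_scale expo_L2 mu_pos)

lemma l2_inner_right_vec:
  assumes "f \<in> L2"
  shows "l2_inner (right_vec s (l, m, i, j)) f = kernel_coeff s (l, m, i, j) * l2_inner (expo (\<mu> m) j) f"
proof -
  have "l2_inner f (right_vec s (l, m, i, j)) = cnj (kernel_coeff s (l, m, i, j)) * l2_inner f (expo (\<mu> m) j)"
    unfolding right_vec_def split_conv by (rule l2_inner_scale_right[OF assms expo_L2[OF mu_pos]])
  then show ?thesis
    by (subst (1 2) l2_inner_commute) simp
qed

lemma norm_left_vec_le: "0 < x \<Longrightarrow> norm (left_vec a x) \<le> exp (- c * x)"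
  by (cases a) (simp only: left_vec_def split_conv norm_expo exp_mu_le less_imp_le)

lemma norm_l2_inner_right_vec_le:
  assumes "0 \<le> Re s" "f \<in> L2"
  shows "cmod (l2_inner (right_vec s a) f) \<le> weight a * (sqrt (1 / (2 * c)) * l2_norm f)"
  using assms
  by (cases a) (simp only: l2_inner_right_vec norm_mult, intro mult_mono kernel_coeff_le_weight norm_l2_inner_expo_le weight_nonneg norm_ge_zero)

lemma K_has_sum:
  assumes s: "0 \<le> Re s" and f: "f \<in> L2" and x: "0 < x"
  shows "((\<lambda>a. (l2_inner (right_vec s a) f *s left_vec a x) $ k) has_sum K s f x $ k) UNIV"
proof (rule has_sum_quadruple)
  let ?F = "\<lambda>m j. l2_inner (expo (\<mu> m) j) f"
  let ?D = "shifted_coeff s"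
  let ?h = "\<lambda>x. \<sigma> *v hankel (shift_sym \<Psi> s) f x"
  let ?G = "\<lambda>l. of_real (exp (- \<mu> l * x)) * (\<Sum>p\<in>UNIV. ?D l $ k $ p * l2_inner (expo (\<mu> l) p) ?h)"
  let ?b = "\<lambda>a. weight a * (sqrt (1 / (2 * c)) * l2_norm f * exp (- c * x))"
  have "?b summable_on UNIV" by (rule summable_on_cmult_left[OF weight_summable])
  then have sb: "(\<lambda>a. norm (?b a)) summable_on UNIV" by (rule iffD1[OF summable_on_iff_abs_summable_on_real])
  have le: "cmod ((l2_inner (right_vec s a) f *s left_vec a x) $ k) \<le> norm (?b a)" for a
  proof -
    have "cmod ((l2_inner (right_vec s a) f *s left_vec a x) $ k) \<le> cmod (l2_inner (right_vec s a) f) * norm (left_vec a x)"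
      by (simp add: norm_mult mult_left_mono Finite_Cartesian_Product.norm_nth_le)
    also have "\<dots> \<le> weight a * (sqrt (1 / (2 * c)) * l2_norm f) * exp (- c * x)"
      using c_pos by (intro mult_mono norm_l2_inner_right_vec_le s f norm_left_vec_le x mult_nonneg_nonneg weight_nonneg) auto
    also have "\<dots> \<le> norm (?b a)" by (simp add: mult.assoc)
    finally show ?thesis .
  qed
  show "(\<lambda>a. (l2_inner (right_vec s a) f *s left_vec a x) $ k) summable_on UNIV"
    by (rule Infinite_Sum.abs_summable_summable[OF Infinite_Sum.abs_summable_on_comparison_test[OF sb le]])
  show "?G sums (K s f x $ k)"
    unfolding K_op_def
    by (rule hankel_exponential_series[OF shift_sym_star_sums[OF s] shifted_coeff_le[OF s] summable_gamma hankel_shift_L2(2)[OF s f] x])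
  fix l
  have fin: "(\<Sum>p\<in>UNIV. ?D l $ k $ p * ((\<Sum>q\<in>UNIV. \<sigma> $ p $ q * (\<Sum>j\<in>UNIV. ?D m $ q $ j * ?F m j)) / of_real (\<mu> l + \<mu> m)))
      = (\<Sum>j\<in>UNIV. kernel_coeff s (l, m, k, j) * ?F m j)" for m
  proof -
    let ?t = "\<lambda>p q j. ?D l $ k $ p * \<sigma> $ p $ q * ?D m $ q $ j * ?F m j / of_real (\<mu> l + \<mu> m)"
    have "(\<Sum>p\<in>UNIV. ?D l $ k $ p * ((\<Sum>q\<in>UNIV. \<sigma> $ p $ q * (\<Sum>j\<in>UNIV. ?D m $ q $ j * ?F m j)) / of_real (\<mu> l + \<mu> m)))
        = (\<Sum>p\<in>UNIV. \<Sum>q\<in>UNIV. \<Sum>j\<in>UNIV. ?t p q j)"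
      by (simp add: sum_distrib_left sum_divide_distrib mult.assoc)
    also have "\<dots> = (\<Sum>p\<in>UNIV. \<Sum>j\<in>UNIV. \<Sum>q\<in>UNIV. ?t p q j)"
      by (intro sum.cong refl sum.swap)
    also have "\<dots> = (\<Sum>j\<in>UNIV. \<Sum>p\<in>UNIV. \<Sum>q\<in>UNIV. ?t p q j)" by (rule sum.swap)
    also have "\<dots> = (\<Sum>j\<in>UNIV. kernel_coeff s (l, m, k, j) * ?F m j)"
      by (simp add: kernel_coeff_def sum_distrib_right sum_divide_distrib)
    finally show ?thesis .
  qed
  have "(\<lambda>m. \<Sum>p\<in>UNIV. ?D l $ k $ p * ((\<Sum>q\<in>UNIV. \<sigma> $ p $ q * (\<Sum>j\<in>UNIV. ?D m $ q $ j * ?F m j)) / of_real (\<mu> l + \<mu> m)))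
      sums (\<Sum>p\<in>UNIV. ?D l $ k $ p * l2_inner (expo (\<mu> l) p) ?h)"
    by (intro sums_sum sums_mult
         l2_inner_matrix_hankel_exponential[OF shift_sym_sums[OF s] shifted_coeff_le[OF s] summable_gamma f])
  from sums_mult[OF this[unfolded fin], of "of_real (exp (- \<mu> l * x))"]
  have "(\<lambda>m. of_real (exp (- \<mu> l * x)) * (\<Sum>j\<in>UNIV. kernel_coeff s (l, m, k, j) * ?F m j)) sums ?G l" .
  moreover have "(\<Sum>i\<in>UNIV. \<Sum>j\<in>UNIV. (l2_inner (right_vec s (l, m, i, j)) f *s left_vec (l, m, i, j) x) $ k)
      = of_real (exp (- \<mu> l * x)) * (\<Sum>j\<in>UNIV. kernel_coeff s (l, m, k, j) * ?F m j)" for m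
  proof -
    have "(\<Sum>i\<in>UNIV. \<Sum>j\<in>UNIV. (l2_inner (right_vec s (l, m, i, j)) f *s left_vec (l, m, i, j) x) $ k)
        = (\<Sum>i\<in>UNIV. if k = i then of_real (exp (- \<mu> l * x)) * (\<Sum>j\<in>UNIV. kernel_coeff s (l, m, k, j) * ?F m j) else 0)"
      by (intro sum.cong refl)
         (auto simp: l2_inner_right_vec[OF f] left_vec_def expo_nth sum_distrib_left mult_ac)
    then show ?thesis by simp
  qed
  ultimately show "(\<lambda>m. \<Sum>i\<in>UNIV. \<Sum>j\<in>UNIV. (l2_inner (right_vec s (l, m, i, j)) f *s left_vec (l, m, i, j) x) $ k) sums ?G l"
    by simp
qed

lemma K_sums:
  assumes "0 \<le> Re s" "f \<in> L2" "0 < x"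
  shows "(\<lambda>n. l2_inner (right_vec s (index n)) f *s left_vec (index n) x) sums K s f x"
proof (rule sums_vecI)
  fix k
  have "((\<lambda>n. (l2_inner (right_vec s (index n)) f *s left_vec (index n) x) $ k) has_sum K s f x $ k) UNIV"
    by (subst has_sum_reindex_bij_betw[OF bij_index]) (rule K_has_sum[OF assms])
  then show "(\<lambda>n. (l2_inner (right_vec s (index n)) f *s left_vec (index n) x) $ k) sums (K s f x $ k)"
    by (rule has_sum_imp_sums)
qed

lemma l2_norm_left_vec_le: "l2_norm (left_vec a) \<le> sqrt (1 / (2 * c))"
  by (cases a) (simp only: left_vec_def split_conv l2_norm_expo_le)

lemma l2_norm_right_vec_le:
  assumes "0 \<le> Re s" shows "l2_norm (right_vec s a) \<le> weight a * sqrt (1 / (2 * c))"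
proof -
  obtain l m i j where a: "a = (l, m, i, j)" by (cases a) auto
  show ?thesis
    unfolding a right_vec_def split_conv l2_norm_scale complex_mod_cnj
    by (intro mult_mono kernel_coeff_le_weight assms l2_norm_expo_le weight_nonneg l2_norm_nonneg)
qed

text \<open>The series of rank one operators converges pointwise, and its tails are dominated by multiples of
  \<open>exp (- c * x)\<close>, so that it converges in norm too.\<close>
theorem K_nuclear:
  assumes s: "0 \<le> Re s"
  shows "nuclear_representation (K s) (\<lambda>n. left_vec (index n)) (\<lambda>n. right_vec s (index n))"
  unfolding nuclear_representation_def
proof (intro conjI allI ballI)
  let ?q = "sqrt (1 / (2 * c))"
  show "left_vec (index n) \<in> L2" "right_vec s (index n) \<in> L2" for n
    by (rule left_vec_L2 right_vec_L2)+
  show "summable (\<lambda>n. l2_norm (left_vec (index n)) * l2_norm (right_vec s (index n)))"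
  proof (rule summable_comparison_test'[where N = 0])
    show "summable (\<lambda>n. ?q * (weight (index n) * ?q))"
      by (intro summable_mult summable_mult2 summable_weight_index)
    show "norm (l2_norm (left_vec (index n)) * l2_norm (right_vec s (index n))) \<le> ?q * (weight (index n) * ?q)" for n
    proof -
      have "l2_norm (left_vec (index n)) * l2_norm (right_vec s (index n)) \<le> ?q * (weight (index n) * ?q)"
        using c_pos by (intro mult_mono l2_norm_left_vec_le l2_norm_right_vec_le[OF s]) auto
      then show ?thesis by simp
    qed
  qed
  fix f :: "real \<Rightarrow> complex^'m" assume f: "f \<in> L2"
  show KL: "K s f \<in> L2" by (rule K_L2[OF s f])
  let ?e = "\<lambda>n. weight (index n) * (?q * l2_norm f)"
  let ?R = "\<lambda>n. \<Sum>k. ?e (k + n)"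
  have sume: "summable ?e" by (intro summable_mult2 summable_weight_index)
  have e0: "0 \<le> ?e n" for n using c_pos weight_nonneg[of "index n"] by simp
  have R0: "0 \<le> ?R n" for n
    by (intro suminf_nonneg summable_ignore_initial_segment[OF sume] e0)
  let ?d = "\<lambda>n x. K s f x - (\<Sum>i<n. l2_inner (right_vec s (index i)) f *s left_vec (index i) x)"
  have dL: "?d n \<in> L2" for n by (intro L2_diff L2_sum KL left_vec_L2)
  have pt: "norm (?d n x) \<le> ?R n * exp (- c * x)" if x: "0 < x" for n x
  proof -
    let ?w = "\<lambda>i. l2_inner (right_vec s (index i)) f *s left_vec (index i) x"
    have wb: "norm (?w i) \<le> ?e i * exp (- c * x)" for i
      unfolding norm_cvec_scale
      using e0 by (intro mult_mono norm_l2_inner_right_vec_le s f norm_left_vec_le x) auto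
    have "?d n x = (\<Sum>i. ?w (i + n))"
      using K_sums[OF s f x] suminf_minus_initial_segment[of ?w n] by (simp add: sums_iff)
    also have "norm \<dots> \<le> (\<Sum>i. ?e (i + n) * exp (- c * x))"
      by (rule norm_suminf_le[OF wb summable_mult2[OF summable_ignore_initial_segment[OF sume]]])
    also have "\<dots> = ?R n * exp (- c * x)"
      by (rule suminf_mult2[OF summable_ignore_initial_segment[OF sume], symmetric])
    finally show ?thesis .
  qed
  have "(\<lambda>n. ?R n * ?q) \<longlonglongrightarrow> 0 * ?q"
    by (intro tendsto_mult tendsto_const suminf_tail_tendsto_0 sume)
  then have lim: "(\<lambda>n. ?R n * ?q) \<longlonglongrightarrow> 0" by simp
  show "(\<lambda>n. l2_norm (?d n)) \<longlonglongrightarrow> 0"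
    by (rule Lim_null_comparison[OF _ lim])
       (auto intro!: always_eventually l2_norm_le_exp[OF dL c_pos R0 pt])
qed

section \<open>The determinant of the shifted operators\<close>

definition gram_entry :: "complex \<Rightarrow> nat \<Rightarrow> nat \<Rightarrow> complex" where
  "gram_entry s n n' = l2_inner (right_vec s (index n)) (left_vec (index n'))"

lemma gram_entry_eq:
  assumes "index n = (l, m, i, j)" "index n' = (l', m', i', j')"
  shows "gram_entry s n n' = exp (- 2 * of_real (\<mu> l + \<mu> m) * s) * gram_entry 0 n n'"
    and "gram_entry s n n' = kernel_coeff s (l, m, i, j) * (if j = i' then of_real (1 / (\<mu> m + \<mu> l')) else 0)"
proof -
  show 2: "gram_entry s n n' = kernel_coeff s (l, m, i, j) * (if j = i' then of_real (1 / (\<mu> m + \<mu> l')) else 0)" for s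
    unfolding gram_entry_def assms left_vec_def split_conv l2_inner_right_vec[OF expo_L2[OF mu_pos]]
      l2_inner_expo_expo[OF mu_pos mu_pos] ..
  show "gram_entry s n n' = exp (- 2 * of_real (\<mu> l + \<mu> m) * s) * gram_entry 0 n n'"
    unfolding 2 kernel_coeff_shift[of s] by (simp only: mult.assoc)
qed

lemma gram_entry_le:
  assumes "0 \<le> Re s"
  shows "cmod (gram_entry s n n') \<le> (exp (- (4 * c) * Re s) * weight (index n)) * (1 / (2 * c))"
proof -
  obtain l m i j l' m' i' j' where a: "index n = (l, m, i, j)" "index n' = (l', m', i', j')"
    by (cases "index n", cases "index n'") auto
  have "1 / (\<mu> m + \<mu> l') \<le> 1 / (2 * c)"
    using c_pos c_le[of m] c_le[of l'] by (intro divide_left_mono) auto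
  moreover have "0 < \<mu> m + \<mu> l'" using mu_pos[of m] mu_pos[of l'] by simp
  ultimately have "cmod (if j = i' then of_real (1 / (\<mu> m + \<mu> l')) else 0) \<le> 1 / (2 * c)"
    using c_pos by (auto simp: norm_divide simp flip: of_real_add)
  then show ?thesis
    unfolding gram_entry_eq(2)[OF a] norm_mult
    using kernel_coeff_le[OF assms, of "index n"] unfolding a
    by (intro mult_mono) (auto intro!: mult_nonneg_nonneg weight_nonneg)
qed

definition section_det :: "nat \<Rightarrow> complex \<Rightarrow> complex" where
  "section_det n s = leibniz_det n (\<lambda>i j. kron i j - gram_entry s i j)"

lemma section_det_tendsto:
  assumes "0 \<le> Re s"
  shows "(\<lambda>n. section_det n s) \<longlonglongrightarrow> fredholm_det (K s)"
  using nuclear_det_tendsto_fredholm_det[OF K_nuclear[OF assms]]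
  by (simp add: nuclear_det_def[abs_def] section_det_def gram_entry_def)

text \<open>Each kernel coefficient carries the factor \<open>exp (- 2 * (\<mu> l + \<mu> m) * s)\<close>.  This makes the bound uniform on the
  half-plane, as holomorphy of the limit requires, and at \<open>N = 0\<close> it gives the limit one at infinity.\<close>
lemma section_det_tail:
  assumes s: "0 \<le> Re s"
  shows "cmod (fredholm_det (K s) - section_det N s)
    \<le> det_const (\<Sum>k. weight (index k) * (1 / (2 * c))) * (exp (- (4 * c) * Re s) * (\<Sum>k. weight (index (k + N)) * (1 / (2 * c))))"
proof -
  let ?e = "exp (- (4 * c) * Re s)"
  let ?p = "\<lambda>k. ?e * weight (index k)" and ?q = "\<lambda>k::nat. 1 / (2 * c)"
  have e1: "?e \<le> 1" using c_pos s by simp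
  have sm: "summable (\<lambda>k. ?p k * ?q k)"
    by (intro summable_mult2 summable_mult summable_weight_index)
  have sm': "summable (\<lambda>k. weight (index k) * ?q k)" by (intro summable_mult2 summable_weight_index)
  have le: "(\<Sum>k. ?p k * ?q k) \<le> (\<Sum>k. weight (index k) * ?q k)"
  proof (rule suminf_le[OF _ sm sm'])
    show "?p k * ?q k \<le> weight (index k) * ?q k" for k
      using mult_right_mono[OF e1 weight_nonneg[of "index k"]] c_pos by (intro mult_right_mono) auto
  qed
  have "cmod (fredholm_det (K s) - section_det N s)
      \<le> det_const (\<Sum>k. weight (index k) * ?q k) * (\<Sum>k. ?p (k + N) * ?q (k + N))"
    unfolding section_det_def
    by (rule leibniz_det_limit_tail[OF _ _ gram_entry_le[OF s] sm le section_det_tendsto[OF s, unfolded section_det_def]])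
       (use c_pos weight_nonneg in auto)
  also have "(\<Sum>k. ?p (k + N) * ?q (k + N)) = ?e * (\<Sum>k. weight (index (k + N)) * ?q (k + N))"
    unfolding mult.assoc by (rule suminf_mult[OF summable_ignore_initial_segment[OF sm', of N]])
  finally show ?thesis .
qed

lemma fredholm_det_K_holomorphic: "(\<lambda>s. fredholm_det (K s)) holomorphic_on right_half_plane"
proof (rule holomorphic_uniform_sequence)
  show op: "open right_half_plane" unfolding right_half_plane_def by (rule open_halfspace_Re_gt)
  show "(\<lambda>s. section_det n s) holomorphic_on right_half_plane" for n
    unfolding section_det_def
  proof (intro holomorphic_leibniz_det)
    fix i j
    obtain l m p q l' m' p' q' where a: "index i = (l, m, p, q)" "index j = (l', m', p', q')"
      by (cases "index i", cases "index j") auto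
    show "(\<lambda>s. kron i j - gram_entry s i j) holomorphic_on right_half_plane"
      by (subst gram_entry_eq(1)[OF a]) (intro holomorphic_intros)
  qed
  fix s assume "s \<in> right_half_plane"
  then obtain d where d: "0 < d" "cball s d \<subseteq> right_half_plane"
    using op open_contains_cball by blast
  let ?S = "det_const (\<Sum>k. weight (index k) * (1 / (2 * c)))"
  let ?t = "\<lambda>N. \<Sum>k. weight (index (k + N)) * (1 / (2 * c))"
  have sm': "summable (\<lambda>k. weight (index k) * (1 / (2 * c)))" by (intro summable_mult2 summable_weight_index)
  have "uniform_limit (cball s d) (\<lambda>n s. section_det n s) (\<lambda>s. fredholm_det (K s)) sequentially"
  proof (rule uniform_limitI)
    fix e :: real assume e: "0 < e"
    have "(\<lambda>N. ?S * ?t N) \<longlonglongrightarrow> ?S * 0"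
      by (intro tendsto_mult tendsto_const suminf_tail_tendsto_0[OF sm'])
    then have ev: "\<forall>\<^sub>F N in sequentially. ?S * ?t N < e"
      using e by (intro order_tendstoD) auto
    show "\<forall>\<^sub>F N in sequentially. \<forall>s\<in>cball s d. dist (section_det N s) (fredholm_det (K s)) < e"
      using ev
    proof eventually_elim
      case (elim N)
      show ?case
      proof
        fix z assume "z \<in> cball s d"
        then have z: "0 \<le> Re z" using d by (auto simp: right_half_plane_def)
        have "exp (- (4 * c) * Re z) * ?t N \<le> 1 * ?t N"
          using c_pos z sm' weight_nonneg
          by (intro mult_right_mono suminf_nonneg summable_ignore_initial_segment[OF sm', of N]) auto
        then have "?S * (exp (- (4 * c) * Re z) * ?t N) \<le> ?S * ?t N"
          using det_const_pos by (simp add: less_imp_le mult_left_mono)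
        with section_det_tail[OF z, of N] elim
        show "dist (section_det N z) (fredholm_det (K z)) < e"
          by (simp add: dist_norm norm_minus_commute)
      qed
    qed
  qed
  with d show "\<exists>d>0. cball s d \<subseteq> right_half_plane \<and> uniform_limit (cball s d) (\<lambda>n s. section_det n s) (\<lambda>s. fredholm_det (K s)) sequentially"
    by blast
qed

text \<open>Conjugating by the diagonal matrix of \<open>exp(- 2 s \<mu>\<^sub>l)\<close> moves the shift of
  the symbol to the truncation of the operator.\<close>
theorem tau_K:
  assumes s: "0 < s"
  shows "tau (K 0) (2 * s) = fredholm_det (K (of_real s))"
proof -
  let ?u = "\<lambda>n x. indicator {2 * s..} x *\<^sub>R left_vec (index n) x"
  let ?v = "\<lambda>n. right_vec 0 (index n)"
  define d where "d n = (case index n of (l, m, i, j) \<Rightarrow> complex_of_real (exp (- (2 * s) * \<mu> l)))" for n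
  have d0: "d n \<noteq> 0" for n by (auto simp: d_def split: prod.split)
  have "nuclear_det ?u ?v \<longlonglongrightarrow> tau (K 0) (2 * s)"
    unfolding tau_def
    by (intro nuclear_det_tendsto_fredholm_det nuclear_rep_truncate K_nuclear) simp
  moreover have "nuclear_det ?u ?v n = section_det n (of_real s)" for n
  proof -
    have ent: "gram_entry (of_real s) a b = d a * l2_inner (?v a) (?u b) / d b" for a b
    proof -
      obtain l m i j l' m' i' j' where ab: "index a = (l, m, i, j)" "index b = (l', m', i', j')"
        by (cases "index a", cases "index b") auto
      have uL: "(\<lambda>x. indicator {2 * s..} x *\<^sub>R expo (\<mu> l') i' x) \<in> L2"
        using L2_truncate(1)[OF expo_L2[OF mu_pos[of l']], of "2 * s" i'] by (simp add: L2_beyond_def)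
      have "l2_inner (?v a) (?u b) = kernel_coeff 0 (l, m, i, j) * (if j = i' then of_real (exp (- (\<mu> m + \<mu> l') * (2 * s)) / (\<mu> m + \<mu> l')) else 0)"
        unfolding ab left_vec_def split_conv l2_inner_right_vec[OF uL]
        using l2_inner_expo_truncated[OF mu_pos mu_pos, of "2 * s" m j l' i'] s by simp
      moreover have "exp (- 2 * of_real (\<mu> l + \<mu> m) * of_real s)
          = complex_of_real (exp (- (2 * s) * \<mu> l)) * of_real (exp (- (\<mu> m + \<mu> l') * (2 * s))) / of_real (exp (- (2 * s) * \<mu> l'))"
        unfolding exp_of_real[symmetric] exp_add[symmetric] exp_diff[symmetric]
        by (simp add: algebra_simps)
      ultimately show ?thesis
        unfolding gram_entry_eq(2)[OF ab] kernel_coeff_shift[of "of_real s"] d_def ab split_conv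
        by (simp add: divide_simps)
    qed
    have "section_det n (of_real s) = leibniz_det n (\<lambda>a b. d a * (kron a b - l2_inner (?v a) (?u b)) * (1 / d b))"
      unfolding section_det_def
      using d0 by (intro leibniz_det_cong) (auto simp: ent kron_def algebra_simps)
    also have "\<dots> = (\<Prod>i<n. d i) * (\<Prod>i<n. 1 / d i) * nuclear_det ?u ?v n"
      unfolding leibniz_det_scale nuclear_det_def ..
    also have "(\<Prod>i<n. d i) * (\<Prod>i<n. 1 / d i) = 1"
      unfolding prod.distrib[symmetric] using d0 by (intro prod.neutral) simp
    finally show ?thesis by simp
  qed
  then have "nuclear_det ?u ?v = (\<lambda>n. section_det n (of_real s))" by auto
  ultimately have "(\<lambda>n. section_det n (of_real s)) \<longlonglongrightarrow> tau (K 0) (2 * s)" by simp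
  moreover have "(\<lambda>n. section_det n (of_real s)) \<longlonglongrightarrow> fredholm_det (K (of_real s))"
    using s by (intro section_det_tendsto) simp
  ultimately show ?thesis by (rule LIMSEQ_unique)
qed

lemma tau_K_tendsto_1: "(tau (K 0) \<longlongrightarrow> 1) at_top"
proof -
  let ?S = "det_const (\<Sum>k. weight (index k) * (1 / (2 * c))) * (\<Sum>k. weight (index k) * (1 / (2 * c)))"
  have bound: "cmod (tau (K 0) t - 1) \<le> ?S * exp (- (2 * c) * t)" if "0 < t" for t
  proof -
    have "0 \<le> Re (of_real (t / 2))" using that by simp
    note tail = section_det_tail[OF this, of 0, unfolded add_0_right]
    have "- (4 * c) * Re (of_real (t / 2)) = - (2 * c) * t" by simp
    moreover have "fredholm_det (K (of_real (t / 2))) = tau (K 0) t" using tau_K[of "t / 2"] that by simp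
    moreover have "section_det 0 (of_real (t / 2)) = 1" by (simp add: section_det_def)
    ultimately show ?thesis using tail by (simp only: mult_ac)
  qed
  have "((\<lambda>t. exp (- (2 * c) * t)) \<longlongrightarrow> 0) at_top"
    using c_pos by (intro filterlim_compose[OF exp_at_bot]
       filterlim_tendsto_neg_mult_at_bot[OF tendsto_const] filterlim_ident) auto
  from tendsto_mult[OF tendsto_const[of ?S] this]
  have lim: "((\<lambda>t. ?S * exp (- (2 * c) * t)) \<longlongrightarrow> 0) at_top" by simp
  have "\<forall>\<^sub>F t in at_top. cmod (tau (K 0) t - 1) \<le> ?S * exp (- (2 * c) * t)"
    using eventually_gt_at_top[of 0] by eventually_elim (rule bound)
  then show ?thesis
    by (intro LIM_zero_cancel[OF Lim_null_comparison[OF _ lim]])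
qed

section \<open>Non-vanishing\<close>

lemma shift_sym_measurable:
  assumes "0 \<le> Re s" shows "shift_sym \<Psi> s \<in> borel_measurable half_line"
proof (rule borel_measurable_LIMSEQ_metric)
  show "(\<lambda>x. \<Sum>l<n. exp (- \<mu> l * x) *\<^sub>R shifted_coeff s l) \<in> borel_measurable half_line" for n
    by (rule measurable_half_line) measurable
  fix x assume "x \<in> space half_line"
  then have x: "0 < x" by simp
  show "(\<lambda>n. \<Sum>l<n. exp (- \<mu> l * x) *\<^sub>R shifted_coeff s l) \<longlonglongrightarrow> shift_sym \<Psi> s x"
  proof (intro vec_tendstoI)
    fix i j
    have "(exp (- \<mu> l * x) *\<^sub>R shifted_coeff s l) $ i $ j = of_real (exp (- \<mu> l * x)) * shifted_coeff s l $ i $ j" for l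
      unfolding vector_scaleR_component by (rule scaleR_conv_of_real)
    then show "(\<lambda>n. (\<Sum>l<n. exp (- \<mu> l * x) *\<^sub>R shifted_coeff s l) $ i $ j) \<longlonglongrightarrow> shift_sym \<Psi> s x $ i $ j"
      using shift_sym_sums[OF assms x, of i j] by (simp add: sums_def sum_component)
  qed
qed

lemma shift_sym_star_measurable:
  assumes "0 \<le> Re s" shows "shift_sym_star \<Psi> s \<in> borel_measurable half_line"
  using shift_sym_measurable[OF assms] measurable_cong[of half_line "shift_sym_star \<Psi> s" "shift_sym \<Psi> s" borel]
  by (simp add: shift_sym_star_eq[OF assms])

lemma K_norm_le:
  assumes s: "0 \<le> Re s" and f: "f \<in> L2"
  shows "ennreal ((l2_norm (K s f))\<^sup>2)
    \<le> (ennreal (mat_norm \<sigma>) * weighted_symbol_norm \<Psi> (2 * s))\<^sup>2 * ennreal ((l2_norm f)\<^sup>2)"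
proof -
  let ?W = "weighted_symbol_norm \<Psi> (2 * s)"
  let ?h = "hankel (shift_sym \<Psi> s) f" and ?g = "\<lambda>x. \<sigma> *v hankel (shift_sym \<Psi> s) f x"
  have W: "(\<integral>\<^sup>+x\<in>{0<..}. ennreal (x * (mat_norm (shift_sym \<Psi> s x))\<^sup>2) \<partial>lborel) = ?W"
    by (simp add: weighted_symbol_norm_def shift_sym_def)
  have "(\<integral>\<^sup>+x\<in>{0<..}. ennreal (x * (mat_norm (shift_sym_star \<Psi> s x))\<^sup>2) \<partial>lborel)
      = (\<integral>\<^sup>+x\<in>{0<..}. ennreal (x * (mat_norm (shift_sym \<Psi> s x))\<^sup>2) \<partial>lborel)"
    by (intro nn_integral_cong) (auto simp: indicator_def shift_sym_star_eq[OF s])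
  then have W': "(\<integral>\<^sup>+x\<in>{0<..}. ennreal (x * (mat_norm (shift_sym_star \<Psi> s x))\<^sup>2) \<partial>lborel) = ?W"
    by (simp add: W)
  note L2 = hankel_shift_L2[OF s f]
  have "ennreal ((l2_norm (K s f))\<^sup>2) \<le> ?W * ennreal ((l2_norm ?g)\<^sup>2)"
    using hankel_norm_le[OF shift_sym_star_measurable[OF s] L2(2)] K_L2[OF s f]
    unfolding W' K_op_def by blast
  also have "ennreal ((l2_norm ?g)\<^sup>2) \<le> (ennreal (mat_norm \<sigma>))\<^sup>2 * ennreal ((l2_norm ?h)\<^sup>2)"
  proof -
    have "(l2_norm ?g)\<^sup>2 \<le> (\<integral>x. (mat_norm \<sigma>)\<^sup>2 * (norm (?h x))\<^sup>2 \<partial>half_line)"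
      unfolding l2_norm_square
    proof (rule integral_mono)
      fix x
      show "(norm (\<sigma> *v ?h x))\<^sup>2 \<le> (mat_norm \<sigma>)\<^sup>2 * (norm (?h x))\<^sup>2"
        unfolding power_mult_distrib[symmetric] by (intro power_mono norm_matrix_vector_le) auto
    qed (use L2 in \<open>auto intro!: L2_integrable\<close>)
    then have "(l2_norm ?g)\<^sup>2 \<le> (mat_norm \<sigma>)\<^sup>2 * (l2_norm ?h)\<^sup>2" by (simp add: l2_norm_square)
    then have "ennreal ((l2_norm ?g)\<^sup>2) \<le> ennreal ((mat_norm \<sigma>)\<^sup>2 * (l2_norm ?h)\<^sup>2)" by (rule ennreal_leI)
    then show ?thesis by (simp add: ennreal_mult ennreal_power mat_norm_nonneg)
  qed
  also have "ennreal ((l2_norm ?h)\<^sup>2) \<le> ?W * ennreal ((l2_norm f)\<^sup>2)"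
    using hankel_norm_le[OF shift_sym_measurable[OF s] f L2(1)] unfolding W .
  finally have "ennreal ((l2_norm (K s f))\<^sup>2) \<le> ?W * ((ennreal (mat_norm \<sigma>))\<^sup>2 * (?W * ennreal ((l2_norm f)\<^sup>2)))"
    by (simp add: mult_left_mono)
  then show ?thesis by (simp add: power2_eq_square mult_ac)
qed

theorem fredholm_det_K_nonzero:
  assumes s: "0 \<le> Re s" and small: "ennreal (mat_norm \<sigma>) * weighted_symbol_norm \<Psi> (2 * s) < 1"
  shows "fredholm_det (K s) \<noteq> 0"
proof -
  define r where "r = enn2real (ennreal (mat_norm \<sigma>) * weighted_symbol_norm \<Psi> (2 * s))"
  \<comment> \<open>The product is finite, even if one of the factors is not.\<close>
  have e: "ennreal (mat_norm \<sigma>) * weighted_symbol_norm \<Psi> (2 * s) = ennreal r"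
    unfolding r_def using small by (intro ennreal_enn2real[symmetric]) (auto intro: order.strict_trans)
  have r0: "0 \<le> r" by (simp add: r_def)
  have r1: "r < 1" using small unfolding e by (simp add: ennreal_less_one_iff)
  show ?thesis
  proof (rule fredholm_det_contraction_nonzero[OF K_nuclear[OF s] r0 r1])
    fix f :: "real \<Rightarrow> complex^'m" assume f: "f \<in> L2"
    have "ennreal ((l2_norm (K s f))\<^sup>2) \<le> ennreal ((r * l2_norm f)\<^sup>2)"
      using K_norm_le[OF s f] r0 unfolding e by (simp add: ennreal_mult ennreal_power power_mult_distrib)
    then have "(l2_norm (K s f))\<^sup>2 \<le> (r * l2_norm f)\<^sup>2" by simp
    then show "l2_norm (K s f) \<le> r * l2_norm f"
      by (rule power2_le_imp_le) (simp add: r0)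
  qed
qed

text \<open>In the variable \<open>w = x + r\<close> both sides integrate the same squared norm, on the left over a smaller domain
  and with the smaller weight \<open>w - r\<close>.\<close>
lemma weighted_symbol_norm_shift:
  assumes z: "0 \<le> Re z" and r: "0 \<le> r"
  shows "weighted_symbol_norm \<Psi> (z + of_real r) \<le> weighted_symbol_norm \<Psi> z"
proof -
  define k where "k w = ennreal (w * (mat_norm (\<Psi> (of_real w + z)))\<^sup>2) * indicator {0<..} w" for w
  have "(\<lambda>x. mat_norm (shift_sym \<Psi> (z / 2) x)) \<in> borel_measurable half_line"
    by (rule borel_measurable_continuous_on[OF continuous_on_mat_norm shift_sym_measurable]) (use z in simp)
  then have m: "(\<lambda>x. mat_norm (\<Psi> (of_real x + z))) \<in> borel_measurable half_line"
    by (simp add: shift_sym_def)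
  have "(\<lambda>x. x) \<in> borel_measurable half_line" by (rule measurable_half_line) simp
  with m have "(\<lambda>w. ennreal (w * (mat_norm (\<Psi> (of_real w + z)))\<^sup>2)) \<in> borel_measurable half_line"
    by measurable
  then have [measurable]: "k \<in> borel_measurable borel"
    unfolding half_line_def k_def by (subst (asm) borel_measurable_restrict_space_iff_ennreal) auto
  have "weighted_symbol_norm \<Psi> (z + of_real r) \<le> (\<integral>\<^sup>+x. k (r + 1 * x) \<partial>lborel)"
    unfolding weighted_symbol_norm_def
  proof (rule nn_integral_mono)
    fix x :: real
    show "ennreal (x * (mat_norm (\<Psi> (of_real x + (z + of_real r))))\<^sup>2) * indicator {0<..} x \<le> k (r + 1 * x)"
    proof (cases "0 < x")
      case True
      have eq: "of_real x + (z + of_real r) = of_real (r + 1 * x) + z" by simp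
      have "ennreal (x * (mat_norm (\<Psi> (of_real (r + 1 * x) + z)))\<^sup>2)
          \<le> ennreal ((r + 1 * x) * (mat_norm (\<Psi> (of_real (r + 1 * x) + z)))\<^sup>2)"
        using r by (intro ennreal_leI mult_right_mono) auto
      then show ?thesis
        using True r unfolding eq k_def by simp
    qed simp
  qed
  also have "\<dots> = (\<integral>\<^sup>+x. k x \<partial>lborel)"
    by (subst nn_integral_real_affine[of k 1 r]) auto
  also have "\<dots> = weighted_symbol_norm \<Psi> z"
    by (simp add: weighted_symbol_norm_def k_def)
  finally show ?thesis .
qed

end

section \<open>The exponential expansion of the symbol\<close>

lemma of_real_1_islimpt_positive_reals: "(1::complex) islimpt of_real ` {0<..}"
  unfolding islimpt_approachable
proof (intro allI impI)
  fix e :: real assume "0 < e"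
  have mem: "complex_of_real (1 + e / 2) \<in> complex_of_real ` {0<..}"
    using \<open>0 < e\<close> by (intro imageI) simp
  have "complex_of_real (1 + e / 2) - 1 = of_real (e / 2)" by simp
  then have "dist (complex_of_real (1 + e / 2)) 1 = e / 2"
    unfolding dist_norm by (simp only: norm_of_real) (use \<open>0 < e\<close> in simp)
  then show "\<exists>x'\<in>complex_of_real ` {0<..}. x' \<noteq> 1 \<and> dist x' 1 < e"
    using \<open>0 < e\<close> by (intro bexI[OF _ mem]) auto
qed

text \<open>Both sides are holomorphic in the half-plane and agree on the positive half-line.\<close>
lemma exponential_expansion_half_plane:
  fixes \<psi> :: "complex \<Rightarrow> complex" and a :: "nat \<Rightarrow> complex" and \<mu> :: "nat \<Rightarrow> real"
  assumes hol: "\<psi> holomorphic_on right_half_plane"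
    and \<mu>: "\<And>l. 0 < \<mu> l" and a: "summable b" "\<And>l. cmod (a l) \<le> b l"
    and real: "\<And>t. 0 < t \<Longrightarrow> (\<lambda>l. exp (- of_real (\<mu> l) * of_real t) * a l) sums \<psi> (of_real t)"
    and z: "0 < Re z"
  shows "(\<lambda>l. exp (- of_real (\<mu> l) * z) * a l) sums \<psi> z"
proof -
  have op: "open right_half_plane" unfolding right_half_plane_def by (rule open_halfspace_Re_gt)
  have "convex right_half_plane" unfolding right_half_plane_def by (rule convex_halfspace_Re_gt)
  then have conn: "connected right_half_plane" by (rule convex_connected)
  have le: "cmod (exp (- of_real (\<mu> l) * z) * a l) \<le> b l" if "z \<in> right_half_plane" for z l
  proof -
    have "cmod (exp (- of_real (\<mu> l) * z)) \<le> 1"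
      using \<mu>[of l] that by (simp add: right_half_plane_def)
    from mult_mono[OF this a(2)[of l]] show ?thesis by (simp add: norm_mult)
  qed
  let ?F = "\<lambda>z. \<Sum>l. exp (- of_real (\<mu> l) * z) * a l"
  have ul: "uniform_limit right_half_plane (\<lambda>n z. \<Sum>l<n. exp (- of_real (\<mu> l) * z) * a l) ?F sequentially"
    by (rule Weierstrass_m_test[OF le a(1)])
  have F: "?F holomorphic_on right_half_plane"
  proof (rule holomorphic_uniform_sequence[OF op])
    show "(\<lambda>z. \<Sum>l<n. exp (- of_real (\<mu> l) * z) * a l) holomorphic_on right_half_plane" for n
      by (intro holomorphic_intros)
    fix x assume "x \<in> right_half_plane"
    then obtain d where d: "0 < d" "cball x d \<subseteq> right_half_plane"
      using op open_contains_cball by blast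
    then show "\<exists>d>0. cball x d \<subseteq> right_half_plane \<and>
        uniform_limit (cball x d) (\<lambda>n z. \<Sum>l<n. exp (- of_real (\<mu> l) * z) * a l) ?F sequentially"
      using uniform_limit_on_subset[OF ul] by blast
  qed
  have "?F z - \<psi> z = 0"
  proof (rule analytic_continuation[of "\<lambda>z. ?F z - \<psi> z" right_half_plane "of_real ` {0<..}" 1])
    show "(\<lambda>z. ?F z - \<psi> z) holomorphic_on right_half_plane"
      by (intro holomorphic_on_diff F hol)
    show "?F z - \<psi> z = 0" if "z \<in> of_real ` {0<..}" for z
      using that real by (auto simp: sums_iff)
  qed (use op conn z of_real_1_islimpt_positive_reals in \<open>auto simp: right_half_plane_def\<close>)
  moreover have "summable (\<lambda>l. exp (- of_real (\<mu> l) * z) * a l)"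
    using z by (intro summable_comparison_test'[OF a(1), of 0] le) (simp add: right_half_plane_def)
  ultimately show ?thesis by (simp add: sums_iff)
qed

definition Psi_coeff :: "complex^('k::finite \<times> 2) \<Rightarrow> complex^('k \<times> 2 + unit)^('k \<times> 2 + unit)" where
  "Psi_coeff a = (\<chi> i j. case (i, j) of
     (Inl p, Inr _) \<Rightarrow> a $ p
   | (Inr _, Inl p) \<Rightarrow> cnj (a $ p)
   | _ \<Rightarrow> 0)"

lemma Psi_coeff_le: "cmod (Psi_coeff a $ i $ j) \<le> norm a"
  by (cases i; cases j) (simp_all add: Psi_coeff_def Finite_Cartesian_Product.norm_nth_le)

lemma Psi_sums:
  assumes "\<And>z p. 0 < Re z \<Longrightarrow> (\<lambda>l. exp (- of_real (\<mu> l) * z) * a l $ p) sums (\<psi> z $ p)" and z: "0 < Re z"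
  shows "(\<lambda>l. exp (- of_real (\<mu> l) * z) * Psi_coeff (a l) $ i $ j) sums (Psi \<psi> z $ i $ j)"
proof -
  have "(\<lambda>l. exp (- of_real (\<mu> l) * z) * cnj (a l $ p)) sums cnj (\<psi> (cnj z) $ p)" for p
  proof -
    have "exp (- of_real (\<mu> l) * z) * cnj (a l $ p) = cnj (exp (- of_real (\<mu> l) * cnj z) * a l $ p)" for l
      by (simp add: exp_cnj)
    then show ?thesis
      using assms(1)[of "cnj z" p] z by (simp only: sums_cnj Re_complex_of_real complex_cnj_cnj complex.sel cnj.sel)
  qed
  then show ?thesis
    using assms(1)[OF z] by (cases i; cases j) (simp_all add: Psi_coeff_def Psi_def)
qed

lemma Psi_symmetric: "cadjoint (Psi \<psi> (cnj z)) = Psi \<psi> z"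
proof -
  have "cadjoint (Psi \<psi> (cnj z)) $ i $ j = Psi \<psi> z $ i $ j" for i j
    by (cases i; cases j) (simp_all add: cadjoint_def Psi_def)
  then show ?thesis by (simp add: Finite_Cartesian_Product.vec_eq_iff)
qed

section \<open>The logarithmic derivative\<close>

lemma minus_two_log_deriv2_meromorphic:
  assumes "T analytic_on A" shows "minus_two_log_deriv2 T meromorphic_on A"
proof -
  have "T meromorphic_on A" by (rule analytic_on_imp_meromorphic_on[OF assms])
  then have "(\<lambda>s. - 2 * deriv (\<lambda>z. deriv T z / T z) s) meromorphic_on A"
    by (intro meromorphic_on_mult meromorphic_on_const meromorphic_on_deriv meromorphic_on_divide)
  then show ?thesis by (simp add: minus_two_log_deriv2_def[abs_def])
qed

lemma minus_two_log_deriv2_analytic: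
  assumes "T analytic_on {s}" "T s \<noteq> 0" shows "minus_two_log_deriv2 T analytic_on {s}"
proof -
  have "(\<lambda>s. - 2 * deriv (\<lambda>z. deriv T z / T z) s) analytic_on {s}"
    using assms by (intro analytic_on_mult analytic_on_const analytic_deriv analytic_on_divide) auto
  then show ?thesis by (simp add: minus_two_log_deriv2_def[abs_def])
qed

section \<open>The tau function\<close>

theorem proposition9p1:
  fixes N g n :: nat
    and v :: "real poly" and \<rho> :: "real measure" and S :: "real set"
    and \<delta> :: "nat \<Rightarrow> complex" and p :: "nat \<Rightarrow> real poly"
    and \<alpha> :: "nat \<Rightarrow> complex^2^2" and \<kappa> :: real and Z :: "real \<Rightarrow> real^2"
    and pos :: "'k::finite \<Rightarrow> nat" and \<gamma> \<sigma>\<^sub>0 :: "'k \<Rightarrow> complex^2^2"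
    and \<psi> :: "complex \<Rightarrow> complex^('k \<times> 2)" and coef :: "nat \<Rightarrow> complex^('k \<times> 2)"
    and \<sigma> :: "complex^('k \<times> 2 + unit)^('k \<times> 2 + unit)"
  assumes v: "N \<ge> 1" "degree v = 2 * N" "coeff v (2 * N) > 0"
    and equilibrium: "is_equilibrium_measure v \<rho>"
    and support: "S = bands g \<delta>" "measure_support \<rho> = S"
    and endpoints: "2 * g + 2 \<le> 4 * N - 2" "\<forall>j\<in>{1..2*g+2}. \<delta> j \<in> \<real>"
        "strict_mono_on {1..2*g+2} (\<lambda>j. Re (\<delta> j))"
    and zeros: "\<forall>z. (cpoly (pderiv v) z)\<^sup>2 - 4 * u_fun v \<rho> S z =
        (of_real (2 * real N * coeff v (2 * N)))\<^sup>2 * (\<Prod>j=1..4*N-2. z - \<delta> j)"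
    and density: "\<rho> = density lborel
        (\<lambda>x. ennreal (indicator S x * Re (w_fun N v \<delta> (of_real x)) / (2 * pi)))"
    and normalization: "\<delta> 1 = 0" "1 < Re (\<delta> 2)"
    and orthogonal: "monic_orthogonal \<rho> p"
    and n: "n \<ge> 1"
    and residues: "\<forall>z. z \<notin> of_real ` S \<longrightarrow> w_radicand N \<delta> z \<notin> \<real>\<^sub>\<le>\<^sub>0 \<longrightarrow>
        A_mat N v \<rho> S \<delta> p n z = partial_fractions N \<delta> \<alpha> z"
    and kappa: "\<kappa> > 0" "2 * \<kappa> \<notin> \<int>"
        "eigenvalue_of (beta \<alpha> 1) (of_real \<kappa>)" "eigenvalue_of (beta \<alpha> 1) (- of_real \<kappa>)"
    and ode: "\<forall>x\<in>{0<..<1}. of_real x \<notin> \<delta> ` {1..4*N-2} \<longrightarrow>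
        ((\<lambda>y. cvec (Z y)) has_vector_derivative B_mat N \<delta> \<alpha> (of_real x) *v cvec (Z x)) (at x)"
    and Z_tendsto: "(Z \<longlongrightarrow> 0) (at_right (Re (\<delta> 1)))"
    and pos: "bij_betw pos UNIV {2..4*N-2}"
    and blocks: "\<forall>k. real_symmetric (residue_block \<delta> \<alpha> (pos k))"
    and signature: "\<forall>k. signature_matrix (\<sigma>\<^sub>0 k) \<and>
        congruent_matrices (\<sigma>\<^sub>0 k) (residue_block \<delta> \<alpha> (pos k))"
    and gamma: "cadjoint (block_diag \<gamma>) ** block_diag \<sigma>\<^sub>0 ** block_diag \<gamma> =
        block_diag (\<lambda>k. residue_block \<delta> \<alpha> (pos k))"
    and psi: "\<forall>t>0. of_real (Re (\<delta> 1) + exp (- t)) \<notin> \<delta> ` {2..4*N-2} \<longrightarrow>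
        \<psi> (of_real t) = psi_column pos \<delta> \<gamma> Z (Re (\<delta> 1) + exp (- t))"
    and expansion: "summable (\<lambda>l. norm (coef l))"
        "\<forall>t>0. (\<lambda>l. exp (- (\<kappa> + real l + 1/2) * t) *\<^sub>R coef l) sums \<psi> (of_real t)"
    and extension: "\<forall>i. (\<lambda>z. \<psi> z $ i) holomorphic_on right_half_plane"
  shows
    "let K = K_op (Psi \<psi>) \<sigma>;
         \<tau> = tau (K 0);
         T = (\<lambda>s. fredholm_det (K s));
         q = minus_two_log_deriv2 T
     in
       \<comment> \<open>(i)\<close>
       trace_class (K 0) \<and>
       (\<forall>t>0. trace_class (truncate t (K 0))) \<and>
       (\<forall>s\<in>right_half_plane. trace_class (K s)) \<and>
       (\<forall>s::real. s > 0 \<longrightarrow> \<tau> (2 * s) = T (of_real s)) \<and>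
       T analytic_on right_half_plane \<and>
       \<comment> \<open>(ii)\<close>
       q meromorphic_on right_half_plane \<and>
       (\<forall>s\<in>right_half_plane.
          ennreal (mat_norm \<sigma>) * weighted_symbol_norm (Psi \<psi>) (2 * s) < 1 \<longrightarrow> q analytic_on {s}) \<and>
       (mat_norm \<sigma> \<le> 1 \<longrightarrow>
          (\<forall>s::real. s > 0 \<longrightarrow> weighted_symbol_norm (Psi \<psi>) (of_real s) < 1 \<longrightarrow>
             q analytic_on {of_real s})) \<and>
       \<comment> \<open>(iii)\<close>
       (zero_le_op_le_id (K 0) \<longrightarrow>
          (\<forall>s>0. \<tau> s \<in> \<real> \<and> 0 \<le> Re (\<tau> s)) \<and>
          mono_on {0<..} (\<lambda>s. Re (\<tau> s)) \<and>
          (\<tau> \<longlongrightarrow> 1) at_top)"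
proof -
  define \<mu> where "\<mu> l = \<kappa> + real l + 1/2" for l
  define C where "C l = Psi_coeff (coef l)" for l
  have \<mu>_pos: "0 < \<mu> l" for l using kappa(1) by (simp add: \<mu>_def)
  have psi_sums: "(\<lambda>l. exp (- of_real (\<mu> l) * z) * coef l $ p) sums (\<psi> z $ p)" if "0 < Re z" for z p
  proof (rule exponential_expansion_half_plane[where b = "\<lambda>l. norm (coef l)"])
    show "(\<lambda>z. \<psi> z $ p) holomorphic_on right_half_plane" using extension by blast
    show "cmod (coef l $ p) \<le> norm (coef l)" for l by (rule Finite_Cartesian_Product.norm_nth_le)
    fix t :: real assume "0 < t"
    then have "(\<lambda>l. exp (- (\<kappa> + real l + 1/2) * t) *\<^sub>R coef l) sums \<psi> (of_real t)"
      using expansion(2) by blast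
    then have "(\<lambda>l. (exp (- \<mu> l * t) *\<^sub>R coef l) $ p) sums (\<psi> (of_real t) $ p)"
      unfolding \<mu>_def by (rule sums_nth)
    moreover have "(exp (- \<mu> l * t) *\<^sub>R coef l) $ p = exp (- of_real (\<mu> l) * of_real t) * coef l $ p" for l
    proof -
      have "exp (- of_real (\<mu> l) * of_real t) = complex_of_real (exp (- \<mu> l * t))"
        by (simp add: exp_of_real[symmetric])
      then show ?thesis unfolding vector_scaleR_component by (simp only: scaleR_conv_of_real)
    qed
    ultimately show "(\<lambda>l. exp (- of_real (\<mu> l) * of_real t) * coef l $ p) sums (\<psi> (of_real t) $ p)" by simp
  qed (use \<mu>_pos expansion(1) that in auto)
  interpret exponential_symbol \<mu> "\<kappa> + 1/2" "Psi \<psi>" C "\<lambda>l. norm (coef l)" \<sigma>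
  proof
    show "0 < \<kappa> + 1/2" using kappa(1) by simp
    show "\<kappa> + 1/2 \<le> \<mu> l" for l by (simp add: \<mu>_def)
    show "summable (\<lambda>l. norm (coef l))" by (rule expansion(1))
    show "cmod (C l $ i $ j) \<le> norm (coef l)" for l i j unfolding C_def by (rule Psi_coeff_le)
    show "(\<lambda>l. exp (- of_real (\<mu> l) * z) * C l $ i $ j) sums (Psi \<psi> z $ i $ j)" if "0 < Re z" for z i j
      unfolding C_def by (rule Psi_sums[OF psi_sums that])
    show "cadjoint (Psi \<psi> (cnj z)) = Psi \<psi> z" for z by (rule Psi_symmetric)
  qed
  let ?T = "\<lambda>s. fredholm_det (K_op (Psi \<psi>) \<sigma> s)"
  have op: "open right_half_plane" unfolding right_half_plane_def by (rule open_halfspace_Re_gt)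
  have T: "?T analytic_on right_half_plane"
    using fredholm_det_K_holomorphic op by (simp add: analytic_on_open)
  have trace: "trace_class (K_op (Psi \<psi>) \<sigma> s)" if "0 \<le> Re s" for s
    unfolding trace_class_def using K_nuclear[OF that] by blast
  have K0: "nuclear_representation (K_op (Psi \<psi>) \<sigma> 0) (\<lambda>n. left_vec (index n)) (\<lambda>n. right_vec 0 (index n))"
    by (rule K_nuclear) simp
  have trace_trunc: "trace_class (truncate t (K_op (Psi \<psi>) \<sigma> 0))" for t
    unfolding trace_class_def using nuclear_rep_truncate[OF K0] by blast
  have q: "minus_two_log_deriv2 ?T analytic_on {s}"
    if "s \<in> right_half_plane" "ennreal (mat_norm \<sigma>) * weighted_symbol_norm (Psi \<psi>) (2 * s) < 1" for s
  proof (rule minus_two_log_deriv2_analytic)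
    show "?T analytic_on {s}" using T that(1) by (auto intro: analytic_on_subset)
    show "?T s \<noteq> 0" using that by (intro fredholm_det_K_nonzero) (auto simp: right_half_plane_def)
  qed
  have q': "minus_two_log_deriv2 ?T analytic_on {of_real s}"
    if \<sigma>: "mat_norm \<sigma> \<le> 1" and s: "0 < s" and W: "weighted_symbol_norm (Psi \<psi>) (of_real s) < 1" for s :: real
  proof (rule q)
    show "of_real s \<in> right_half_plane" using s by (simp add: right_half_plane_def)
    have "ennreal (mat_norm \<sigma>) * weighted_symbol_norm (Psi \<psi>) (2 * of_real s)
        \<le> ennreal 1 * weighted_symbol_norm (Psi \<psi>) (of_real s)"
    proof (rule mult_mono)
      show "ennreal (mat_norm \<sigma>) \<le> ennreal 1" using \<sigma> by (rule ennreal_leI)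
      show "weighted_symbol_norm (Psi \<psi>) (2 * of_real s) \<le> weighted_symbol_norm (Psi \<psi>) (of_real s)"
        unfolding mult_2 by (rule weighted_symbol_norm_shift) (use s in simp_all)
    qed (rule zero_le)+
    also have "\<dots> < 1" using W by simp
    finally show "ennreal (mat_norm \<sigma>) * weighted_symbol_norm (Psi \<psi>) (2 * of_real s) < 1" .
  qed
  note pos = tau_positive_contraction[OF K0]
  show ?thesis
    unfolding Let_def
  proof (intro conjI ballI allI impI)
    show "trace_class (K_op (Psi \<psi>) \<sigma> 0)" by (rule trace) simp
    show "trace_class (truncate t (K_op (Psi \<psi>) \<sigma> 0))" for t by (rule trace_trunc)
    show "trace_class (K_op (Psi \<psi>) \<sigma> s)" if "s \<in> right_half_plane" for s
      using that by (intro trace) (simp add: right_half_plane_def)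
    show "tau (K_op (Psi \<psi>) \<sigma> 0) (2 * s) = ?T (of_real s)" if "0 < s" for s
      using that by (rule tau_K)
    show "?T analytic_on right_half_plane" by (rule T)
    show "minus_two_log_deriv2 ?T meromorphic_on right_half_plane"
      by (rule minus_two_log_deriv2_meromorphic[OF T])
    show "minus_two_log_deriv2 ?T analytic_on {s}"
      if "s \<in> right_half_plane" "ennreal (mat_norm \<sigma>) * weighted_symbol_norm (Psi \<psi>) (2 * s) < 1" for s
      using that by (rule q)
    show "minus_two_log_deriv2 ?T analytic_on {of_real s}"
      if "mat_norm \<sigma> \<le> 1" "0 < s" "weighted_symbol_norm (Psi \<psi>) (of_real s) < 1" for s
      using that by (rule q')
    assume K: "zero_le_op_le_id (K_op (Psi \<psi>) \<sigma> 0)"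
    show "tau (K_op (Psi \<psi>) \<sigma> 0) s \<in> \<real>" for s
      using pos(1)[OF K order_refl] by (simp add: complex_is_Real_iff)
    show "0 \<le> Re (tau (K_op (Psi \<psi>) \<sigma> 0) s)" for s by (rule pos(2)[OF K order_refl])
    show "mono_on {0<..} (\<lambda>s. Re (tau (K_op (Psi \<psi>) \<sigma> 0) s))"
      by (rule mono_onI) (rule pos(3)[OF K])
    show "(tau (K_op (Psi \<psi>) \<sigma> 0) \<longlongrightarrow> 1) at_top" by (rule tau_K_tendsto_1)
  qed
qed

end
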